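(* Fix $\alpha\ge0$. (i) (Bessel hard edge) Fix $d\in\mathbb N_0$. If $n_j\in\mathbb N_0$, $t_j\in\mathbb R\setminus\{0\}$, $|t_j|\to\infty$, and $n_j/|t_j|\to c\in(0,\infty)$, then $$g_{n_j}^{(\alpha,d)}(x_{t_j})\to J_\alpha(2c),\qquad |t_j|\,K_\alpha(t_j;n_j,n_j+d)\to|J_\alpha(2c)|.$$ More precisely, let $|t_j|\to\infty$ and for $c>0$ set $n_j(c)=\lfloor c|t_j|\rfloor$. For every compact interval $I\subset(0,\infty)$, $$\sup_{c\in I}\left|g_{n_j(c)}^{(\alpha,d)}(x_{t_j})-J_\alpha(2c)\right|\to0,\qquad \sup_{c\in I}\Big||t_j|\,K_\alpha(t_j;n_j(c),n_j(c)+d)-|J_\alpha(2c)|\Big|\to0.$$ (ii) (Laguerre confluence) Fix $k\in\mathbb N_0$. If $d_j\in\mathbb N_0$, $t_j\in\mathbb R\setminus\{0\}$, $d_j\to\infty$, $|t_j|\to\infty$, and $d_j/(1+t_j^2)\to u\in[0,\infty)$, then $$g_k^{(\alpha,d_j)}(x_{t_j})\to\mathcal L_k^{(\alpha)}(u),\qquad |t_j|\,K_\alpha(t_j;k,k+d_j)\to|\mathcal L_k^{(\alpha)}(u)|.$$ More precisely, for every $R>0$, as integers $d>R$ tend to infinity, $$\sup_{0\le u\le R}\left|g_k^{(\alpha,d)}\left(1-\frac{2u}d\right)-\mathcal L_k^{(\alpha)}(u)\right|\to0.$$ (iii) (Darboux interior) Fix $d\in\mathbb N_0$ and $t\ne0$,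 and put $$\phi_{\alpha,d,t}=\frac{\alpha+d+1}2\theta_t-\frac{2\alpha+1}4\pi.$$ Then, as $n\to\infty$, $$K_\alpha(t;n,n+d)=\frac{|\cos(n\theta_t+\phi_{\alpha,d,t})|}{\sqrt{\pi n|t|}}+O(n^{-3/2}),$$ and the error is uniform for $t$ in compact subsets of $\mathbb R\setminus\{0\}$.
   Context: For $\alpha>-1$, the discrete Laguerre operator $H_\alpha$ is the self-adjoint Jacobi operator on $\ell^2(\mathbb N_0)$ (with its maximal domain) associated with $$(H_\alpha u)_n=\sqrt{n(n+\alpha)}\,u_{n-1}+(2n+1+\alpha)u_n+\sqrt{(n+1)(n+1+\alpha)}\,u_{n+1},\quad u_{-1}=0.$$ $K_\alpha(t;n,m)=|e^{-itH_\alpha}(n,m)|=|\langle\delta_n,e^{-itH_\alpha}\delta_m\rangle|$. Put $x_t=\frac{t^2-1}{t^2+1}$ and, for $t\ne0$, $\theta_t=\arccos x_t=2\arctan(|t|^{-1})\in(0,\pi)$. $P_n^{(\alpha,\beta)}$ is the Jacobi polynomial in the standard normalization and $$g_n^{(\alpha,\beta)}(x)=\left[\frac{\Gamma(n+1)\Gamma(n+\alpha+\beta+1)}{\Gamma(n+\alpha+1)\Gamma(n+\beta+1)}\right]^{1/2}\left(\frac{1-x}{2}\right)^{\alpha/2}\left(\frac{1+x}{2}\right)^{\beta/2}P_n^{(\alpha,\beta)}(x)$$ (with $0^0=1$ at endpoints by continuous extension). $J_\alpha$ is the Bessel function of the first kind. $L_k^{(\alpha)}$ is the standard Laguerre polynomial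 and $$\mathcal L_k^{(\alpha)}(u)=\left[\frac{k!}{\Gamma(k+\alpha+1)}\right]^{1/2}u^{\alpha/2}e^{-u/2}L_k^{(\alpha)}(u),\quad u\ge0,$$ with endpoint value at $u=0$ by continuous extension. *)

theory Defs
  imports "HOL-Analysis.Analysis" "HOL-Library.FuncSet" "HOL-Library.Landau_Symbols"
begin

definition ell2 :: "(nat \<Rightarrow> complex) set" where
  "ell2 = {u. summable (\<lambda>n. (cmod (u n))\<^sup>2)}"

definition ell2_norm :: "(nat \<Rightarrow> complex) \<Rightarrow> real" where
  "ell2_norm u = sqrt (\<Sum>n. (cmod (u n))\<^sup>2)"

definition ell2_inner :: "(nat \<Rightarrow> complex) \<Rightarrow> (nat \<Rightarrow> complex) \<Rightarrow> complex" where
  "ell2_inner u v = (\<Sum>n. cnj (u n) * v n)"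

definition delta :: "nat \<Rightarrow> nat \<Rightarrow> complex" where
  "delta m = (\<lambda>n. if n = m then 1 else 0)"

text \<open>Operators on the Hilbert space are functions on the carrier set; they are required to be
  extensional (\<open>undefined\<close> off the carrier) so that they are determined by their values on it.\<close>

definition unitary_on_ell2 :: "((nat \<Rightarrow> complex) \<Rightarrow> (nat \<Rightarrow> complex)) \<Rightarrow> bool" where
  "unitary_on_ell2 V \<longleftrightarrow>
     V \<in> ell2 \<rightarrow>\<^sub>E ell2 \<and> V ` ell2 = ell2 \<and>
     (\<forall>u\<in>ell2. \<forall>v\<in>ell2. V (\<lambda>n. u n + v n) = (\<lambda>n. V u n + V v n)) \<and>
     (\<forall>a. \<forall>u\<in>ell2. V (\<lambda>n. a * u n) = (\<lambda>n. a * V u n)) \<and>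
     (\<forall>u\<in>ell2. \<forall>v\<in>ell2. ell2_inner (V u) (V v) = ell2_inner u v)"

definition unitary_group :: "(real \<Rightarrow> (nat \<Rightarrow> complex) \<Rightarrow> (nat \<Rightarrow> complex)) \<Rightarrow> bool" where
  "unitary_group U \<longleftrightarrow>
     (\<forall>t. unitary_on_ell2 (U t)) \<and>
     (\<forall>u\<in>ell2. U 0 u = u) \<and>
     (\<forall>s t. \<forall>u\<in>ell2. U (s + t) u = U s (U t u)) \<and>
     (\<forall>u\<in>ell2. \<forall>s. ((\<lambda>t. ell2_norm (\<lambda>n. U t u n - U s u n)) \<longlongrightarrow> 0) (at s))"

text \<open>The infinitesimal generator of \<open>U\<close> is exactly \<open>-\<i>A\<close> with domain \<open>D\<close>: the strong derivative
  of \<open>U t u\<close> at \<open>t = 0\<close> exists and equals \<open>-\<i>w\<close> if and only if \<open>u\<close> lies in \<open>D\<close> and \<open>w = A u\<close>.\<close>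

definition has_generator ::
    "(real \<Rightarrow> (nat \<Rightarrow> complex) \<Rightarrow> (nat \<Rightarrow> complex)) \<Rightarrow> (nat \<Rightarrow> complex) set \<Rightarrow>
     ((nat \<Rightarrow> complex) \<Rightarrow> (nat \<Rightarrow> complex)) \<Rightarrow> bool" where
  "has_generator U D A \<longleftrightarrow>
     (\<forall>u\<in>ell2. \<forall>w\<in>ell2.
        ((\<lambda>t. ell2_norm (\<lambda>n. (U t u n - u n) / complex_of_real t - (- \<i> * w n))) \<longlongrightarrow> 0) (at 0)
        \<longleftrightarrow> u \<in> D \<and> w = A u)"

text \<open>\<open>e\<^sup>-\<^sup>i\<^sup>t\<^sup>A\<close>: by Stone's theorem, for self-adjoint \<open>A\<close> on \<open>D\<close> there is exactly one strongly
  continuous unitary group with generator \<open>-\<i>A\<close>.\<close>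

definition exp_group ::
    "(nat \<Rightarrow> complex) set \<Rightarrow> ((nat \<Rightarrow> complex) \<Rightarrow> (nat \<Rightarrow> complex)) \<Rightarrow>
     real \<Rightarrow> (nat \<Rightarrow> complex) \<Rightarrow> (nat \<Rightarrow> complex)" where
  "exp_group D A = (THE U. unitary_group U \<and> has_generator U D A)"

definition laguerre_op :: "real \<Rightarrow> (nat \<Rightarrow> complex) \<Rightarrow> (nat \<Rightarrow> complex)" where
  "laguerre_op \<alpha> u = (\<lambda>n.
     complex_of_real (sqrt (real n * (real n + \<alpha>))) * (if n = 0 then 0 else u (n - 1))
     + complex_of_real (2 * real n + 1 + \<alpha>) * u n
     + complex_of_real (sqrt ((real n + 1) * (real n + 1 + \<alpha>))) * u (n + 1))"

definition laguerre_dom :: "real \<Rightarrow> (nat \<Rightarrow> complex) set" where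
  "laguerre_dom \<alpha> = {u \<in> ell2. laguerre_op \<alpha> u \<in> ell2}"

definition laguerre_kernel :: "real \<Rightarrow> real \<Rightarrow> nat \<Rightarrow> nat \<Rightarrow> real" where
  "laguerre_kernel \<alpha> t n m =
     cmod (ell2_inner (delta n) (exp_group (laguerre_dom \<alpha>) (laguerre_op \<alpha>) t (delta m)))"

definition x_of :: "real \<Rightarrow> real" where
  "x_of t = (t\<^sup>2 - 1) / (t\<^sup>2 + 1)"

definition theta_of :: "real \<Rightarrow> real" where
  "theta_of t = arccos (x_of t)"

text \<open>The library has \<open>0 powr a = 0\<close> for all \<open>a\<close>; here \<open>0\<^sup>0 = 1\<close>.\<close>

definition rpow :: "real \<Rightarrow> real \<Rightarrow> real" where
  "rpow x a = (if a = 0 then 1 else x powr a)"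

text \<open>The standard normalization: the value at \<open>1\<close> is \<open>(n + \<alpha>) gchoose n\<close>.\<close>

definition jacobi_poly :: "nat \<Rightarrow> real \<Rightarrow> real \<Rightarrow> real \<Rightarrow> real" where
  "jacobi_poly n \<alpha> \<beta> x =
     (\<Sum>s\<le>n. ((real n + \<alpha>) gchoose (n - s)) * ((real n + \<beta>) gchoose s) *
        ((x - 1) / 2) ^ s * ((x + 1) / 2) ^ (n - s))"

definition jacobi_fun :: "nat \<Rightarrow> real \<Rightarrow> real \<Rightarrow> real \<Rightarrow> real" where
  "jacobi_fun n \<alpha> \<beta> x =
     sqrt (Gamma (real n + 1) * Gamma (real n + \<alpha> + \<beta> + 1) /
           (Gamma (real n + \<alpha> + 1) * Gamma (real n + \<beta> + 1))) *
     rpow ((1 - x) / 2) (\<alpha> / 2) * rpow ((1 + x) / 2) (\<beta> / 2) * jacobi_poly n \<alpha> \<beta> x"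

definition laguerre_poly :: "nat \<Rightarrow> real \<Rightarrow> real \<Rightarrow> real" where
  "laguerre_poly k \<alpha> u =
     (\<Sum>i\<le>k. (- 1) ^ i * ((real k + \<alpha>) gchoose (k - i)) * u ^ i / fact i)"

definition laguerre_fun :: "nat \<Rightarrow> real \<Rightarrow> real \<Rightarrow> real" where
  "laguerre_fun k \<alpha> u =
     sqrt (fact k / Gamma (real k + \<alpha> + 1)) * rpow u (\<alpha> / 2) * exp (- u / 2) * laguerre_poly k \<alpha> u"

text \<open>Bessel function of the first kind, for nonnegative real argument; \<open>rGamma\<close> is the
  reciprocal Gamma function.\<close>

definition bessel_J :: "real \<Rightarrow> real \<Rightarrow> real" where
  "bessel_J \<alpha> x =
     (\<Sum>m. (- 1) ^ m * rGamma (real m + \<alpha> + 1) / fact m * (x / 2) ^ (2 * m)) * rpow (x / 2) \<alpha>"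

end

theory Submission
  imports Defs "HOL-Complex_Analysis.Complex_Analysis"
begin

text \<open>
  The Laguerre operator is conjugate to a first order differential operator acting on generating
  functions, whose flow is explicit. This gives the matrix of the propagator in closed form;
  because the reciprocal off-diagonal entries are not summable, square summable solutions of the
  Schroedinger equation are unique, and so this matrix really is the unitary group of the maximal
  operator. Comparing coefficients yields \<open>K(t; n, n + d) = \<bar>g\<^sub>n(x\<^sub>t)\<bar> / sqrt (1 + t\<^sup>2)\<close>, and everything
  reduces to asymptotics of Jacobi polynomials. The two confluent limits are limits under the sum
  sign in the hypergeometric representation; they hold along every convergent sequence of
  parameters, which makes them uniform on compact sets. In the interior, the three-term recurrence,
  normalised by the coefficients of \<open>(1 - z)\<^sup>-\<^sup>1\<^sup>/\<^sup>2\<close>, is a perturbation of size \<open>O(1/n\<^sup>2)\<close> of a rotation.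
  Its solutions are therefore rotations with a limiting amplitude up to \<open>O(1/n)\<close>, uniformly in the
  angle, and an Abelian argument reads the amplitude off the singularity of Jacobi's generating
  function, which in turn comes from Lagrange inversion.
\<close>

section \<open>Jacobi operators and their propagators\<close>

text \<open>\<open>exp_group\<close> is a definite description, so existence and uniqueness of a
  group whose generator has exactly the maximal domain both have to be established. Everything is
  reduced to one weak notion, coordinatewise solutions with locally bounded mass: once their mass is
  known to be constant, isometry, the group law and uniqueness of the group follow by comparing
  solutions with equal initial values. Exponential decay of the explicit columns, against linear
  growth of the matrix entries, justifies every interchange of sum, derivative and operator.

  In the interior, a contour argument would call for bounds on the generating function that stay
  uniform while its two singularities move with \<open>t\<close>. The labour is divided instead: the
  recurrence supplies the rate and the uniformity but not the amplitude, and the amplitude takes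
  only a radial limit at one singularity for each fixed angle. The normalizing weight is treated in
  the same spirit, with the rate from a telescoping estimate and the value from Euler's limit for
  the Gamma function.\<close>

abbreviation nsq :: "(nat \<Rightarrow> complex) \<Rightarrow> real" where
  "nsq u \<equiv> (\<Sum>n. (cmod (u n))\<^sup>2)"

lemma ell2D: "u \<in> ell2 \<Longrightarrow> summable (\<lambda>n. (cmod (u n))\<^sup>2)"
  by (simp add: ell2_def)

lemma ell2_boundedI:
  assumes "\<And>N. (\<Sum>n<N. (cmod (u n))\<^sup>2) \<le> C"
  shows "u \<in> ell2" "nsq u \<le> C"
proof -
  show *: "u \<in> ell2"
    unfolding ell2_def using assms by (auto intro!: summableI_nonneg_bounded)
  show "nsq u \<le> C"
    using assms ell2D[OF *] by (intro suminf_le_const)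
qed

lemma sum_le_nsq: "u \<in> ell2 \<Longrightarrow> (\<Sum>n<N. (cmod (u n))\<^sup>2) \<le> nsq u"
  by (intro sum_le_suminf) (auto simp: ell2_def)

lemma cmod_add_power2_le: "(cmod (x + y))\<^sup>2 \<le> 2 * (cmod x)\<^sup>2 + 2 * (cmod y)\<^sup>2"
proof -
  have "(cmod (x + y))\<^sup>2 \<le> (cmod x + cmod y)\<^sup>2"
    by (intro power_mono norm_triangle_ineq) auto
  also have "\<dots> \<le> 2 * (cmod x)\<^sup>2 + 2 * (cmod y)\<^sup>2"
    using zero_le_power2[of "cmod x - cmod y"] by (simp add: power2_eq_square algebra_simps)
  finally show ?thesis .
qed

lemma cmod_diff_power2_le: "(cmod (x - y))\<^sup>2 \<le> 2 * (cmod x)\<^sup>2 + 2 * (cmod y)\<^sup>2"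
  using cmod_add_power2_le[of x "- y"] by simp

lemma ell2_add: 
  assumes "u \<in> ell2" "v \<in> ell2" 
  shows "(\<lambda>n. u n + v n) \<in> ell2"
  unfolding ell2_def mem_Collect_eq
proof (rule summable_comparison_test')
  show "summable (\<lambda>n. 2 * (cmod (u n))\<^sup>2 + 2 * (cmod (v n))\<^sup>2)"
    using assms by (intro summable_add summable_mult ell2D)
qed (use cmod_add_power2_le in auto)

lemma ell2_scale: "u \<in> ell2 \<Longrightarrow> (\<lambda>n. a * u n) \<in> ell2"
  by (auto simp: ell2_def norm_mult power_mult_distrib intro: summable_mult)

lemma ell2_diff: "u \<in> ell2 \<Longrightarrow> v \<in> ell2 \<Longrightarrow> (\<lambda>n. u n - v n) \<in> ell2"
  using ell2_add[of u "\<lambda>n. (-1) * v n"] ell2_scale[of v "-1"] by simp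

lemma ell2_norm_scale: "u \<in> ell2 \<Longrightarrow> ell2_norm (\<lambda>n. a * u n) = cmod a * ell2_norm u"
  by (simp add: ell2_norm_def norm_mult power_mult_distrib suminf_mult ell2_def real_sqrt_mult)

lemma ell2_finite: "finite {n. u n \<noteq> 0} \<Longrightarrow> u \<in> ell2"
  unfolding ell2_def mem_Collect_eq
  by (rule summable_finite[of "{n. u n \<noteq> 0}"]) auto

lemma delta_ell2: "delta m \<in> ell2"
  by (rule ell2_finite) (auto simp: delta_def)

lemma ell2_inner_summable:
  assumes "u \<in> ell2" "v \<in> ell2"
  shows "summable (\<lambda>n. cnj (u n) * v n)"
proof (rule summable_comparison_test')
  show "summable (\<lambda>n. (cmod (u n))\<^sup>2 + (cmod (v n))\<^sup>2)"
    using assms by (intro summable_add ell2D)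
  show "norm (cnj (u n) * v n) \<le> (cmod (u n))\<^sup>2 + (cmod (v n))\<^sup>2" for n
  proof -
    have "0 \<le> cmod (u n) * cmod (v n)" by simp
    with sum_squares_bound[of "cmod (u n)" "cmod (v n)"]
    have "cmod (u n) * cmod (v n) \<le> (cmod (u n))\<^sup>2 + (cmod (v n))\<^sup>2" by linarith
    thus ?thesis unfolding norm_mult complex_mod_cnj .
  qed
qed

lemma ell2_inner_delta: "ell2_inner (delta n) v = v n"
proof -
  have "ell2_inner (delta n) v = (\<Sum>k. if k = n then v k else 0)"
    unfolding ell2_inner_def delta_def by (intro suminf_cong) auto
  also have "\<dots> = v n" using sums_If_finite_set[of "{n}" v] by (auto simp: sums_iff)
  finally show ?thesis .
qed

lemma ell2_inner_self: "u \<in> ell2 \<Longrightarrow> ell2_inner u u = complex_of_real (nsq u)"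
  unfolding ell2_inner_def 
  by (simp add: suminf_of_real ell2_def complex_norm_square mult.commute del: of_real_power)

lemma nsq_add_scale:
  assumes "u \<in> ell2" "v \<in> ell2"
  shows "nsq (\<lambda>n. u n + a * v n) = nsq u + (cmod a)\<^sup>2 * nsq v + 2 * Re (a * ell2_inner u v)"
proof -
  have eq: "(cmod (u n + a * v n))\<^sup>2 =
      (cmod (u n))\<^sup>2 + (cmod a)\<^sup>2 * (cmod (v n))\<^sup>2 + 2 * Re (a * (cnj (u n) * v n))" for n
    unfolding cmod_power2 by (simp add: power2_eq_square algebra_simps)
  have s: "summable (\<lambda>n. a * (cnj (u n) * v n))"
    by (intro summable_mult ell2_inner_summable assms)
  have "(\<lambda>n. (cmod (u n))\<^sup>2 + (cmod a)\<^sup>2 * (cmod (v n))\<^sup>2 + 2 * Re (a * (cnj (u n) * v n))) sums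
      (nsq u + (cmod a)\<^sup>2 * nsq v + 2 * Re (\<Sum>n. a * (cnj (u n) * v n)))"
    using assms by (intro sums_add sums_mult sums_Re summable_sums s ell2D)
  moreover have "(\<Sum>n. a * (cnj (u n) * v n)) = a * ell2_inner u v"
    unfolding ell2_inner_def by (intro suminf_mult ell2_inner_summable assms)
  ultimately show ?thesis unfolding eq by (simp add: sums_iff)
qed

text \<open>Polarization: \<open>a = 1\<close> and \<open>a = -\<i>\<close> in the cross term of
  \<open>nsq_add_scale\<close> give the real and the imaginary part of the inner product.\<close>

lemma isometric_imp_inner:
  assumes "u \<in> ell2" "v \<in> ell2" "u' \<in> ell2" "v' \<in> ell2"
    and "\<And>a. nsq (\<lambda>n. u' n + a * v' n) = nsq (\<lambda>n. u n + a * v n)"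
    and "nsq v' = nsq v"
  shows "ell2_inner u' v' = ell2_inner u v"
proof -
  have "nsq u' = nsq u" using assms(5)[of 0] by simp
  hence *: "Re (a * ell2_inner u' v') = Re (a * ell2_inner u v)" for a
    using assms(5)[of a]
    unfolding nsq_add_scale[OF assms(1,2)] nsq_add_scale[OF assms(3,4)] assms(6)
    by (simp only: add_left_cancel add_right_cancel)
  from *[of 1] *[of "-\<i>"] show ?thesis by (simp add: complex_eq_iff)
qed

text \<open>No mass can escape to infinity: the tail of \<open>w t\<close> is the common total minus
  a head, and the head converges to the head of \<open>v\<close>. So coordinatewise convergence with
  equal norms is already convergence in norm.\<close>

lemma ell2_norm_tendsto_0:
  assumes "\<And>n. ((\<lambda>t. w t n) \<longlongrightarrow> v n) F" "\<And>t. w t \<in> ell2" "v \<in> ell2" "\<And>t. nsq (w t) = nsq v"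
  shows "((\<lambda>t. ell2_norm (\<lambda>n. w t n - v n)) \<longlongrightarrow> 0) F"
proof -
  have "((\<lambda>t. nsq (\<lambda>n. w t n - v n)) \<longlongrightarrow> 0) F"
  proof (rule tendstoI)
    fix e :: real assume e: "e > 0"
    have "(\<lambda>N. nsq v - (\<Sum>n<N. (cmod (v n))\<^sup>2)) \<longlonglongrightarrow> nsq v - nsq v"
      by (intro tendsto_intros summable_LIMSEQ ell2D assms)
    hence "eventually (\<lambda>N. nsq v - (\<Sum>n<N. (cmod (v n))\<^sup>2) < e / 4) sequentially"
      by (rule order_tendstoD) (use e in auto)
    \<comment> \<open>The bound \<open>T\<close> below tends to four times this tail of
      \<open>v\<close>, hence \<open>e / 4\<close>.\<close>
    then obtain N where N: "nsq v - (\<Sum>n<N. (cmod (v n))\<^sup>2) < e / 4"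
      by (meson eventually_happens' sequentially_bot)
    define T where "T = (\<lambda>t. (\<Sum>n<N. (cmod (w t n - v n))\<^sup>2) + 2 * (nsq v - (\<Sum>n<N. (cmod (w t n))\<^sup>2))
        + 2 * (nsq v - (\<Sum>n<N. (cmod (v n))\<^sup>2)))"
    have le: "nsq (\<lambda>n. w t n - v n) \<le> T t" for t
    proof (rule ell2_boundedI(2))
      fix M
      have tail: "(\<Sum>n\<in>{..<M} - {..<N}. (cmod (x n))\<^sup>2) \<le> nsq x - (\<Sum>n<N. (cmod (x n))\<^sup>2)"
        if "x \<in> ell2" for x
      proof -
        have "(\<Sum>n\<in>{..<M} - {..<N}. (cmod (x n))\<^sup>2) + (\<Sum>n<N. (cmod (x n))\<^sup>2) =
            (\<Sum>n\<in>({..<M} - {..<N}) \<union> {..<N}. (cmod (x n))\<^sup>2)"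
          by (subst sum.union_disjoint) auto
        also have "\<dots> \<le> nsq x"
          using that by (intro sum_le_suminf) (auto simp: ell2_def)
        finally show ?thesis by simp
      qed
      have "(\<Sum>n<M. (cmod (w t n - v n))\<^sup>2) \<le> (\<Sum>n\<in>{..<N} \<union> ({..<M} - {..<N}). (cmod (w t n - v n))\<^sup>2)"
        by (intro sum_mono2) auto
      also have "\<dots> = (\<Sum>n<N. (cmod (w t n - v n))\<^sup>2) + (\<Sum>n\<in>{..<M} - {..<N}. (cmod (w t n - v n))\<^sup>2)"
        by (subst sum.union_disjoint) auto
      also have "(\<Sum>n\<in>{..<M} - {..<N}. (cmod (w t n - v n))\<^sup>2) \<le>
          (\<Sum>n\<in>{..<M} - {..<N}. 2 * (cmod (w t n))\<^sup>2 + 2 * (cmod (v n))\<^sup>2)"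
        by (intro sum_mono cmod_diff_power2_le)
      also have "\<dots> = 2 * (\<Sum>n\<in>{..<M} - {..<N}. (cmod (w t n))\<^sup>2) + 2 * (\<Sum>n\<in>{..<M} - {..<N}. (cmod (v n))\<^sup>2)"
        by (simp add: sum.distrib sum_distrib_left)
      finally show "(\<Sum>n<M. (cmod (w t n - v n))\<^sup>2) \<le> T t"
        using tail[of "w t"] tail[of v] assms(2-4) unfolding T_def by simp
    qed
    have "(T \<longlongrightarrow> (\<Sum>n<N. (cmod (v n - v n))\<^sup>2) + 2 * (nsq v - (\<Sum>n<N. (cmod (v n))\<^sup>2))
        + 2 * (nsq v - (\<Sum>n<N. (cmod (v n))\<^sup>2))) F"
      unfolding T_def by (intro tendsto_intros assms)
    hence "eventually (\<lambda>t. T t < e) F"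
      by (rule order_tendstoD) (use N in simp)
    thus "eventually (\<lambda>t. dist (nsq (\<lambda>n. w t n - v n)) 0 < e) F"
    proof eventually_elim
      case (elim t)
      have "0 \<le> nsq (\<lambda>n. w t n - v n)"
        using assms by (intro suminf_nonneg ell2D ell2_diff) auto
      thus ?case using le[of t] elim by (simp add: dist_real_def)
    qed
  qed
  from tendsto_real_sqrt[OF this] show ?thesis by (simp add: ell2_norm_def)
qed

text \<open>The formal Jacobi operator with off-diagonal entries \<open>a\<close> and diagonal \<open>b\<close>; the value \<open>a 0\<close>
  plays no role.\<close>

definition jac :: "(nat \<Rightarrow> real) \<Rightarrow> (nat \<Rightarrow> real) \<Rightarrow> (nat \<Rightarrow> complex) \<Rightarrow> nat \<Rightarrow> complex" where
  "jac a b u = (\<lambda>n. complex_of_real (a n) * (if n = 0 then 0 else u (n - 1)) +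
     complex_of_real (b n) * u n + complex_of_real (a (Suc n)) * u (Suc n))"

text \<open>A deliberately weak notion: the equation is read coordinate by coordinate and
  \<open>w t\<close> is not asked to lie in any domain. Bounding all partial sums at once also
  yields membership in \<open>ell2\<close>.\<close>

definition jac_solution ::
    "(nat \<Rightarrow> real) \<Rightarrow> (nat \<Rightarrow> real) \<Rightarrow> (real \<Rightarrow> nat \<Rightarrow> complex) \<Rightarrow> bool" where
  "jac_solution a b w \<longleftrightarrow>
     (\<forall>t n. ((\<lambda>s. w s n) has_vector_derivative - \<i> * jac a b (w t) n) (at t)) \<and>
     (\<forall>T. \<exists>C. \<forall>t N. \<bar>t\<bar> \<le> T \<longrightarrow> (\<Sum>n<N. (cmod (w t n))\<^sup>2) \<le> C)"

lemma jac_add_scale: "jac a b (\<lambda>n. u n + z * v n) n = jac a b u n + z * jac a b v n"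
  by (auto simp: jac_def algebra_simps)

lemma jac_solution_ell2:
  assumes "jac_solution a b w"
  shows "w t \<in> ell2"
proof -
  obtain C where "\<And>s N. \<bar>s\<bar> \<le> \<bar>t\<bar> \<Longrightarrow> (\<Sum>n<N. (cmod (w s n))\<^sup>2) \<le> C"
    using assms unfolding jac_solution_def by meson
  thus ?thesis using ell2_boundedI[of "w t" C] by auto
qed

lemma jac_solution_add_scale:
  assumes "jac_solution a b w" "jac_solution a b v"
  shows "jac_solution a b (\<lambda>t n. w t n + z * v t n)"
  unfolding jac_solution_def
proof (intro conjI allI)
  fix t n
  show "((\<lambda>s. w s n + z * v s n) has_vector_derivative - \<i> * jac a b (\<lambda>n. w t n + z * v t n) n) (at t)"
    using assms unfolding jac_add_scale jac_solution_def
    by (auto intro!: derivative_eq_intros simp: algebra_simps)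
next
  fix T
  obtain C where C: "\<And>t N. \<bar>t\<bar> \<le> T \<Longrightarrow> (\<Sum>n<N. (cmod (w t n))\<^sup>2) \<le> C"
    using assms unfolding jac_solution_def by meson
  obtain D where D: "\<And>t N. \<bar>t\<bar> \<le> T \<Longrightarrow> (\<Sum>n<N. (cmod (v t n))\<^sup>2) \<le> D"
    using assms unfolding jac_solution_def by meson
  have "(\<Sum>n<N. (cmod (w t n + z * v t n))\<^sup>2) \<le> 2 * C + 2 * (cmod z)\<^sup>2 * D" if "\<bar>t\<bar> \<le> T" for t N
  proof -
    have "(\<Sum>n<N. (cmod (w t n + z * v t n))\<^sup>2) \<le>
        (\<Sum>n<N. 2 * (cmod (w t n))\<^sup>2 + 2 * (cmod (z * v t n))\<^sup>2)"
      by (intro sum_mono cmod_add_power2_le)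
    also have "\<dots> = 2 * (\<Sum>n<N. (cmod (w t n))\<^sup>2) + 2 * (cmod z)\<^sup>2 * (\<Sum>n<N. (cmod (v t n))\<^sup>2)"
      by (simp add: norm_mult power_mult_distrib sum.distrib sum_distrib_left mult.assoc)
    also have "\<dots> \<le> 2 * C + 2 * (cmod z)\<^sup>2 * D"
      using C[OF that] D[OF that] by (intro add_mono mult_left_mono) auto
    finally show ?thesis .
  qed
  thus "\<exists>C. \<forall>t N. \<bar>t\<bar> \<le> T \<longrightarrow> (\<Sum>n<N. (cmod (w t n + z * v t n))\<^sup>2) \<le> C" by blast
qed

lemma jac_solution_shift:
  assumes "jac_solution a b w"
  shows "jac_solution a b (\<lambda>t. w (t + r))"
  unfolding jac_solution_def
proof (intro conjI allI)
  fix t n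
  have "((\<lambda>s. w s n) has_vector_derivative - \<i> * jac a b (w (t + r)) n) (at (t + r))"
    using assms by (auto simp: jac_solution_def)
  moreover have "((\<lambda>s. s + r) has_vector_derivative 1) (at t)"
    by (auto intro!: derivative_eq_intros)
  ultimately show "((\<lambda>s. w (s + r) n) has_vector_derivative - \<i> * jac a b (w (t + r)) n) (at t)"
    using vector_diff_chain_at[of "\<lambda>s. s + r" 1 t] by (auto simp: o_def)
next
  fix T
  obtain C where C: "\<And>t N. \<bar>t\<bar> \<le> T + \<bar>r\<bar> \<Longrightarrow> (\<Sum>n<N. (cmod (w t n))\<^sup>2) \<le> C"
    using assms unfolding jac_solution_def by meson
  show "\<exists>C. \<forall>t N. \<bar>t\<bar> \<le> T \<longrightarrow> (\<Sum>n<N. (cmod (w (t + r) n))\<^sup>2) \<le> C"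
    by (rule exI[of _ C]) (auto intro!: C)
qed

lemma has_real_derivative_cmod_power2:
  assumes "(f has_vector_derivative f') (at t)"
  shows "((\<lambda>s. (cmod (f s))\<^sup>2) has_real_derivative 2 * Re (cnj (f t) * f')) (at t)"
proof -
  have "((\<lambda>s. Re (f s)) has_real_derivative Re f') (at t)" "((\<lambda>s. Im (f s)) has_real_derivative Im f') (at t)"
    using bounded_linear.has_vector_derivative[OF bounded_linear_Re assms]
      bounded_linear.has_vector_derivative[OF bounded_linear_Im assms]
    by (auto simp: has_real_derivative_iff_has_vector_derivative)
  from DERIV_add[OF DERIV_power[OF this(1), of 2] DERIV_power[OF this(2), of 2]]
  show ?thesis by (simp add: cmod_power2 algebra_simps)
qed

text \<open>Discrete Green identity: the coefficients are real, so the diagonal terms are real and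
  the inner off-diagonal terms come in conjugate pairs; only the bond cut at \<open>N\<close>
  contributes an imaginary part.\<close>

lemma jac_green:
  "Im (\<Sum>n\<le>N. cnj (u n) * jac a b u n) = a (Suc N) * Im (cnj (u N) * u (Suc N))"
proof (induction N)
  case 0
  show ?case by (simp add: jac_def algebra_simps)
next
  case (Suc N)
  show ?case unfolding sum.atMost_Suc plus_complex.sel Suc by (simp add: jac_def algebra_simps)
qed

section \<open>Carleman's condition: conservation of mass and uniqueness of solutions\<close>

locale carleman =
  fixes a b :: "nat \<Rightarrow> real"
  assumes a_pos: "a (Suc n) > 0"
    and carleman: "\<not> summable (\<lambda>n. 1 / a (Suc n))"
begin

text \<open>Carleman's argument: the flux of the mass of \<open>{..N}\<close> is \<open>2 a\<^sub>N\<^sub>+\<^sub>1 Im (cnj w\<^sub>N w\<^sub>N\<^sub>+\<^sub>1)\<close>, so the mass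
  changes weighted by \<open>1 / a\<^sub>N\<^sub>+\<^sub>1\<close> have a bounded sum, although the weights are not summable.\<close>

lemma solution_nsq:
  assumes "jac_solution a b w"
  shows "nsq (w t) = nsq (w 0)"
proof (rule ccontr)
  assume neq: "nsq (w t) \<noteq> nsq (w 0)"
  obtain C where C: "\<And>s N. \<bar>s\<bar> \<le> \<bar>t\<bar> \<Longrightarrow> (\<Sum>n<N. (cmod (w s n))\<^sup>2) \<le> C"
    using assms unfolding jac_solution_def by meson
  define S where "S = (\<lambda>N s. \<Sum>n\<le>N. (cmod (w s n))\<^sup>2)"
  define D where "D = nsq (w t) - nsq (w 0)"
  have S_deriv: "(S N has_real_derivative 2 * a (Suc N) * Im (cnj (w s N) * w s (Suc N))) (at s)" for N s
  proof -
    have d: "((\<lambda>s. w s n) has_vector_derivative - \<i> * jac a b (w s) n) (at s)" for n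
      using assms by (simp add: jac_solution_def)
    have "(S N has_real_derivative (\<Sum>n\<le>N. 2 * Re (cnj (w s n) * (- \<i> * jac a b (w s) n)))) (at s)"
      unfolding S_def by (intro derivative_intros has_real_derivative_cmod_power2 d)
    also have "(\<Sum>n\<le>N. 2 * Re (cnj (w s n) * (- \<i> * jac a b (w s) n))) =
        2 * Im (\<Sum>n\<le>N. cnj (w s n) * jac a b (w s) n)"
      unfolding Im_sum sum_distrib_left by (intro sum.cong) (auto simp: algebra_simps)
    finally show ?thesis unfolding jac_green by (simp add: mult.assoc)
  qed
  \<comment> \<open>Division by \<open>a (Suc N)\<close> cancels the unbounded factor of the flux.
    The remaining products are summed with the mass bound \<open>C\<close>, once for
    \<open>w s N\<close> and once for \<open>w s (Suc N)\<close>.\<close>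
  define \<Phi> where "\<Phi> = (\<lambda>M s. \<Sum>N<M. S N s / a (Suc N))"
  have \<Phi>_bound: "\<bar>\<Phi> M t - \<Phi> M 0\<bar> \<le> 2 * C * \<bar>t\<bar>" for M
  proof -
    have "norm (\<Phi> M t - \<Phi> M 0) \<le> 2 * C * norm (t - 0)"
    proof (rule field_differentiable_bound[of "{-\<bar>t\<bar>..\<bar>t\<bar>}" _ "\<lambda>s. \<Sum>N<M. 2 * Im (cnj (w s N) * w s (Suc N))"])
      fix s assume s: "s \<in> {-\<bar>t\<bar>..\<bar>t\<bar>}"
      have "(\<Phi> M has_real_derivative (\<Sum>N<M. 2 * a (Suc N) * Im (cnj (w s N) * w s (Suc N)) / a (Suc N))) (at s)"
        unfolding \<Phi>_def by (intro DERIV_sum DERIV_cdivide S_deriv)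
      also have "(\<Sum>N<M. 2 * a (Suc N) * Im (cnj (w s N) * w s (Suc N)) / a (Suc N)) =
          (\<Sum>N<M. 2 * Im (cnj (w s N) * w s (Suc N)))"
        using a_pos by (intro sum.cong) (auto simp: field_simps order.strict_implies_not_eq[OF a_pos, symmetric])
      finally show "(\<Phi> M has_field_derivative (\<Sum>N<M. 2 * Im (cnj (w s N) * w s (Suc N))))
          (at s within {-\<bar>t\<bar>..\<bar>t\<bar>})" 
        by (rule has_field_derivative_at_within)
      have "norm (\<Sum>N<M. 2 * Im (cnj (w s N) * w s (Suc N))) \<le> (\<Sum>N<M. norm (2 * Im (cnj (w s N) * w s (Suc N))))"
        by (rule norm_sum)
      also have "\<dots> \<le> (\<Sum>N<M. (cmod (w s N))\<^sup>2 + (cmod (w s (Suc N)))\<^sup>2)"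
      proof (rule sum_mono)
        fix N
        have "norm (2 * Im (cnj (w s N) * w s (Suc N))) \<le> 2 * cmod (w s N) * cmod (w s (Suc N))"
          using abs_Im_le_cmod[of "cnj (w s N) * w s (Suc N)"] by (simp add: norm_mult abs_mult)
        also have "\<dots> \<le> (cmod (w s N))\<^sup>2 + (cmod (w s (Suc N)))\<^sup>2" by (rule sum_squares_bound)
        finally show "norm (2 * Im (cnj (w s N) * w s (Suc N))) \<le> (cmod (w s N))\<^sup>2 + (cmod (w s (Suc N)))\<^sup>2" .
      qed
      also have "\<dots> = (\<Sum>N<M. (cmod (w s N))\<^sup>2) + (\<Sum>N\<in>{1..<Suc M}. (cmod (w s N))\<^sup>2)"
        unfolding sum.distrib by (simp only: One_nat_def sum.shift_bounds_Suc_ivl lessThan_atLeast0)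
      also have "(\<Sum>N\<in>{1..<Suc M}. (cmod (w s N))\<^sup>2) \<le> (\<Sum>N<Suc M. (cmod (w s N))\<^sup>2)"
        by (intro sum_mono2) auto
      finally have le: "norm (\<Sum>N<M. 2 * Im (cnj (w s N) * w s (Suc N))) \<le>
          (\<Sum>N<M. (cmod (w s N))\<^sup>2) + (\<Sum>N<Suc M. (cmod (w s N))\<^sup>2)" by simp
      show "norm (\<Sum>N<M. 2 * Im (cnj (w s N) * w s (Suc N))) \<le> 2 * C"
      proof -
        have "\<bar>s\<bar> \<le> \<bar>t\<bar>" using s by auto
        with le C[of s M] C[of s "Suc M"]
        show ?thesis by linarith
      qed
    qed auto
    thus ?thesis by simp
  qed
  have lim: "(\<lambda>N. S N s) \<longlonglongrightarrow> nsq (w s)" for s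
    using summable_LIMSEQ'[OF ell2D[OF jac_solution_ell2[OF assms]]] by (simp add: S_def)
  \<comment> \<open>Dividing by \<open>D\<close> makes the limit 1 whatever the sign of the change;
    from \<open>N0\<close> on, the ratio exceeds 1/2, so each weight is at most twice the
    corresponding weighted ratio.\<close>
  have "(\<lambda>N. (S N t - S N 0) / D) \<longlonglongrightarrow> D / D"
    unfolding D_def by (intro tendsto_intros lim) (use neq in auto)
  hence "eventually (\<lambda>N. (S N t - S N 0) / D > 1 / 2) sequentially"
    by (rule order_tendstoD) (use neq in \<open>auto simp: D_def\<close>)
  then obtain N0 where N0: "\<And>N. N \<ge> N0 \<Longrightarrow> (S N t - S N 0) / D > 1 / 2"
    by (auto simp: eventually_sequentially)
  have "summable (\<lambda>n. 1 / a (Suc (n + N0)))"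
  proof (rule summableI_nonneg_bounded)
    fix M
    have eq: "(\<Sum>N<M+N0. (S N t - S N 0) / D / a (Suc N)) = (\<Phi> (M + N0) t - \<Phi> (M + N0) 0) / D" for M
      unfolding \<Phi>_def sum_subtractf[symmetric] sum_divide_distrib
      by (intro sum.cong) (auto simp: diff_divide_distrib mult.commute)
    have bd: "(\<Sum>N<M+N0. (S N t - S N 0) / D / a (Suc N)) \<le> 2 * C * \<bar>t\<bar> / \<bar>D\<bar>" for M
    proof -
      have "(\<Phi> (M + N0) t - \<Phi> (M + N0) 0) / D \<le> \<bar>\<Phi> (M + N0) t - \<Phi> (M + N0) 0\<bar> / \<bar>D\<bar>"
        by (simp flip: abs_divide)
      also have "\<dots> \<le> 2 * C * \<bar>t\<bar> / \<bar>D\<bar>" by (intro divide_right_mono \<Phi>_bound) auto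
      finally show ?thesis unfolding eq .
    qed
    define K where "K = (\<Sum>N<N0. (S N t - S N 0) / D / a (Suc N))"
    have "(\<Sum>n<M. 1 / a (Suc (n + N0))) \<le> (\<Sum>n<M. 2 * ((S (n + N0) t - S (n + N0) 0) / D / a (Suc (n + N0))))"
    proof (rule sum_mono)
      fix n
      have "1 \<le> 2 * ((S (n + N0) t - S (n + N0) 0) / D)" using N0[of "n + N0"] by linarith
      hence "1 / a (Suc (n + N0)) \<le> 2 * ((S (n + N0) t - S (n + N0) 0) / D) / a (Suc (n + N0))"
        by (intro divide_right_mono) (auto intro: less_imp_le a_pos)
      thus "1 / a (Suc (n + N0)) \<le> 2 * ((S (n + N0) t - S (n + N0) 0) / D / a (Suc (n + N0)))"
        by (simp only: times_divide_eq_right)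
    qed
    also have "\<dots> = 2 * (\<Sum>n<M. (S (n + N0) t - S (n + N0) 0) / D / a (Suc (n + N0)))"
      by (simp add: sum_distrib_left)
    also have "(\<Sum>n<M. (S (n + N0) t - S (n + N0) 0) / D / a (Suc (n + N0))) =
        (\<Sum>N<M+N0. (S N t - S N 0) / D / a (Suc N)) - K"
    proof -
      have "(\<Sum>n<M+N0. g n) - (\<Sum>n<N0. g n) = (\<Sum>n<M. g (n + N0))" for g :: "nat \<Rightarrow> real"
        by (induction M) auto
      from this[of "\<lambda>N. (S N t - S N 0) / D / a (Suc N)"] show ?thesis
        unfolding K_def by simp
    qed
    finally show "(\<Sum>n<M. 1 / a (Suc (n + N0))) \<le> 2 * (2 * C * \<bar>t\<bar> / \<bar>D\<bar> - K)"
      using bd[of M] by (rule order_trans[OF _ mult_left_mono[OF diff_right_mono]]) simp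
  qed (auto intro: less_imp_le a_pos)
  hence "summable (\<lambda>n. 1 / a (Suc n))"
    using summable_iff_shift[of "\<lambda>n. 1 / a (Suc n)" N0] by simp
  with carleman show False by blast
qed

text \<open>By linearity the difference is a solution, and its mass keeps the initial value
  0.\<close>

lemma solution_unique:
  assumes "jac_solution a b w" "jac_solution a b v" "w 0 = v 0"
  shows "w t = v t"
proof
  fix n
  have sol: "jac_solution a b (\<lambda>t n. w t n + (-1) * v t n)"
    by (intro jac_solution_add_scale assms)
  have "nsq (\<lambda>n. w t n + (-1) * v t n) = 0"
    using solution_nsq[OF sol, of t] assms(3) by simp
  moreover have "summable (\<lambda>n. (cmod (w t n + (-1) * v t n))\<^sup>2)"
    using jac_solution_ell2[OF sol] by (rule ell2D)
  ultimately have "\<forall>n. (cmod (w t n + (-1) * v t n))\<^sup>2 = 0"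
    by (subst (asm) suminf_eq_zero_iff) auto
  thus "w t n = v t n" by simp
qed

end

section \<open>From a decaying symmetric fundamental matrix to the unitary group\<close>

lemma has_vector_derivative_suminf:
  fixes f :: "nat \<Rightarrow> real \<Rightarrow> 'a :: banach"
  assumes deriv: "\<And>n s. \<bar>s\<bar> < T \<Longrightarrow> (f n has_vector_derivative f' n s) (at s)"
    and bound: "\<And>n s. \<bar>s\<bar> < T \<Longrightarrow> norm (f' n s) \<le> M n" and M: "summable M"
    and t: "\<bar>t\<bar> < T" and f: "summable (\<lambda>n. f n t)"
  shows "((\<lambda>s. \<Sum>n. f n s) has_vector_derivative (\<Sum>n. f' n t)) (at t)"
proof -
  define S where "S = {-T<..<T}"
  have S: "s \<in> S \<longleftrightarrow> \<bar>s\<bar> < T" for s by (auto simp: S_def)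
  have unif: "uniform_limit S (\<lambda>n s. \<Sum>i<n. f' i s) (\<lambda>s. \<Sum>i. f' i s) sequentially"
    by (rule Weierstrass_m_test[OF _ M]) (auto simp: S bound)
  have "\<exists>g. \<forall>s\<in>S. (\<lambda>n. f n s) sums g s \<and>
      (g has_derivative (\<lambda>h. h *\<^sub>R (\<Sum>n. f' n s))) (at s within S)"
  proof (rule has_derivative_series)
    show "convex S" by (simp add: S_def)
    show "(f n has_derivative (\<lambda>h. h *\<^sub>R f' n s)) (at s within S)" if "s \<in> S" for n s
      using deriv[of s n] that by (auto simp: S has_vector_derivative_def intro: has_derivative_at_withinI)
    show "\<forall>\<^sub>F n in sequentially. \<forall>s\<in>S. \<forall>h. norm ((\<Sum>i<n. h *\<^sub>R f' i s) - h *\<^sub>R (\<Sum>n. f' n s)) \<le> e * norm h"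
      if "e > 0" for e
      using uniform_limitD[OF unif that]
    proof eventually_elim
      case (elim n)
      have "norm ((\<Sum>i<n. h *\<^sub>R f' i s) - h *\<^sub>R (\<Sum>n. f' n s)) \<le> e * norm h" if "s \<in> S" for s h
      proof -
        have "norm ((\<Sum>i<n. h *\<^sub>R f' i s) - h *\<^sub>R (\<Sum>n. f' n s)) =
            norm h * dist (\<Sum>i<n. f' i s) (\<Sum>n. f' n s)"
          by (simp add: dist_norm flip: scaleR_right.sum scaleR_diff_right)
        also have "\<dots> \<le> norm h * e" using elim that by (intro mult_left_mono) (auto intro: less_imp_le)
        finally show ?thesis by (simp add: mult.commute)
      qed
      thus ?case by blast
    qed
    show "t \<in> S" using t by (simp add: S)
    show "(\<lambda>n. f n t) sums (\<Sum>n. f n t)" using f by (rule summable_sums)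
  qed
  then obtain g where g: "\<And>s. s \<in> S \<Longrightarrow> (\<lambda>n. f n s) sums g s"
    "\<And>s. s \<in> S \<Longrightarrow> (g has_derivative (\<lambda>h. h *\<^sub>R (\<Sum>n. f' n s))) (at s within S)" by blast
  have "(g has_derivative (\<lambda>h. h *\<^sub>R (\<Sum>n. f' n t))) (at t)"
    using g(2)[of t] t at_within_open[of t S] by (simp add: S) (simp add: S_def)
  thus ?thesis
    unfolding has_vector_derivative_def
    by (rule has_derivative_transform_within_open[where s = S]) (use t g(1) in \<open>auto simp: S_def sums_iff\<close>)
qed

lemma has_vector_derivative_at_0_iff:
  fixes f :: "real \<Rightarrow> complex"
  shows "(f has_vector_derivative f') (at 0) \<longleftrightarrow>
    ((\<lambda>h. (f h - f 0) / complex_of_real h) \<longlongrightarrow> f') (at 0)"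
proof -
  have "(f has_vector_derivative f') (at 0) \<longleftrightarrow>
      ((\<lambda>h. norm (f (0 + h) - f 0 - h *\<^sub>R f') / norm h) \<longlongrightarrow> 0) (at 0)"
    unfolding has_vector_derivative_def has_derivative_at by (simp add: bounded_linear_scaleR_left)
  also have "\<dots> \<longleftrightarrow> ((\<lambda>h. norm ((f h - f 0) / complex_of_real h - f')) \<longlongrightarrow> 0) (at 0)"
  proof (intro filterlim_cong refl eventually_mono[OF eventually_neq_at_within[of 0]])
    fix h :: real assume "h \<noteq> 0"
    hence "(f h - f 0) / complex_of_real h - f' = (f h - f 0 - complex_of_real h * f') / complex_of_real h"
      by (simp add: field_simps)
    thus "norm (f (0 + h) - f 0 - h *\<^sub>R f') / norm h = norm ((f h - f 0) / complex_of_real h - f')"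
      by (simp add: norm_divide scaleR_conv_of_real)
  qed
  also have "\<dots> \<longleftrightarrow> ((\<lambda>h. (f h - f 0) / complex_of_real h) \<longlongrightarrow> f') (at 0)"
    unfolding tendsto_norm_zero_iff by (rule LIM_zero_iff)
  finally show ?thesis .
qed

lemma summable_affine_mult_geometric:
  fixes \<rho> :: real
  assumes "0 \<le> \<rho>" "\<rho> < 1"
  shows "summable (\<lambda>n. real (Suc n) * \<rho> ^ n)"
proof (cases "\<rho> = 0")
  case False
  have "summable (\<lambda>n. diffs (\<lambda>_. 1) n * \<rho> ^ n)"
    by (rule termdiff_converges[of _ 1]) (use assms in \<open>auto intro: summable_geometric\<close>)
  thus ?thesis by (simp add: diffs_def)
qed (auto intro!: summable_finite[of "{0}"])

text \<open>\<open>c m t\<close> is a candidate for column \<open>m\<close> of the propagator. By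
  \<open>c_sym\<close> every row is also a column, so rows solve the same equation and decay
  exponentially; this absorbs the linear growth of \<open>a\<close> and \<open>b\<close> and makes
  all sums over an \<open>ell2\<close> vector absolutely convergent, locally uniformly in
  time.\<close>

locale jacobi_propagator = carleman a b for a b +
  fixes c :: "nat \<Rightarrow> real \<Rightarrow> nat \<Rightarrow> complex" and K :: real
  assumes c_deriv: "((\<lambda>s. c m s n) has_vector_derivative - \<i> * jac a b (c m t) n) (at t)"
    and c_sym: "c m t n = c n t m"
    and c_0: "c m 0 = delta m"
    and c_decay: "\<exists>(C::real) \<rho>. 0 \<le> C \<and> 0 \<le> \<rho> \<and> \<rho> < 1 \<and> (\<forall>t n. \<bar>t\<bar> \<le> T \<longrightarrow> cmod (c m t n) \<le> C * \<rho> ^ n)"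
    and a_growth: "\<bar>a n\<bar> \<le> K * Suc n" and b_growth: "\<bar>b n\<bar> \<le> K * Suc n"
begin

lemma K_nonneg: "K \<ge> 0"
  using a_growth[of 0] abs_ge_zero[of "a 0"] by simp

lemma c_solution: "jac_solution a b (c m)"
  unfolding jac_solution_def
proof (intro conjI allI c_deriv)
  fix T
  obtain C \<rho> where C: "0 \<le> C" "0 \<le> \<rho>" "\<rho> < 1" "\<And>t n. \<bar>t\<bar> \<le> T \<Longrightarrow> cmod (c m t n) \<le> C * \<rho> ^ n"
    using c_decay[of T m] by blast
  have sm: "summable (\<lambda>n. (C * \<rho> ^ n)\<^sup>2)"
  proof -
    have "(C * \<rho> ^ n)\<^sup>2 = C\<^sup>2 * (\<rho>\<^sup>2) ^ n" for n
      by (simp add: power_mult_distrib mult.commute flip: power_mult)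
    moreover have "norm (\<rho>\<^sup>2) < 1" using C(2,3) by (simp add: power_less_one_iff)
    ultimately show ?thesis by (simp add: summable_geometric summable_mult)
  qed
  have "(\<Sum>n<N. (cmod (c m t n))\<^sup>2) \<le> (\<Sum>n. (C * \<rho> ^ n)\<^sup>2)" if "\<bar>t\<bar> \<le> T" for t N
  proof -
    have "(\<Sum>n<N. (cmod (c m t n))\<^sup>2) \<le> (\<Sum>n<N. (C * \<rho> ^ n)\<^sup>2)"
      using C(4)[OF that] by (intro sum_mono power_mono) auto
    also have "\<dots> \<le> (\<Sum>n. (C * \<rho> ^ n)\<^sup>2)"
      by (rule sum_le_suminf[OF sm]) auto
    finally show ?thesis .
  qed
  thus "\<exists>C. \<forall>t N. \<bar>t\<bar> \<le> T \<longrightarrow> (\<Sum>n<N. (cmod (c m t n))\<^sup>2) \<le> C" by blast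
qed

lemma c_ell2: "c m t \<in> ell2"
  using jac_solution_ell2[OF c_solution] .

text \<open>Differentiating the symmetry of \<open>c\<close> in time shows that the operator may act
  on either index: the matrix commutes with its propagator.\<close>

lemma jac_c_sym: "jac a b (c m t) n = jac a b (c n t) m"
proof -
  have "((\<lambda>s. c m s n) has_vector_derivative - \<i> * jac a b (c n t) m) (at t)"
    using c_deriv[of n m t] by (simp add: c_sym[of m])
  from vector_derivative_unique_at[OF c_deriv this] show ?thesis by simp
qed

lemma c_sums:
  assumes "u \<in> ell2"
  shows "summable (\<lambda>m. c n t m * u m)"
proof -
  have "(\<lambda>m. cnj (c n t m)) \<in> ell2" using c_ell2[of n t] by (simp add: ell2_def)
  from ell2_inner_summable[OF this assms] show ?thesis by simp
qed

text \<open>The value off \<open>ell2\<close> is dictated by the extensionality built into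
  \<open>unitary_on_ell2\<close>.\<close>

definition prop_op :: "real \<Rightarrow> (nat \<Rightarrow> complex) \<Rightarrow> (nat \<Rightarrow> complex)" where
  "prop_op t u = (if u \<in> ell2 then (\<lambda>n. \<Sum>m. c n t m * u m) else undefined)"

lemma prop_op_apply: "u \<in> ell2 \<Longrightarrow> prop_op t u n = (\<Sum>m. c n t m * u m)"
  by (simp add: prop_op_def)

lemma prop_op_delta: "prop_op t (delta m) n = c m t n"
proof -
  have "prop_op t (delta m) n = (\<Sum>k. if k = m then c n t k else 0)"
    unfolding prop_op_apply[OF delta_ell2] by (intro suminf_cong) (auto simp: delta_def)
  also have "\<dots> = c n t m" using sums_If_finite_set[of "{m}" "c n t"] by (auto simp: sums_iff)
  finally show ?thesis by (simp add: c_sym[of m])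
qed

lemma finite_combination_solution: "jac_solution a b (\<lambda>t n. \<Sum>m<M. c m t n * u m)"
proof (induction M)
  case 0
  show ?case by (auto simp: jac_solution_def jac_def)
next
  case (Suc M)
  from jac_solution_add_scale[OF this c_solution[of M], of "u M"] show ?case
    by (simp add: mult.commute)
qed

text \<open>If \<open>u\<close> is truncated, finitely many columns are combined, which is a
  solution of constant mass; the bound survives the limit of longer and longer truncations because
  only \<open>N\<close> coordinates are inspected.\<close>

lemma sum_prop_op_le:
  assumes u: "u \<in> ell2"
  shows "(\<Sum>n<N. (cmod (prop_op t u n))\<^sup>2) \<le> nsq u"
proof -
  have "(\<lambda>M. \<Sum>n<N. (cmod (\<Sum>m<M. c m t n * u m))\<^sup>2) \<longlonglongrightarrow> (\<Sum>n<N. (cmod (prop_op t u n))\<^sup>2)"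
  proof -
    have "(\<Sum>m<M. c m t n * u m) = (\<Sum>m<M. c n t m * u m)" for M n
      by (intro sum.cong refl arg_cong2[where f = "(*)"] c_sym)
    thus ?thesis
      unfolding prop_op_apply[OF u] by (simp only:) (intro tendsto_intros summable_LIMSEQ c_sums u)
  qed
  thus ?thesis
  proof (rule LIMSEQ_le_const2, intro exI[of _ 0] allI impI)
    fix M
    have "(\<Sum>n<N. (cmod (\<Sum>m<M. c m t n * u m))\<^sup>2) \<le> nsq (\<lambda>n. \<Sum>m<M. c m t n * u m)"
      using finite_combination_solution by (intro sum_le_nsq) (rule jac_solution_ell2)
    also have "\<dots> = nsq (\<lambda>n. \<Sum>m<M. c m 0 n * u m)"
      by (rule solution_nsq[OF finite_combination_solution])
    also have "(\<lambda>n. \<Sum>m<M. c m 0 n * u m) = (\<lambda>n. if n < M then u n else 0)"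
    proof
      fix n
      have "(\<Sum>m<M. c m 0 n * u m) = (\<Sum>m<M. if n = m then u m else 0)"
        unfolding c_0 delta_def by (intro sum.cong) auto
      thus "(\<Sum>m<M. c m 0 n * u m) = (if n < M then u n else 0)" by simp
    qed
    also have "nsq (\<lambda>n. if n < M then u n else 0) = (\<Sum>n<M. (cmod (u n))\<^sup>2)"
      using sums_If_finite_set[of "{..<M}" "\<lambda>n. (cmod (u n))\<^sup>2"]
      by (simp add: sums_iff if_distrib[of cmod] if_distrib[of "\<lambda>x. x\<^sup>2"] cong: if_cong)
    also have "\<dots> \<le> nsq u" by (rule sum_le_nsq[OF u])
    finally show "(\<Sum>n<N. (cmod (\<Sum>m<M. c m t n * u m))\<^sup>2) \<le> nsq u" .
  qed
qed

lemma ell2_bound: "u \<in> ell2 \<Longrightarrow> cmod (u n) \<le> sqrt (nsq u)"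
  using member_le_sum[of n "{..n}" "\<lambda>n. (cmod (u n))\<^sup>2"] sum_le_nsq[of u "Suc n"]
  by (intro real_le_rsqrt) (simp add: lessThan_Suc_atMost)

lemma jac_c_decay:
  "\<exists>(C::real) \<rho>. 0 \<le> C \<and> 0 \<le> \<rho> \<and> \<rho> < 1 \<and> (\<forall>t n. \<bar>t\<bar> \<le> T \<longrightarrow> cmod (jac a b (c m t) n) \<le> C * (real (Suc n) * \<rho> ^ n))"
proof -
  obtain C \<rho> where C: "0 \<le> C" "0 \<le> \<rho>" "\<rho> < 1" "\<And>t n. \<bar>t\<bar> \<le> T \<Longrightarrow> cmod (c m t n) \<le> C * \<rho> ^ n"
    using c_decay[of T m] by blast
  \<comment> \<open>A ratio of at least 1/2 gives
    \<open>\<sigma> ^ (n - 1) \<le> 2 * \<sigma> ^ n\<close>, which absorbs the backward shift in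
    \<open>jac\<close>. The factor 5 below is 2 + 1 + 2 from the three diagonals.\<close>
  define \<sigma> where "\<sigma> = max \<rho> (1/2)"
  have \<sigma>: "0 < \<sigma>" "\<sigma> < 1" "\<rho> \<le> \<sigma>" "1 / 2 \<le> \<sigma>" using C by (auto simp: \<sigma>_def)
  have c_le: "cmod (c m t n) \<le> C * \<sigma> ^ n" if "\<bar>t\<bar> \<le> T" for t n
    using C(4)[OF that, of n] mult_left_mono[OF power_mono[OF \<sigma>(3) C(2), of n] C(1)] by linarith
  have "cmod (jac a b (c m t) n) \<le> (5 * K * C) * (real (Suc n) * \<sigma> ^ n)" if t: "\<bar>t\<bar> \<le> T" for t n
  proof -
    have K: "K \<ge> 0" by (rule K_nonneg)
    have 1: "cmod (complex_of_real (a n) * (if n = 0 then 0 else c m t (n - 1))) \<le> (K * Suc n) * (C * (2 * \<sigma> ^ n))"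
      unfolding norm_mult norm_of_real
    proof (intro mult_mono a_growth)
      have "\<sigma> ^ (n - 1) \<le> 2 * \<sigma> ^ n" if "n \<noteq> 0"
        using that \<sigma> mult_right_mono[of 1 "2 * \<sigma>" "\<sigma> ^ (n - 1)"] by (cases n) auto
      hence "n \<noteq> 0 \<Longrightarrow> C * \<sigma> ^ (n - 1) \<le> C * (2 * \<sigma> ^ n)" using C by (intro mult_left_mono) auto
      thus "cmod (if n = 0 then 0 else c m t (n - 1)) \<le> C * (2 * \<sigma> ^ n)"
        using c_le[OF t, of "n - 1"] C \<sigma> by (auto intro: order_trans)
    qed (use K in auto)
    have 2: "cmod (complex_of_real (b n) * c m t n) \<le> (K * Suc n) * (C * \<sigma> ^ n)"
      unfolding norm_mult norm_of_real by (intro mult_mono b_growth c_le t) (use K in auto)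
    have 3: "cmod (complex_of_real (a (Suc n)) * c m t (Suc n)) \<le> (K * (2 * Suc n)) * (C * \<sigma> ^ n)"
      unfolding norm_mult norm_of_real
    proof (intro mult_mono)
      have "K * Suc (Suc n) \<le> K * (2 * Suc n)" using K by (intro mult_left_mono) auto
      thus "\<bar>a (Suc n)\<bar> \<le> K * (2 * Suc n)" using a_growth[of "Suc n"] by linarith
      have "\<sigma> ^ Suc n \<le> \<sigma> ^ n" using \<sigma> by (simp add: mult_left_le_one_le)
      hence "C * \<sigma> ^ Suc n \<le> C * \<sigma> ^ n" using C by (intro mult_left_mono) auto
      thus "cmod (c m t (Suc n)) \<le> C * \<sigma> ^ n" using c_le[OF t, of "Suc n"] by linarith
    qed (use K in auto)
    have "cmod (jac a b (c m t) n) \<le> (K * Suc n) * (C * (2 * \<sigma> ^ n)) + (K * Suc n) * (C * \<sigma> ^ n) + (K * (2 * Suc n)) * (C * \<sigma> ^ n)"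
      unfolding jac_def by (intro order_trans[OF norm_triangle_ineq] add_mono 1 2 3)
    thus ?thesis by (simp add: algebra_simps)
  qed
  moreover have "0 \<le> 5 * K * C" using K_nonneg C by simp
  ultimately show ?thesis using \<sigma> by (metis less_imp_le)
qed

lemma prop_op_deriv':
  assumes u: "u \<in> ell2"
  shows "((\<lambda>s. prop_op s u n) has_vector_derivative - \<i> * (\<Sum>m. jac a b (c n t) m * u m)) (at t)"
    and "summable (\<lambda>m. jac a b (c n t) m * u m)"
proof -
  \<comment> \<open>One unit of slack makes \<open>t\<close> an interior point of the interval on
    which the derivatives are dominated.\<close>
  define T where "T = \<bar>t\<bar> + 1"
  obtain C \<rho> where C: "0 \<le> C" "0 \<le> \<rho>" "\<rho> < 1"
    "\<And>t m. \<bar>t\<bar> \<le> T \<Longrightarrow> cmod (jac a b (c n t) m) \<le> C * (real (Suc m) * \<rho> ^ m)"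
    using jac_c_decay[of T n] by blast
  have le: "norm (jac a b (c n s) m * u m) \<le> C * (real (Suc m) * \<rho> ^ m) * sqrt (nsq u)" if "\<bar>s\<bar> < T" for s m
    unfolding norm_mult using C that by (intro mult_mono ell2_bound u) auto
  have sm: "summable (\<lambda>m. C * (real (Suc m) * \<rho> ^ m) * sqrt (nsq u))"
    by (intro summable_mult summable_mult2 summable_affine_mult_geometric C)
  show s: "summable (\<lambda>m. jac a b (c n t) m * u m)"
    by (rule summable_comparison_test'[OF sm]) (use le[of t] in \<open>auto simp: T_def\<close>)
  have "((\<lambda>s. \<Sum>m. c n s m * u m) has_vector_derivative (\<Sum>m. - \<i> * (jac a b (c n t) m * u m))) (at t)"
  proof (rule has_vector_derivative_suminf[OF _ _ sm, where T = T])
    show "((\<lambda>s. c n s m * u m) has_vector_derivative - \<i> * (jac a b (c n s) m * u m)) (at s)" for m s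
      using has_vector_derivative_mult_left[OF c_deriv[of n m s], of "u m"] by (simp add: mult.assoc)
    show "norm (- \<i> * (jac a b (c n s) m * u m)) \<le> C * (real (Suc m) * \<rho> ^ m) * sqrt (nsq u)" if "\<bar>s\<bar> < T" for s m
      using le[OF that, of m] by (simp add: norm_mult)
  qed (auto simp: T_def intro: c_sums u)
  thus "((\<lambda>s. prop_op s u n) has_vector_derivative - \<i> * (\<Sum>m. jac a b (c n t) m * u m)) (at t)"
    unfolding prop_op_apply[OF u] using suminf_mult[OF s, of "- \<i>"] by simp
qed

text \<open>\<open>jac_c_sym\<close> moves the operator from the summation index to the free index,
  where it merely combines three convergent series.\<close>

lemma prop_op_solution:
  assumes u: "u \<in> ell2"
  shows "jac_solution a b (\<lambda>t. prop_op t u)"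
  unfolding jac_solution_def
proof (intro conjI allI)
  fix t n
  have "(\<Sum>m. jac a b (c n t) m * u m) = (\<Sum>m. complex_of_real (a n) * (if n = 0 then 0 else c (n - 1) t m * u m) +
      complex_of_real (b n) * (c n t m * u m) + complex_of_real (a (Suc n)) * (c (Suc n) t m * u m))"
  proof (rule suminf_cong)
    fix m
    show "jac a b (c n t) m * u m = complex_of_real (a n) * (if n = 0 then 0 else c (n - 1) t m * u m) +
      complex_of_real (b n) * (c n t m * u m) + complex_of_real (a (Suc n)) * (c (Suc n) t m * u m)"
      unfolding jac_c_sym[of n t m] by (simp add: jac_def algebra_simps c_sym[of m])
  qed
  also have "\<dots> = jac a b (prop_op t u) n"
  proof -
    have 0: "summable (\<lambda>m. if n = 0 then 0 else c (n - 1) t m * u m)" using c_sums[OF u] by (cases n) auto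
    have "(\<Sum>m. complex_of_real (a n) * (if n = 0 then 0 else c (n - 1) t m * u m) +
        complex_of_real (b n) * (c n t m * u m) + complex_of_real (a (Suc n)) * (c (Suc n) t m * u m)) =
        complex_of_real (a n) * (\<Sum>m. if n = 0 then 0 else c (n - 1) t m * u m) +
        complex_of_real (b n) * (\<Sum>m. c n t m * u m) + complex_of_real (a (Suc n)) * (\<Sum>m. c (Suc n) t m * u m)"
      by (intro sums_unique[symmetric] sums_add sums_mult summable_sums c_sums u 0)
    thus ?thesis unfolding jac_def prop_op_apply[OF u] by (cases n) auto
  qed
  finally have eq: "(\<Sum>m. jac a b (c n t) m * u m) = jac a b (prop_op t u) n" .
  show "((\<lambda>s. prop_op s u n) has_vector_derivative - \<i> * jac a b (prop_op t u) n) (at t)"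
    using prop_op_deriv'(1)[OF u, of n t] unfolding eq .
qed (use sum_prop_op_le[OF u] in blast)

lemma prop_op_0: "u \<in> ell2 \<Longrightarrow> prop_op 0 u = u"
proof
  fix n assume "u \<in> ell2"
  hence "prop_op 0 u n = (\<Sum>m. if m = n then u m else 0)"
    unfolding prop_op_apply[OF \<open>u \<in> ell2\<close>] c_0 delta_def by (intro suminf_cong) auto
  also have "\<dots> = u n" using sums_If_finite_set[of "{n}" u] by (auto simp: sums_iff)
  finally show "prop_op 0 u n = u n" .
qed

lemma prop_op_ell2: "u \<in> ell2 \<Longrightarrow> prop_op t u \<in> ell2"
  by (rule jac_solution_ell2[OF prop_op_solution])

lemma nsq_prop_op: "u \<in> ell2 \<Longrightarrow> nsq (prop_op t u) = nsq u"
  using solution_nsq[OF prop_op_solution, of u t] by (simp add: prop_op_0)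

text \<open>Both sides solve the equation in \<open>s\<close> and agree at
  \<open>s = 0\<close>.\<close>

lemma prop_op_group: "u \<in> ell2 \<Longrightarrow> prop_op (s + t) u = prop_op s (prop_op t u)"
  using solution_unique[OF jac_solution_shift[OF prop_op_solution, of u t]
    prop_op_solution[OF prop_op_ell2, of u t], of s] by (simp add: prop_op_0 prop_op_ell2)

lemma prop_op_add_scale:
  assumes "u \<in> ell2" "v \<in> ell2"
  shows "prop_op t (\<lambda>n. u n + z * v n) = (\<lambda>n. prop_op t u n + z * prop_op t v n)"
proof
  fix n
  have "(\<lambda>n. u n + z * v n) \<in> ell2" by (intro ell2_add ell2_scale assms)
  hence "prop_op t (\<lambda>n. u n + z * v n) n = (\<Sum>m. c n t m * u m + z * (c n t m * v m))"
    by (simp add: prop_op_apply algebra_simps)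
  also have "\<dots> = prop_op t u n + z * prop_op t v n"
    unfolding prop_op_apply[OF assms(1)] prop_op_apply[OF assms(2)]
    by (intro sums_unique[symmetric] sums_add sums_mult summable_sums c_sums assms)
  finally show "prop_op t (\<lambda>n. u n + z * v n) n = prop_op t u n + z * prop_op t v n" .
qed

lemma prop_op_unitary: "unitary_on_ell2 (prop_op t)"
  unfolding unitary_on_ell2_def
proof (intro conjI ballI allI)
  show "prop_op t \<in> ell2 \<rightarrow>\<^sub>E ell2"
    using prop_op_ell2 by (auto simp: PiE_def extensional_def prop_op_def)
  show "prop_op t ` ell2 = ell2"
  proof (intro equalityI subsetI)
    fix u assume "u \<in> ell2"
    thus "u \<in> prop_op t ` ell2"
      using prop_op_group[of u t "-t"] by (intro image_eqI[of _ _ "prop_op (-t) u"]) (auto simp: prop_op_0 prop_op_ell2)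
  qed (use prop_op_ell2 in auto)
  show "prop_op t (\<lambda>n. u n + v n) = (\<lambda>n. prop_op t u n + prop_op t v n)" if "u \<in> ell2" "v \<in> ell2" for u v
    using prop_op_add_scale[OF that, of t 1] by simp
  show "prop_op t (\<lambda>n. z * u n) = (\<lambda>n. z * prop_op t u n)" if "u \<in> ell2" for u z
  proof -
    have 0: "(\<lambda>_. 0) \<in> ell2" by (simp add: ell2_def)
    have "prop_op t (\<lambda>_. 0) = (\<lambda>_. 0)" using 0 by (auto simp: prop_op_apply)
    thus ?thesis using prop_op_add_scale[OF 0 that, of t z] by simp
  qed
  show "ell2_inner (prop_op t u) (prop_op t v) = ell2_inner u v" if "u \<in> ell2" "v \<in> ell2" for u v
  proof (rule isometric_imp_inner)
    show "nsq (\<lambda>n. prop_op t u n + z * prop_op t v n) = nsq (\<lambda>n. u n + z * v n)" for z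
    proof -
      have "nsq (prop_op t (\<lambda>n. u n + z * v n)) = nsq (\<lambda>n. u n + z * v n)"
        by (intro nsq_prop_op ell2_add ell2_scale that)
      thus ?thesis unfolding prop_op_add_scale[OF that] .
    qed
  qed (auto simp: that prop_op_ell2 nsq_prop_op)
qed

lemma prop_op_continuous:
  assumes "u \<in> ell2"
  shows "((\<lambda>t. ell2_norm (\<lambda>n. prop_op t u n - prop_op s u n)) \<longlongrightarrow> 0) (at s)"
proof (rule ell2_norm_tendsto_0)
  fix n
  have "((\<lambda>t. prop_op t u n) has_vector_derivative - \<i> * jac a b (prop_op s u) n) (at s)"
    using prop_op_solution[OF assms] by (simp add: jac_solution_def)
  from has_vector_derivative_continuous[OF this]
  show "((\<lambda>t. prop_op t u n) \<longlongrightarrow> prop_op s u n) (at s)" by (simp add: isCont_def)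
qed (auto simp: assms prop_op_ell2 nsq_prop_op)

lemma prop_op_unitary_group: "unitary_group prop_op"
  unfolding unitary_group_def using prop_op_unitary prop_op_0 prop_op_group prop_op_continuous by blast

text \<open>Summation by parts transfers the operator from the rows of the propagator to
  \<open>u\<close>. In contrast to \<open>prop_op_solution\<close>, the derivative is then the
  propagated image of the fixed vector \<open>jac a b u\<close>, whose norm is under
  control.\<close>

lemma prop_op_jac:
  assumes u: "u \<in> ell2" and Hu: "jac a b u \<in> ell2"
  shows "((\<lambda>s. prop_op s u n) has_vector_derivative - \<i> * prop_op t (jac a b u) n) (at t)"
proof -
  \<comment> \<open>Lagrange identity: symmetry leaves only a boundary term at the cut. There the
    exponential decay of \<open>c\<close> beats the linear growth of \<open>a\<close>, the entries
    of \<open>u\<close> being bounded.\<close>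
  have sums: "(\<Sum>m\<le>M. jac a b (c n t) m * u m) - (\<Sum>m\<le>M. c n t m * jac a b u m) =
      a (Suc M) * (c n t (Suc M) * u M - c n t M * u (Suc M))" for M
  proof (induction M)
    case 0
    show ?case by (simp add: jac_def algebra_simps)
  next
    case (Suc M)
    have "(\<Sum>m\<le>Suc M. jac a b (c n t) m * u m) - (\<Sum>m\<le>Suc M. c n t m * jac a b u m) =
      a (Suc M) * (c n t (Suc M) * u M - c n t M * u (Suc M)) +
      (jac a b (c n t) (Suc M) * u (Suc M) - c n t (Suc M) * jac a b u (Suc M))"
      unfolding Suc[symmetric] by simp
    thus ?case by (simp add: jac_def algebra_simps)
  qed
  obtain C \<rho> where C: "0 \<le> C" "0 \<le> \<rho>" "\<rho> < 1" "\<And>s m. \<bar>s\<bar> \<le> \<bar>t\<bar> \<Longrightarrow> cmod (c n s m) \<le> C * \<rho> ^ m"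
    using c_decay[of "\<bar>t\<bar>" n] by blast
  have lim0: "(\<lambda>M. complex_of_real (a (Suc M)) * (c n t (Suc M) * u M - c n t M * u (Suc M))) \<longlonglongrightarrow> 0"
  proof (rule Lim_null_comparison)
    have "(\<lambda>M. 4 * K * C * sqrt (nsq u) * (real (Suc M) * \<rho> ^ M)) \<longlonglongrightarrow> 4 * K * C * sqrt (nsq u) * 0"
      by (intro tendsto_intros summable_LIMSEQ_zero summable_affine_mult_geometric C)
    thus "(\<lambda>M. 4 * K * C * sqrt (nsq u) * (real (Suc M) * \<rho> ^ M)) \<longlonglongrightarrow> 0" by simp
    show "\<forall>\<^sub>F M in sequentially. norm (complex_of_real (a (Suc M)) * (c n t (Suc M) * u M - c n t M * u (Suc M)))
        \<le> 4 * K * C * sqrt (nsq u) * (real (Suc M) * \<rho> ^ M)"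
    proof (intro always_eventually allI)
      fix M
      have 1: "\<bar>a (Suc M)\<bar> \<le> K * (2 * real (Suc M))"
        using a_growth[of "Suc M"] mult_left_mono[of "real (Suc (Suc M))" "2 * real (Suc M)" K] K_nonneg by simp
      have "\<rho> ^ Suc M \<le> \<rho> ^ M" using C by (simp add: mult_left_le_one_le)
      hence "cmod (c n t (Suc M)) \<le> C * \<rho> ^ M" 
        using C(4)[of t "Suc M"] mult_left_mono[of "\<rho> ^ Suc M" "\<rho> ^ M" C] C(1) by linarith
      hence 2: "cmod (c n t (Suc M) * u M) \<le> C * \<rho> ^ M * sqrt (nsq u)"
        unfolding norm_mult using C by (intro mult_mono ell2_bound u) auto
      have 3: "cmod (c n t M * u (Suc M)) \<le> C * \<rho> ^ M * sqrt (nsq u)"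
        unfolding norm_mult using C by (intro mult_mono ell2_bound u) auto
      have "norm (c n t (Suc M) * u M - c n t M * u (Suc M)) \<le> 2 * (C * \<rho> ^ M * sqrt (nsq u))"
        using norm_triangle_ineq4[of "c n t (Suc M) * u M" "c n t M * u (Suc M)"] 2 3 by linarith
      hence "norm (complex_of_real (a (Suc M)) * (c n t (Suc M) * u M - c n t M * u (Suc M))) \<le>
        (K * (2 * real (Suc M))) * (2 * (C * \<rho> ^ M * sqrt (nsq u)))"
        unfolding norm_mult norm_of_real using 1 K_nonneg by (intro mult_mono) auto
      thus "norm (complex_of_real (a (Suc M)) * (c n t (Suc M) * u M - c n t M * u (Suc M))) \<le>
        4 * K * C * sqrt (nsq u) * (real (Suc M) * \<rho> ^ M)" by (simp add: algebra_simps)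
    qed
  qed
  have "(\<lambda>M. (\<Sum>m\<le>M. jac a b (c n t) m * u m) - (\<Sum>m\<le>M. c n t m * jac a b u m)) \<longlonglongrightarrow>
      (\<Sum>m. jac a b (c n t) m * u m) - (\<Sum>m. c n t m * jac a b u m)"
    by (intro tendsto_diff summable_LIMSEQ' prop_op_deriv'(2) c_sums u Hu)
  from LIMSEQ_unique[OF this lim0[folded sums]]
  have "(\<Sum>m. jac a b (c n t) m * u m) = prop_op t (jac a b u) n"
    by (simp add: prop_op_apply Hu)
  thus ?thesis using prop_op_deriv'(1)[OF u, of n t] by simp
qed

text \<open>By \<open>prop_op_jac\<close> each coordinate has the propagated vector
  \<open>jac a b u\<close>, up to the factor \<open>- \<i>\<close>, as derivative, and that vector
  moves continuously in norm; a mean value estimate turns this into a derivative in norm.\<close>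

lemma prop_op_strong_derivative:
  assumes u: "u \<in> ell2" and Hu: "jac a b u \<in> ell2"
  shows "((\<lambda>t. ell2_norm (\<lambda>n. (prop_op t u n - u n) / complex_of_real t - (- \<i> * jac a b u n))) \<longlongrightarrow> 0) (at 0)"
proof (rule tendstoI)
  fix e :: real assume e: "e > 0"
  define v where "v = (\<lambda>s n. prop_op s (jac a b u) n - jac a b u n)"
  have v: "v s \<in> ell2" for s unfolding v_def by (intro ell2_diff prop_op_ell2 Hu)
  have "((\<lambda>s. ell2_norm (v s)) \<longlongrightarrow> 0) (at 0)"
    using prop_op_continuous[OF Hu, of 0] by (simp add: v_def prop_op_0 Hu)
  hence "eventually (\<lambda>s. ell2_norm (v s) < e / 2) (at 0)"
    by (rule order_tendstoD) (use e in auto)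
  then obtain r where r: "r > 0" "\<And>s. s \<noteq> 0 \<Longrightarrow> \<bar>s\<bar> < r \<Longrightarrow> ell2_norm (v s) < e / 2"
    by (auto simp: eventually_at)
  have r': "ell2_norm (v s) \<le> e / 2" if "\<bar>s\<bar> < r" for s
    using r(2)[of s] that e by (cases "s = 0") (auto simp: v_def prop_op_0 Hu ell2_norm_def)
  have main: "dist (ell2_norm (\<lambda>n. (prop_op t u n - u n) / complex_of_real t - (- \<i> * jac a b u n))) 0 < e"
    if t: "t \<noteq> 0" "\<bar>t\<bar> < r" for t
  proof -
    define f where "f = (\<lambda>s n. prop_op s u n - u n + \<i> * of_real s * jac a b u n)"
    have f0: "f 0 n = 0" for n by (simp add: f_def prop_op_0 u)
    have f_deriv: "((\<lambda>s. f s n) has_vector_derivative - \<i> * v s n) (at s)" for s n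
      unfolding f_def v_def
      by (rule derivative_eq_intros prop_op_jac u Hu refl | simp)+ (simp add: algebra_simps)
    have bound: "(\<Sum>n<N. (cmod (f t n))\<^sup>2) \<le> (\<bar>t\<bar> * (e / 2))\<^sup>2" for N
    proof -
      define Y where "Y = L2_set (\<lambda>n. cmod (f t n)) {..<N}"
      have Y2: "Y\<^sup>2 = (\<Sum>n<N. (cmod (f t n))\<^sup>2)" by (simp add: Y_def L2_set_def sum_nonneg)
      have Y0: "Y \<ge> 0" by (simp add: Y_def)
      \<comment> \<open>Pairing \<open>f s\<close> with the fixed vector \<open>f t\<close>, cut at
        \<open>N\<close>, gives a scalar function that is 0 at time 0 and \<open>Y\<^sup>2\<close>
        at time \<open>t\<close>. By Cauchy-Schwarz its derivative is at most
        \<open>Y * (e / 2)\<close>, so one factor \<open>Y\<close> cancels.\<close>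
      define \<phi> where "\<phi> = (\<lambda>s. Re (\<Sum>n<N. cnj (f t n) * f s n))"
      have "norm (\<phi> t - \<phi> 0) \<le> Y * (e / 2) * norm (t - 0)"
      proof (rule field_differentiable_bound[of "{-\<bar>t\<bar>..\<bar>t\<bar>}" _ "\<lambda>s. Re (\<Sum>n<N. cnj (f t n) * (- \<i> * v s n))"])
        fix s assume s: "s \<in> {-\<bar>t\<bar>..\<bar>t\<bar>}"
        have "((\<lambda>s. \<Sum>n<N. cnj (f t n) * f s n) has_vector_derivative (\<Sum>n<N. cnj (f t n) * (- \<i> * v s n))) (at s)"
          by (intro has_vector_derivative_sum has_vector_derivative_mult_right f_deriv)
        from bounded_linear.has_vector_derivative[OF bounded_linear_Re this]
        show "(\<phi> has_field_derivative Re (\<Sum>n<N. cnj (f t n) * (- \<i> * v s n))) (at s within {-\<bar>t\<bar>..\<bar>t\<bar>})"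
          unfolding \<phi>_def has_real_derivative_iff_has_vector_derivative by (rule has_vector_derivative_at_within)
        have "norm (Re (\<Sum>n<N. cnj (f t n) * (- \<i> * v s n))) \<le> cmod (\<Sum>n<N. cnj (f t n) * (- \<i> * v s n))"
          unfolding real_norm_def by (rule abs_Re_le_cmod)
        also have "\<dots> \<le> (\<Sum>n<N. cmod (cnj (f t n) * (- \<i> * v s n)))" by (rule norm_sum)
        also have "\<dots> = (\<Sum>n<N. \<bar>cmod (f t n)\<bar> * \<bar>cmod (v s n)\<bar>)" by (simp add: norm_mult)
        also have "\<dots> \<le> Y * L2_set (\<lambda>n. cmod (v s n)) {..<N}"
          unfolding Y_def by (rule L2_set_mult_ineq)
        also have "\<dots> \<le> Y * (e / 2)"
        proof (intro mult_left_mono Y0)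
          have "L2_set (\<lambda>n. cmod (v s n)) {..<N} \<le> ell2_norm (v s)"
            unfolding L2_set_def ell2_norm_def by (intro real_sqrt_le_mono sum_le_nsq v)
          also have "\<dots> \<le> e / 2" using s t by (intro r') auto
          finally show "L2_set (\<lambda>n. cmod (v s n)) {..<N} \<le> e / 2" .
        qed
        finally show "norm (Re (\<Sum>n<N. cnj (f t n) * (- \<i> * v s n))) \<le> Y * (e / 2)" .
      qed auto
      moreover have "\<phi> t = Y\<^sup>2"
      proof -
        have "(\<Sum>n<N. cnj (f t n) * f t n) = complex_of_real (\<Sum>n<N. (cmod (f t n))\<^sup>2)"
          unfolding of_real_sum complex_norm_square by (simp add: mult.commute)
        thus ?thesis unfolding Y2 \<phi>_def by simp
      qed
      moreover have "\<phi> 0 = 0" by (simp add: \<phi>_def f0)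
      ultimately have "Y\<^sup>2 \<le> Y * (e / 2) * \<bar>t\<bar>" by simp
      hence "Y * Y \<le> Y * (\<bar>t\<bar> * (e / 2))" by (simp add: power2_eq_square mult_ac)
      hence "Y \<le> \<bar>t\<bar> * (e / 2)" using Y0 e by (cases "Y = 0") (auto simp: mult_le_cancel_left)
      hence "Y\<^sup>2 \<le> (\<bar>t\<bar> * (e / 2))\<^sup>2" by (intro power_mono Y0)
      thus ?thesis unfolding Y2 .
    qed
    have ft: "f t \<in> ell2" "nsq (f t) \<le> (\<bar>t\<bar> * (e / 2))\<^sup>2"
      using ell2_boundedI[OF bound] by auto
    have "(\<lambda>n. (prop_op t u n - u n) / complex_of_real t - (- \<i> * jac a b u n)) =
        (\<lambda>n. inverse (complex_of_real t) * f t n)"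
      using t by (auto simp: f_def fun_eq_iff field_simps)
    moreover have "ell2_norm (\<lambda>n. inverse (complex_of_real t) * f t n) = ell2_norm (f t) / \<bar>t\<bar>"
      by (simp only: ell2_norm_scale[OF ft(1)] norm_inverse norm_of_real divide_inverse mult.commute)
    moreover have "ell2_norm (f t) \<le> \<bar>t\<bar> * (e / 2)"
      using real_sqrt_le_mono[OF ft(2)] e by (simp add: ell2_norm_def)
    moreover have "ell2_norm (f t) \<ge> 0" using ft by (simp add: ell2_norm_def suminf_nonneg ell2D)
    ultimately have "ell2_norm (\<lambda>n. (prop_op t u n - u n) / complex_of_real t - (- \<i> * jac a b u n)) = ell2_norm (f t) / \<bar>t\<bar>"
      and "ell2_norm (f t) / \<bar>t\<bar> \<le> e / 2" and "0 \<le> ell2_norm (f t) / \<bar>t\<bar>"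
      using t by (simp_all only:) (simp_all add: field_simps)
    thus ?thesis using e by (simp only: dist_real_def)
  qed
  show "eventually (\<lambda>t. dist (ell2_norm (\<lambda>n. (prop_op t u n - u n) / complex_of_real t - (- \<i> * jac a b u n))) 0 < e) (at 0)"
    unfolding eventually_at using r(1) main by (intro exI[of _ r]) auto
qed

text \<open>A limit in norm is a limit in every coordinate, and the coordinatewise derivative at 0
  is \<open>jac a b u\<close>; hence \<open>w\<close> can only be this sequence, and being in
  \<open>ell2\<close> it puts \<open>u\<close> into the maximal domain.\<close>

lemma prop_op_generator: "has_generator prop_op {u \<in> ell2. jac a b u \<in> ell2} (jac a b)"
  unfolding has_generator_def
proof (intro ballI iffI)
  fix u w
  assume u: "u \<in> ell2" and w: "w \<in> ell2"
    and lim: "((\<lambda>t. ell2_norm (\<lambda>n. (prop_op t u n - u n) / complex_of_real t - (- \<i> * w n))) \<longlongrightarrow> 0) (at 0)"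
  have "w n = jac a b u n" for n
  proof -
    have "((\<lambda>t. (prop_op t u n - u n) / complex_of_real t - (- \<i> * w n)) \<longlongrightarrow> 0) (at 0)"
    proof (rule Lim_null_comparison[OF _ lim], intro always_eventually allI)
      fix t
      have "(\<lambda>n. (1 / complex_of_real t) * (prop_op t u n - u n) - (- \<i> * w n)) \<in> ell2"
        by (intro ell2_diff ell2_scale prop_op_ell2 u w)
      hence "(\<lambda>n. (prop_op t u n - u n) / complex_of_real t - (- \<i> * w n)) \<in> ell2" by simp
      from ell2_bound[OF this, of n]
      show "norm ((prop_op t u n - u n) / complex_of_real t - (- \<i> * w n)) \<le>
          ell2_norm (\<lambda>n. (prop_op t u n - u n) / complex_of_real t - (- \<i> * w n))"
        by (simp only: ell2_norm_def)
    qed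
    from tendsto_add[OF this tendsto_const[of "- \<i> * w n"]]
    have 1: "((\<lambda>t. (prop_op t u n - u n) / complex_of_real t) \<longlongrightarrow> - \<i> * w n) (at 0)" by simp
    have "((\<lambda>s. prop_op s u n) has_vector_derivative - \<i> * jac a b (prop_op 0 u) n) (at 0)"
      using prop_op_solution[OF u] unfolding jac_solution_def by blast
    hence 2: "((\<lambda>t. (prop_op t u n - u n) / complex_of_real t) \<longlongrightarrow> - \<i> * jac a b u n) (at 0)"
      by (simp add: has_vector_derivative_at_0_iff prop_op_0 u)
    from tendsto_unique[OF _ 1 2] show ?thesis by simp
  qed
  thus "u \<in> {u \<in> ell2. jac a b u \<in> ell2} \<and> w = jac a b u"
    using u w by (metis (no_types, lifting) ext mem_Collect_eq)
next
  fix u w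
  assume "u \<in> {u \<in> ell2. jac a b u \<in> ell2} \<and> w = jac a b u"
  thus "((\<lambda>t. ell2_norm (\<lambda>n. (prop_op t u n - u n) / complex_of_real t - (- \<i> * w n))) \<longlongrightarrow> 0) (at 0)"
    using prop_op_strong_derivative[of u] by simp
qed

text \<open>Unitarity reduces the coordinates of \<open>V t u\<close> to the values of the group at
  unit vectors. This replaces a density argument when two groups are compared.\<close>

lemma unitary_group_adjoint:
  assumes V: "unitary_group V" and u: "u \<in> ell2"
  shows "V t u n = ell2_inner (V (-t) (delta n)) u"
proof -
  have ell2: "V s v \<in> ell2" if "v \<in> ell2" for s v
    using V that by (auto simp: unitary_group_def unitary_on_ell2_def)
  have "V (-t) (V t u) = V (-t + t) u" using V u unfolding unitary_group_def by metis
  also have "\<dots> = u" using V u by (simp add: unitary_group_def)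
  finally have *: "V (-t) (V t u) = u" .
  have "V t u n = ell2_inner (delta n) (V t u)" by (simp add: ell2_inner_delta)
  also have "\<dots> = ell2_inner (V (-t) (delta n)) (V (-t) (V t u))"
    using V ell2[OF u, of t] delta_ell2 unfolding unitary_group_def unitary_on_ell2_def by metis
  finally show ?thesis unfolding * .
qed

text \<open>For \<open>u\<close> in the maximal domain, \<open>V t u\<close> is a coordinatewise
  solution and therefore equals \<open>prop_op t u\<close>. Unit vectors belong to that domain, so
  \<open>unitary_group_adjoint\<close> carries the equality over to all of \<open>ell2\<close>, and
  extensionality settles the rest.\<close>

lemma unitary_group_unique:
  assumes V: "unitary_group V"
    and gen: "has_generator V {u \<in> ell2. jac a b u \<in> ell2} (jac a b)"
  shows "V = prop_op"
proof -
  define D where "D = {u \<in> ell2. jac a b u \<in> ell2}"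
  have ell2: "V s v \<in> ell2" if "v \<in> ell2" for s v
    using V that by (auto simp: unitary_group_def unitary_on_ell2_def)
  have lin: "V s (\<lambda>n. v n + z * w n) = (\<lambda>n. V s v n + z * V s w n)" if "v \<in> ell2" "w \<in> ell2" for s v w z
    using V that ell2_scale[OF that(2), of z] unfolding unitary_group_def unitary_on_ell2_def by metis
  have nsq_V: "nsq (V s v) = nsq v" if "v \<in> ell2" for s v
  proof -
    have "ell2_inner (V s v) (V s v) = ell2_inner v v"
      using V that unfolding unitary_group_def unitary_on_ell2_def by metis
    thus ?thesis using that ell2[OF that, of s] by (simp only: ell2_inner_self of_real_eq_iff)
  qed
  have group: "V (s + t) v = V s (V t v)" if "v \<in> ell2" for s t v
    using V that unfolding unitary_group_def by metis
  have D_eq: "V t u = prop_op t u" if u: "u \<in> D" for t u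
  proof -
    define w where "w = jac a b u"
    have uw: "u \<in> ell2" "w \<in> ell2" using u by (auto simp: D_def w_def)
    have lim0: "((\<lambda>h. ell2_norm (\<lambda>n. (V h u n - u n) / complex_of_real h - (- \<i> * w n))) \<longlongrightarrow> 0) (at 0)"
      using gen uw u unfolding has_generator_def D_def w_def by blast
    \<comment> \<open>\<open>V t\<close> is isometric and commutes with \<open>V h\<close>, so the
      difference quotient at \<open>V t u\<close> has the same norm as the one at
      \<open>u\<close>.\<close>
    have lim: "((\<lambda>h. ell2_norm (\<lambda>n. (V h (V t u) n - V t u n) / complex_of_real h - (- \<i> * V t w n))) \<longlongrightarrow> 0) (at 0)" for t
    proof (rule Lim_transform_eventually[OF lim0], intro always_eventually allI)
      fix h
      define q where "q = (\<lambda>n. (V h u n - u n) / complex_of_real h - (- \<i> * w n))"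
      define z where "z = 1 / complex_of_real h"
      have q: "q = (\<lambda>n. (\<i> * w n + z * V h u n) + (-z) * u n)"
        by (simp add: q_def z_def fun_eq_iff diff_divide_distrib)
      have mem: "(\<lambda>n. z * V h u n) \<in> ell2" "(\<lambda>n. \<i> * w n) \<in> ell2" "(\<lambda>n. \<i> * w n + z * V h u n) \<in> ell2"
        by (intro ell2_add ell2_scale ell2 uw)+
      have "V t q = (\<lambda>n. V t (\<lambda>n. \<i> * w n + z * V h u n) n + (-z) * V t u n)"
        unfolding q by (rule lin[OF mem(3) uw(1)])
      also have "V t (\<lambda>n. \<i> * w n + z * V h u n) = (\<lambda>n. V t (\<lambda>n. \<i> * w n) n + z * V t (V h u) n)"
        by (rule lin[OF mem(2) ell2[OF uw(1)]])
      also have "V t (\<lambda>n. \<i> * w n) = (\<lambda>n. \<i> * V t w n)"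
        using V uw unfolding unitary_group_def unitary_on_ell2_def by metis
      also have "V t (V h u) = V h (V t u)" using group[OF uw(1), of t h] group[OF uw(1), of h t] by (simp add: add.commute)
      finally have Vq: "V t q = (\<lambda>n. (V h (V t u) n - V t u n) / complex_of_real h - (- \<i> * V t w n))"
        by (simp add: z_def fun_eq_iff diff_divide_distrib)
      have "q \<in> ell2" unfolding q by (intro ell2_add ell2_scale ell2 uw)
      hence "ell2_norm (V t q) = ell2_norm q" by (simp add: ell2_norm_def nsq_V)
      thus "ell2_norm (\<lambda>n. (V h u n - u n) / complex_of_real h - (- \<i> * w n)) =
        ell2_norm (\<lambda>n. (V h (V t u) n - V t u n) / complex_of_real h - (- \<i> * V t w n))"
        unfolding Vq unfolding q_def by (rule sym)
    qed
    \<comment> \<open>Read in the other direction, the generator property places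
      \<open>V t u\<close> in the domain and identifies its image.\<close>
    have Vw: "V t w = jac a b (V t u)" for t
      using gen lim[of t] ell2[OF uw(1), of t] ell2[OF uw(2), of t] unfolding has_generator_def by blast
    have "jac_solution a b (\<lambda>t. V t u)"
      unfolding jac_solution_def
    proof (intro conjI allI)
      fix t n
      have "((\<lambda>h. (V h (V t u) n - V t u n) / complex_of_real h - (- \<i> * V t w n)) \<longlongrightarrow> 0) (at 0)"
      proof (rule Lim_null_comparison[OF _ lim], intro always_eventually allI)
        fix h
        have "(\<lambda>n. (1 / complex_of_real h) * (V h (V t u) n - V t u n) - (- \<i> * V t w n)) \<in> ell2"
          by (intro ell2_diff ell2_scale ell2 uw)
        hence "(\<lambda>n. (V h (V t u) n - V t u n) / complex_of_real h - (- \<i> * V t w n)) \<in> ell2" by simp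
        from ell2_bound[OF this, of n]
        show "norm ((V h (V t u) n - V t u n) / complex_of_real h - (- \<i> * V t w n)) \<le>
            ell2_norm (\<lambda>n. (V h (V t u) n - V t u n) / complex_of_real h - (- \<i> * V t w n))"
          by (simp only: ell2_norm_def)
      qed
      from tendsto_add[OF this tendsto_const[of "- \<i> * V t w n"]]
      have "((\<lambda>h. (V (h + t) u n - V t u n) / complex_of_real h) \<longlongrightarrow> - \<i> * V t w n) (at 0)"
        by (simp add: group uw)
      hence "((\<lambda>h. V (h + t) u n) has_vector_derivative - \<i> * V t w n) (at 0)"
        by (simp add: has_vector_derivative_at_0_iff)
      moreover have "((\<lambda>s. s - t) has_vector_derivative 1) (at t)"
        by (auto intro!: derivative_eq_intros)
      ultimately have "((\<lambda>s. V (s - t + t) u n) has_vector_derivative 1 *\<^sub>R (- \<i> * V t w n)) (at t)"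
        using vector_diff_chain_at[of "\<lambda>s. s - t" 1 t "\<lambda>h. V (h + t) u n" "- \<i> * V t w n"]
        by (auto simp: o_def)
      thus "((\<lambda>s. V s u n) has_vector_derivative - \<i> * jac a b (V t u) n) (at t)"
        by (simp add: Vw)
    next
      fix T
      show "\<exists>C. \<forall>t N. \<bar>t\<bar> \<le> T \<longrightarrow> (\<Sum>n<N. (cmod (V t u n))\<^sup>2) \<le> C"
        using sum_le_nsq[OF ell2[OF uw(1)]] nsq_V[OF uw(1)] by (intro exI[of _ "nsq u"]) auto
    qed
    moreover have "V 0 u = prop_op 0 u" using V uw by (simp add: unitary_group_def prop_op_0)
    ultimately show ?thesis using solution_unique prop_op_solution[OF uw(1)] by blast
  qed
  \<comment> \<open>The image of a unit vector has at most three nonzero entries.\<close>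
  have "delta n \<in> D" for n
  proof -
    have "{k. jac a b (delta n) k \<noteq> 0} \<subseteq> {..Suc n}"
      by (auto simp: jac_def delta_def split: if_splits)
    hence "jac a b (delta n) \<in> ell2" by (intro ell2_finite) (rule finite_subset, auto)
    thus ?thesis by (simp add: D_def delta_ell2)
  qed
  hence "V t u n = prop_op t u n" if "u \<in> ell2" for t u n
    using that unitary_group_adjoint[OF V that] unitary_group_adjoint[OF prop_op_unitary_group that] D_eq by simp
  moreover have "V t u = prop_op t u" if "u \<notin> ell2" for t u
    using V that by (auto simp: prop_op_def unitary_group_def unitary_on_ell2_def PiE_def extensional_def)
  ultimately show ?thesis by (intro ext) metis
qed

theorem exp_group_jac: "exp_group {u \<in> ell2. jac a b u \<in> ell2} (jac a b) = prop_op"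
  unfolding exp_group_def
  by (rule the_equality) (use prop_op_unitary_group prop_op_generator unitary_group_unique in blast)+

end

section \<open>Confluent limits of Jacobi functions\<close>

text \<open>Expansion at the endpoint 1, where both confluent limits take place. Writing the second
  factor as \<open>A + 1\<close> and collecting powers of \<open>A\<close> leaves an inner sum that
  trinomial revision brings into the form of Vandermonde's convolution.\<close>

lemma jacobi_poly_hypergeometric:
  "jacobi_poly n \<alpha> \<beta> x =
     (\<Sum>k\<le>n. ((real n + \<alpha>) gchoose (n - k)) * ((real n + \<alpha> + \<beta> + real k) gchoose k) * ((x - 1) / 2) ^ k)"
proof -
  define A where "A = (x - 1) / 2"
  have B: "(x + 1) / 2 = A + 1" by (simp add: A_def field_simps)
  have "jacobi_poly n \<alpha> \<beta> x =
      (\<Sum>s\<le>n. \<Sum>i\<le>n - s. ((real n + \<alpha>) gchoose (n - s)) * ((real n + \<beta>) gchoose s) * A ^ s *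
        (of_nat ((n - s) choose i) * A ^ i))"
    unfolding jacobi_poly_def B binomial_ring sum_distrib_left A_def[symmetric] by simp
  also have "\<dots> = (\<Sum>(s, i)\<in>(SIGMA s:{..n}. {..n - s}). ((real n + \<alpha>) gchoose (n - s)) * ((real n + \<beta>) gchoose s) * A ^ s *
        (of_nat ((n - s) choose i) * A ^ i))"
    by (subst sum.Sigma) auto
  also have "(SIGMA s:{..n}. {..n - s}) = {(s, i). s + i \<le> n}" by auto
  also have "(\<Sum>(s, i)\<in>{(s, i). s + i \<le> n}. ((real n + \<alpha>) gchoose (n - s)) * ((real n + \<beta>) gchoose s) * A ^ s *
        (of_nat ((n - s) choose i) * A ^ i)) =
      (\<Sum>k\<le>n. \<Sum>s\<le>k. ((real n + \<alpha>) gchoose (n - s)) * ((real n + \<beta>) gchoose s) * A ^ s *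
        (of_nat ((n - s) choose (k - s)) * A ^ (k - s)))"
    by (rule sum.triangle_reindex_eq)
  also have "\<dots> = (\<Sum>k\<le>n. ((real n + \<alpha>) gchoose (n - k)) * ((real n + \<alpha> + \<beta> + real k) gchoose k) * A ^ k)"
  proof (rule sum.cong[OF refl])
    fix k assume k: "k \<in> {..n}"
    have "(\<Sum>s\<le>k. ((real n + \<alpha>) gchoose (n - s)) * ((real n + \<beta>) gchoose s) * A ^ s *
        (of_nat ((n - s) choose (k - s)) * A ^ (k - s))) =
      (\<Sum>s\<le>k. ((real n + \<alpha>) gchoose (n - k)) * A ^ k * (((real n + \<beta>) gchoose s) * ((\<alpha> + real k) gchoose (k - s))))"
    proof (rule sum.cong[OF refl])
      fix s assume s: "s \<in> {..k}"
      have "(n - s) choose (k - s) = (n - s) choose (n - k)"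
        using k s binomial_symmetric[of "k - s" "n - s"] by simp
      moreover have "((real n + \<alpha>) gchoose (n - s)) * (of_nat (n - s) gchoose (n - k)) =
          ((real n + \<alpha>) gchoose (n - k)) * ((real n + \<alpha> - of_nat (n - k)) gchoose ((n - s) - (n - k)))"
        using k s by (intro gbinomial_trinomial_revision) auto
      moreover have "real n + \<alpha> - of_nat (n - k) = \<alpha> + real k" "(n - s) - (n - k) = k - s"
        using k s by (auto simp: of_nat_diff)
      ultimately have "((real n + \<alpha>) gchoose (n - s)) * of_nat ((n - s) choose (k - s)) =
          ((real n + \<alpha>) gchoose (n - k)) * ((\<alpha> + real k) gchoose (k - s))"
        by (simp add: binomial_gbinomial)
      moreover have "A ^ s * A ^ (k - s) = A ^ k" using s by (simp flip: power_add)
      moreover have "((real n + \<alpha>) gchoose (n - s)) * ((real n + \<beta>) gchoose s) * A ^ s *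
        (of_nat ((n - s) choose (k - s)) * A ^ (k - s)) =
        (((real n + \<alpha>) gchoose (n - s)) * of_nat ((n - s) choose (k - s))) * ((real n + \<beta>) gchoose s) * (A ^ s * A ^ (k - s))"
        by (simp only: mult_ac)
      ultimately show "((real n + \<alpha>) gchoose (n - s)) * ((real n + \<beta>) gchoose s) * A ^ s *
        (of_nat ((n - s) choose (k - s)) * A ^ (k - s)) =
        ((real n + \<alpha>) gchoose (n - k)) * A ^ k * (((real n + \<beta>) gchoose s) * ((\<alpha> + real k) gchoose (k - s)))"
        by (simp only: mult_ac)
    qed
    also have "\<dots> = ((real n + \<alpha>) gchoose (n - k)) * A ^ k * ((real n + \<beta> + (\<alpha> + real k)) gchoose k)"
      unfolding sum_distrib_left[symmetric] atMost_atLeast0 gbinomial_Vandermonde by simp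
    finally show "(\<Sum>s\<le>k. ((real n + \<alpha>) gchoose (n - s)) * ((real n + \<beta>) gchoose s) * A ^ s *
        (of_nat ((n - s) choose (k - s)) * A ^ (k - s))) =
      ((real n + \<alpha>) gchoose (n - k)) * ((real n + \<alpha> + \<beta> + real k) gchoose k) * A ^ k"
      by (simp add: algebra_simps)
  qed
  finally show ?thesis by (simp add: A_def)
qed

lemma jacobi_poly_minus: "jacobi_poly n \<alpha> \<beta> (-x) = (-1) ^ n * jacobi_poly n \<beta> \<alpha> x"
proof -
  have "jacobi_poly n \<alpha> \<beta> (-x) = (\<Sum>s\<le>n. ((real n + \<alpha>) gchoose s) * ((real n + \<beta>) gchoose (n - s)) *
        ((-x - 1) / 2) ^ (n - s) * ((-x + 1) / 2) ^ s)"
    unfolding jacobi_poly_def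
    by (rule sum.reindex_bij_witness[of _ "\<lambda>s. n - s" "\<lambda>s. n - s"]) auto
  also have "\<dots> = (\<Sum>s\<le>n. (-1) ^ n * (((real n + \<beta>) gchoose (n - s)) * ((real n + \<alpha>) gchoose s) *
        ((x - 1) / 2) ^ s * ((x + 1) / 2) ^ (n - s)))"
  proof (rule sum.cong[OF refl])
    fix s assume s: "s \<in> {..n}"
    have "(-x - 1) / 2 = (-1) * ((x + 1) / 2)" "(-x + 1) / 2 = (-1) * ((x - 1) / 2)" by (simp_all add: field_simps)
    hence "((-x - 1) / 2) ^ (n - s) * ((-x + 1) / 2) ^ s =
        ((-1) ^ (n - s) * (-1) ^ s) * (((x + 1) / 2) ^ (n - s) * ((x - 1) / 2) ^ s)"
      by (simp only: power_mult_distrib mult_ac)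
    also have "(-1) ^ (n - s) * (-1) ^ s = ((-1) ^ n :: real)" using s by (simp flip: power_add)
    finally show "((real n + \<alpha>) gchoose s) * ((real n + \<beta>) gchoose (n - s)) *
        ((-x - 1) / 2) ^ (n - s) * ((-x + 1) / 2) ^ s = (-1) ^ n * (((real n + \<beta>) gchoose (n - s)) * ((real n + \<alpha>) gchoose s) *
        ((x - 1) / 2) ^ s * ((x + 1) / 2) ^ (n - s))"
      by (simp only: mult_ac)
  qed
  finally show ?thesis by (simp add: jacobi_poly_def sum_distrib_left)
qed

section \<open>Fixed degree: the Laguerre limit\<close>

lemma rpow_eq_powr: "x > 0 \<Longrightarrow> rpow x a = x powr a"
  by (simp add: rpow_def)

lemma tendsto_rpow:
  assumes "(f \<longlongrightarrow> x) F" "a \<ge> 0" "eventually (\<lambda>j. f j \<ge> 0) F"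
  shows "((\<lambda>j. rpow (f j) a) \<longlongrightarrow> rpow x a) F"
  using assms by (cases "a = 0") (auto simp: rpow_def intro!: tendsto_powr')

lemma rpow_divide: "0 \<le> x \<Longrightarrow> 0 < y \<Longrightarrow> rpow (x / y) a = rpow x a / y powr a"
  by (simp add: rpow_def powr_divide)

text \<open>Euler's limit for the Gamma function, solved for the shifted value. The range reaches
  below 0 because \<open>\<alpha> = -1/2\<close> later gives the constant in the asymptotics of
  \<open>half_coeff\<close>.\<close>

lemma Gamma_ratio_tendsto:
  fixes \<alpha> :: real
  assumes "\<alpha> > -1"
  shows "(\<lambda>n. Gamma (real n + \<alpha> + 1) / (fact n * real n powr \<alpha>)) \<longlonglongrightarrow> 1"
proof -
  have G: "Gamma (\<alpha> + 1) > 0" using assms by (intro Gamma_real_pos) auto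
  have "(\<lambda>n. Gamma (\<alpha> + 1) / Gamma_series' (\<alpha> + 1) n) \<longlonglongrightarrow> Gamma (\<alpha> + 1) / Gamma (\<alpha> + 1)"
    using G by (intro tendsto_intros Gamma_series'_LIMSEQ) auto
  hence "(\<lambda>n. Gamma (\<alpha> + 1) / Gamma_series' (\<alpha> + 1) n) \<longlonglongrightarrow> 1" using G by simp
  thus ?thesis
  proof (rule Lim_transform_eventually)
    show "eventually (\<lambda>n. Gamma (\<alpha> + 1) / Gamma_series' (\<alpha> + 1) n =
        Gamma (real n + \<alpha> + 1) / (fact n * real n powr \<alpha>)) sequentially"
      using eventually_gt_at_top[of "0::nat"]
    proof eventually_elim
      case (elim n)
      have "pochhammer (\<alpha> + 1) n = Gamma (\<alpha> + 1 + of_nat n) / Gamma (\<alpha> + 1)"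
        using assms by (intro pochhammer_Gamma) (auto elim!: nonpos_Ints_cases)
      moreover have "exp ((\<alpha> + 1) * of_real (ln (real n))) = real n powr \<alpha> * real n"
        using elim by (simp add: powr_def algebra_simps exp_add)
      moreover have "fact n = real n * fact (n - 1)" using elim by (simp add: fact_reduce)
      ultimately show ?case using G elim
        by (simp add: Gamma_series'_def field_simps)
    qed
  qed
qed

lemma gbinomial_scaled_tendsto:
  fixes f g :: "'a \<Rightarrow> real"
  assumes "((\<lambda>j. f j / g j) \<longlongrightarrow> c) F" "filterlim g at_top F"
  shows "((\<lambda>j. (f j gchoose k) / g j ^ k) \<longlongrightarrow> c ^ k / fact k) F"
proof -
  have "((\<lambda>j. (\<Prod>i = 0..<k. f j / g j - real i / g j) / fact k) \<longlongrightarrow> (\<Prod>i = 0..<k. c - 0) / fact k) F"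
    by (intro tendsto_intros assms real_tendsto_divide_at_top) auto
  moreover have "(\<Prod>i = 0..<k. f j / g j - real i / g j) / fact k = (f j gchoose k) / g j ^ k" for j
    by (simp add: gbinomial_prod_rev prod_dividef flip: diff_divide_distrib)
  ultimately show ?thesis by simp
qed

lemma shift_ratio_tendsto:
  fixes g :: "'a \<Rightarrow> real"
  assumes "filterlim g at_top F"
  shows "((\<lambda>j. (g j + c) / g j) \<longlongrightarrow> 1) F"
proof -
  have "((\<lambda>j. c / g j) \<longlongrightarrow> 0) F" by (rule real_tendsto_divide_at_top[OF tendsto_const assms])
  from tendsto_add[OF tendsto_const[of 1] this] have "((\<lambda>j. 1 + c / g j) \<longlongrightarrow> 1) F" by simp
  moreover have "eventually (\<lambda>j. g j > 0) F"
    by (rule eventually_compose_filterlim[OF eventually_gt_at_top assms])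
  hence "eventually (\<lambda>j. 1 + c / g j = (g j + c) / g j) F"
    by eventually_elim (simp add: field_simps)
  ultimately show ?thesis by (rule Lim_transform_eventually)
qed

text \<open>The numerator is allowed to move with \<open>j\<close>. Since
  \<open>d * ln (1 - v / d)\<close> lies between \<open>- v - 2 * v * (v / d)\<close> and
  \<open>- v\<close>, it has the limit \<open>- u\<close>; the halved exponent is that of the Jacobi
  weight.\<close>

lemma one_minus_powr_tendsto:
  fixes v d :: "'a \<Rightarrow> real"
  assumes v: "(v \<longlongrightarrow> u) F" and v0: "eventually (\<lambda>j. v j \<ge> 0) F" and d: "filterlim d at_top F"
  shows "((\<lambda>j. (1 - v j / d j) powr (d j / 2)) \<longlongrightarrow> exp (- u / 2)) F"
proof -
  have y: "((\<lambda>j. v j / d j) \<longlongrightarrow> 0) F" by (rule real_tendsto_divide_at_top[OF v d])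
  have dpos: "eventually (\<lambda>j. d j > 0) F" using d by (simp add: filterlim_at_top_dense)
  \<comment> \<open>The quadratic lower bound for the logarithm is valid for arguments up to
    1/2.\<close>
  have ysmall: "eventually (\<lambda>j. v j / d j < 1 / 2) F" by (rule order_tendstoD[OF y]) auto
  have lim: "((\<lambda>j. d j * ln (1 - v j / d j)) \<longlongrightarrow> - u) F"
  proof (rule tendsto_sandwich)
    show "eventually (\<lambda>j. - v j - 2 * v j * (v j / d j) \<le> d j * ln (1 - v j / d j)) F"
      using dpos ysmall v0
    proof eventually_elim
      case (elim j)
      have "- (v j / d j) - 2 * (v j / d j)\<^sup>2 \<le> ln (1 - v j / d j)"
        using elim by (intro ln_one_minus_pos_lower_bound) auto
      hence "d j * (- (v j / d j) - 2 * (v j / d j)\<^sup>2) \<le> d j * ln (1 - v j / d j)"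
        using elim by (intro mult_left_mono) auto
      also have "d j * (- (v j / d j) - 2 * (v j / d j)\<^sup>2) = - v j - 2 * v j * (v j / d j)"
        using elim by (simp add: field_simps power2_eq_square)
      finally show ?case .
    qed
    show "eventually (\<lambda>j. d j * ln (1 - v j / d j) \<le> - v j) F"
      using dpos ysmall v0
    proof eventually_elim
      case (elim j)
      have "ln (1 - v j / d j) \<le> - (v j / d j)" using ln_le_minus_one[of "1 - v j / d j"] elim by simp
      hence "d j * ln (1 - v j / d j) \<le> d j * (- (v j / d j))" using elim by (intro mult_left_mono) auto
      thus ?case using elim by simp
    qed
    have "((\<lambda>j. - v j - 2 * v j * (v j / d j)) \<longlongrightarrow> - u - 2 * u * 0) F"
      by (intro tendsto_intros v y)
    thus "((\<lambda>j. - v j - 2 * v j * (v j / d j)) \<longlongrightarrow> - u) F" by simp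
    show "((\<lambda>j. - v j) \<longlongrightarrow> - u) F" by (intro tendsto_intros v)
  qed
  have "((\<lambda>j. exp (d j * ln (1 - v j / d j) / 2)) \<longlongrightarrow> exp (- u / 2)) F"
    by (intro tendsto_intros lim) auto
  thus ?thesis
  proof (rule Lim_transform_eventually)
    show "eventually (\<lambda>j. exp (d j * ln (1 - v j / d j) / 2) = (1 - v j / d j) powr (d j / 2)) F"
      using ysmall
    proof eventually_elim
      case (elim j)
      hence "1 - v j / d j \<noteq> 0" by linarith
      thus ?case by (simp add: powr_def)
    qed
  qed
qed

text \<open>With \<open>(1 - x) / 2 = v / d\<close>, the growth of each binomial coefficient, of
  order \<open>d ^ i\<close>, cancels the small power of the argument. Likewise the Gamma quotient
  under the root, of order \<open>d powr \<alpha>\<close>, compensates the weight at the endpoint 1.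
  The argument \<open>v j\<close> varies with \<open>j\<close> so that the statement also yields
  uniformity.\<close>

lemma jacobi_fun_laguerre_tendsto:
  fixes d :: "nat \<Rightarrow> nat" and v :: "nat \<Rightarrow> real"
  assumes \<alpha>: "\<alpha> \<ge> 0" and d: "filterlim d at_top sequentially" and v: "v \<longlonglongrightarrow> u" and v0: "\<And>j. v j \<ge> 0"
  shows "(\<lambda>j. jacobi_fun k \<alpha> (real (d j)) (1 - 2 * v j / real (d j))) \<longlonglongrightarrow> laguerre_fun k \<alpha> u"
proof -
  have u0: "u \<ge> 0" using v v0 by (intro LIMSEQ_le_const) auto
  have d': "filterlim (\<lambda>j. real (d j)) at_top sequentially"
    by (intro filterlim_compose[OF filterlim_real_sequentially] d)
  have dk: "filterlim (\<lambda>j. k + d j) at_top sequentially"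
    using d by (rule filterlim_at_top_mono) auto
  have dpos: "eventually (\<lambda>j. real (d j) > 0) sequentially"
    by (rule eventually_compose_filterlim[OF eventually_gt_at_top d'])
  have Gk: "Gamma (real k + \<alpha> + 1) > 0" using \<alpha> by (intro Gamma_real_pos) auto
  have vd: "(\<lambda>j. v j / real (d j)) \<longlonglongrightarrow> 0" by (rule real_tendsto_divide_at_top[OF v d'])
  have ysmall: "eventually (\<lambda>j. v j / real (d j) < 1) sequentially" by (rule order_tendstoD[OF vd]) auto
  \<comment> \<open>The Gamma quotient divided by its order of growth.\<close>
  define S where "S = (\<lambda>j. Gamma (real (k + d j) + \<alpha> + 1) / (fact (k + d j) * real (k + d j) powr \<alpha>))"
  have S: "S \<longlonglongrightarrow> 1" unfolding S_def using \<alpha> by (intro filterlim_compose[OF Gamma_ratio_tendsto dk]) auto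
  define P where "P = (\<lambda>j. \<Sum>i\<le>k. ((real k + \<alpha>) gchoose (k - i)) *
    (((real k + \<alpha> + real (d j) + real i) gchoose i) / real (d j) ^ i) * (- v j) ^ i)"
  have "P \<longlonglongrightarrow> (\<Sum>i\<le>k. ((real k + \<alpha>) gchoose (k - i)) * (1 ^ i / fact i) * (- u) ^ i)"
    unfolding P_def
  proof (intro tendsto_sum tendsto_mult tendsto_const tendsto_power tendsto_minus gbinomial_scaled_tendsto v d')
    fix i
    show "(\<lambda>j. (real k + \<alpha> + real (d j) + real i) / real (d j)) \<longlonglongrightarrow> 1"
      using shift_ratio_tendsto[OF d', of "real k + \<alpha> + real i"] by (simp add: add_ac)
  qed
  also have "(\<Sum>i\<le>k. ((real k + \<alpha>) gchoose (k - i)) * (1 ^ i / fact i) * (- u) ^ i) = laguerre_poly k \<alpha> u"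
    unfolding laguerre_poly_def by (intro sum.cong refl) (simp add: power_minus')
  finally have P: "P \<longlonglongrightarrow> laguerre_poly k \<alpha> u" .
  have r: "(\<lambda>j. real (k + d j) / real (d j)) \<longlonglongrightarrow> 1"
    using shift_ratio_tendsto[OF d', of "real k"] by (simp add: add_ac)
  have "(\<lambda>j. sqrt (fact k / Gamma (real k + \<alpha> + 1) * S j) * (real (k + d j) / real (d j)) powr (\<alpha> / 2) * rpow (v j) (\<alpha> / 2) *
      (1 - v j / real (d j)) powr (real (d j) / 2) * P j) \<longlonglongrightarrow>
      sqrt (fact k / Gamma (real k + \<alpha> + 1) * 1) * 1 powr (\<alpha> / 2) * rpow u (\<alpha> / 2) * exp (- u / 2) * laguerre_poly k \<alpha> u"
    using v0 \<alpha> by (intro tendsto_intros S P r one_minus_powr_tendsto tendsto_rpow v d' always_eventually) auto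
  also have "sqrt (fact k / Gamma (real k + \<alpha> + 1) * 1) * 1 powr (\<alpha> / 2) * rpow u (\<alpha> / 2) * exp (- u / 2) * laguerre_poly k \<alpha> u =
    laguerre_fun k \<alpha> u" by (simp add: laguerre_fun_def)
  finally show ?thesis
  proof (rule Lim_transform_eventually)
    show "eventually (\<lambda>j. sqrt (fact k / Gamma (real k + \<alpha> + 1) * S j) * (real (k + d j) / real (d j)) powr (\<alpha> / 2) * rpow (v j) (\<alpha> / 2) *
      (1 - v j / real (d j)) powr (real (d j) / 2) * P j = jacobi_fun k \<alpha> (real (d j)) (1 - 2 * v j / real (d j))) sequentially"
      using dpos ysmall
    proof eventually_elim
      case (elim j)
      define D where "D = real (d j)"
      have D: "D > 0" "v j / D < 1" using elim by (auto simp: D_def)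
      have 1: "(1 - (1 - 2 * v j / D)) / 2 = v j / D" "(1 + (1 - 2 * v j / D)) / 2 = 1 - v j / D"
        "((1 - 2 * v j / D) - 1) / 2 = - v j / D" by (simp_all add: field_simps)
      have 2: "rpow (v j / D) (\<alpha> / 2) = rpow (v j) (\<alpha> / 2) / D powr (\<alpha> / 2)"
        using v0 D by (intro rpow_divide) auto
      have 3: "rpow (1 - v j / D) (D / 2) = (1 - v j / D) powr (D / 2)"
        using D by (intro rpow_eq_powr) auto
      have 4: "jacobi_poly k \<alpha> D (1 - 2 * v j / D) = P j"
        unfolding jacobi_poly_hypergeometric 1 P_def D_def[symmetric]
        by (intro sum.cong refl) (simp add: power_divide power_minus[of "v j / D"] power_minus[of "v j"])
      have 5: "Gamma (real k + 1) * Gamma (real k + \<alpha> + D + 1) / (Gamma (real k + \<alpha> + 1) * Gamma (real k + D + 1)) =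
          (fact k / Gamma (real k + \<alpha> + 1) * S j) * (real k + D) powr \<alpha>"
      proof -
        have "Gamma (real k + 1) = fact k" using Gamma_fact[of k, where ?'a = real] by (simp add: add.commute)
        moreover have "Gamma (real k + D + 1) = fact (k + d j)"
          using Gamma_fact[of "k + d j", where ?'a = real] by (simp add: D_def add_ac)
        moreover have "real k + D > 0" using D by simp
        ultimately show ?thesis unfolding S_def D_def using Gk by (simp add: field_simps add_ac)
      qed
      have 6: "sqrt ((real k + D) powr \<alpha>) = (real k + D) powr (\<alpha> / 2)"
        using D by (simp add: powr_half_sqrt[symmetric] powr_powr)
      have 7: "((real k + D) / D) powr (\<alpha> / 2) = (real k + D) powr (\<alpha> / 2) / D powr (\<alpha> / 2)"
        using D by (simp add: powr_divide)
      show ?case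
        unfolding jacobi_fun_def D_def[symmetric] 1 2 3 4 5 real_sqrt_mult[of _ "(real k + D) powr \<alpha>"] 6 of_nat_add 7
        by simp
    qed
  qed
qed

section \<open>Growing degree: the Bessel limit\<close>

lemma gbinomial_Gamma_shift:
  fixes \<alpha> :: real
  assumes "\<alpha> \<ge> 0" "k \<le> n"
  shows "((real n + \<alpha>) gchoose (n - k)) =
    Gamma (real n + \<alpha> + 1) / fact n * (fact n / fact (n - k)) * rGamma (real k + \<alpha> + 1)"
proof -
  have "((real n + \<alpha>) gchoose (n - k)) = pochhammer (real k + \<alpha> + 1) (n - k) / fact (n - k)"
    using assms by (simp add: gbinomial_pochhammer' of_nat_diff algebra_simps)
  also have "pochhammer (real k + \<alpha> + 1) (n - k) = Gamma (real n + \<alpha> + 1) * rGamma (real k + \<alpha> + 1)"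
  proof -
    have "pochhammer (real k + \<alpha> + 1) (n - k) = Gamma (real k + \<alpha> + 1 + of_nat (n - k)) / Gamma (real k + \<alpha> + 1)"
      using assms by (intro pochhammer_Gamma) (auto elim!: nonpos_Ints_cases)
    thus ?thesis using assms by (simp add: rGamma_inverse_Gamma divide_inverse of_nat_diff algebra_simps)
  qed
  finally show ?thesis by simp
qed

lemma rGamma_shift_bound:
  fixes \<alpha> :: real
  assumes "\<alpha> \<ge> 0"
  shows "\<bar>rGamma (real k + \<alpha> + 1)\<bar> \<le> rGamma (\<alpha> + 1)"
proof -
  have G: "Gamma (\<alpha> + 1) > 0" using assms by (intro Gamma_real_pos) auto
  have "1 \<le> pochhammer (\<alpha> + 1) k"
    unfolding pochhammer_prod using assms by (intro prod_ge_1) auto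
  moreover have "pochhammer (\<alpha> + 1) k = Gamma (\<alpha> + 1 + of_nat k) / Gamma (\<alpha> + 1)"
    using assms by (intro pochhammer_Gamma) (auto elim!: nonpos_Ints_cases)
  ultimately have "Gamma (\<alpha> + 1) \<le> Gamma (real k + \<alpha> + 1)"
    using G by (simp add: field_simps add_ac)
  thus ?thesis using G by (simp add: rGamma_inverse_Gamma field_simps)
qed

lemma gbinomial_le_power:
  fixes x :: real
  assumes "x \<ge> real k"
  shows "0 \<le> (x gchoose k)" "(x gchoose k) \<le> x ^ k / fact k"
proof -
  have "(\<Prod>i = 0..<k. x - real i) \<le> (\<Prod>i = 0..<k. x)" using assms by (intro prod_mono) auto
  thus "(x gchoose k) \<le> x ^ k / fact k" by (simp add: gbinomial_prod_rev divide_right_mono)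
  show "0 \<le> (x gchoose k)" using assms by (auto simp: gbinomial_prod_rev intro!: divide_nonneg_pos prod_nonneg)
qed

text \<open>Here the number of terms grows with the degree, so termwise convergence of the
  hypergeometric sum is combined with a summable majorant (Tannery's theorem).\<close>

lemma jacobi_fun_bessel_tendsto:
  fixes n :: "nat \<Rightarrow> nat" and t :: "nat \<Rightarrow> real"
  assumes \<alpha>: "\<alpha> \<ge> 0" and t: "filterlim (\<lambda>j. \<bar>t j\<bar>) at_top sequentially" and c: "c > 0"
    and nt: "(\<lambda>j. real (n j) / \<bar>t j\<bar>) \<longlonglongrightarrow> c"
  shows "(\<lambda>j. jacobi_fun (n j) \<alpha> (real d) (x_of (t j))) \<longlonglongrightarrow> bessel_J \<alpha> (2 * c)"
proof -
  have tpos: "eventually (\<lambda>j. \<bar>t j\<bar> > 1) sequentially" using t by (simp add: filterlim_at_top_dense)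
  have n': "filterlim (\<lambda>j. real (n j)) at_top sequentially"
  proof -
    have "filterlim (\<lambda>j. real (n j) / \<bar>t j\<bar> * \<bar>t j\<bar>) at_top sequentially"
      by (rule filterlim_tendsto_pos_mult_at_top[OF nt c t])
    moreover have "eventually (\<lambda>j. real (n j) / \<bar>t j\<bar> * \<bar>t j\<bar> = real (n j)) sequentially"
      using tpos by eventually_elim auto
    ultimately show ?thesis by (simp add: filterlim_cong)
  qed
  hence n: "filterlim n at_top sequentially" 
    by (simp add: filterlim_at_top) (metis (mono_tags, lifting) eventually_mono of_nat_le_iff)
  have npos: "eventually (\<lambda>j. n j > 0) sequentially"
    by (rule eventually_compose_filterlim[OF eventually_gt_at_top n])
  \<comment> \<open>This is \<open>n\<^sup>2 * (1 - x) / 2\<close> at \<open>x = x_of t\<close>: the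
    rescaled distance from the endpoint, which stays of order 1.\<close>
  define y where "y = (\<lambda>j. (real (n j))\<^sup>2 / (1 + (t j)\<^sup>2))"
  have t2: "(\<lambda>j. (t j)\<^sup>2 / (1 + (t j)\<^sup>2)) \<longlonglongrightarrow> 1"
  proof -
    have "filterlim (\<lambda>j. \<bar>t j\<bar>\<^sup>2) at_top sequentially" by (intro filterlim_pow_at_top t) auto
    hence "filterlim (\<lambda>j. 1 + (t j)\<^sup>2) at_top sequentially"
      by (intro filterlim_tendsto_add_at_top[OF tendsto_const]) simp
    hence "(\<lambda>j. 1 - 1 / (1 + (t j)\<^sup>2)) \<longlonglongrightarrow> 1 - 0"
      by (intro tendsto_intros real_tendsto_divide_at_top[OF tendsto_const])
    moreover have "1 - 1 / (1 + s\<^sup>2) = s\<^sup>2 / (1 + s\<^sup>2)" for s :: real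
      using zero_le_power2[of s] by (simp add: field_simps add_nonneg_eq_0_iff)
    ultimately show ?thesis by simp
  qed
  have y: "y \<longlonglongrightarrow> c\<^sup>2"
  proof -
    have "(\<lambda>j. (real (n j) / \<bar>t j\<bar>)\<^sup>2 * ((t j)\<^sup>2 / (1 + (t j)\<^sup>2))) \<longlonglongrightarrow> c\<^sup>2 * 1"
      by (intro tendsto_intros nt t2)
    hence "(\<lambda>j. (real (n j) / \<bar>t j\<bar>)\<^sup>2 * ((t j)\<^sup>2 / (1 + (t j)\<^sup>2))) \<longlonglongrightarrow> c\<^sup>2" by simp
    thus ?thesis
      by (rule Lim_transform_eventually)
         (use tpos in \<open>auto elim!: eventually_mono simp: y_def power_divide\<close>)
  qed
  \<comment> \<open>Terms of the polynomial divided by its value at 1 up to a Gamma constant, with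
    two powers of \<open>n\<close> moved from the coefficients to \<open>y\<close>; the extension by
    zero beyond the degree turns the finite sum into a series.\<close>
  define f where "f = (\<lambda>k j. if k \<le> n j then (fact (n j) / fact (n j - k) / real (n j) ^ k) *
    (((real (n j) + \<alpha> + real d + real k) gchoose k) / real (n j) ^ k) * rGamma (real k + \<alpha> + 1) * (- y j) ^ k else 0)"
  define L where "L = (\<lambda>k. (1 / fact k) * rGamma (real k + \<alpha> + 1) * (- (c\<^sup>2)) ^ k)"
  have f: "(\<lambda>j. f k j) \<longlonglongrightarrow> L k" for k
  proof -
    have "(\<lambda>j. (fact k * ((real (n j) gchoose k) / real (n j) ^ k)) *
      (((real (n j) + \<alpha> + real d + real k) gchoose k) / real (n j) ^ k) * rGamma (real k + \<alpha> + 1) * (- y j) ^ k) \<longlonglongrightarrow>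
      (fact k * (1 ^ k / fact k)) * (1 ^ k / fact k) * rGamma (real k + \<alpha> + 1) * (- (c\<^sup>2)) ^ k"
    proof (intro tendsto_mult tendsto_const tendsto_power tendsto_minus gbinomial_scaled_tendsto y n')
      show "(\<lambda>j. real (n j) / real (n j)) \<longlonglongrightarrow> 1"
        using shift_ratio_tendsto[OF n', of 0] by simp
      show "(\<lambda>j. (real (n j) + \<alpha> + real d + real k) / real (n j)) \<longlonglongrightarrow> 1"
        using shift_ratio_tendsto[OF n', of "\<alpha> + real d + real k"] by (simp add: add_ac)
    qed
    moreover have "(fact k * (1 ^ k / fact k)) * (1 ^ k / fact k) * rGamma (real k + \<alpha> + 1) * (- (c\<^sup>2)) ^ k = L k"
      by (simp add: L_def)
    ultimately have "(\<lambda>j. (fact k * ((real (n j) gchoose k) / real (n j) ^ k)) *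
      (((real (n j) + \<alpha> + real d + real k) gchoose k) / real (n j) ^ k) * rGamma (real k + \<alpha> + 1) * (- y j) ^ k) \<longlonglongrightarrow> L k"
      by simp
    thus ?thesis
    proof (rule Lim_transform_eventually)
      have "eventually (\<lambda>j. k \<le> n j) sequentially" using n by (simp add: filterlim_at_top)
      thus "eventually (\<lambda>j. (fact k * ((real (n j) gchoose k) / real (n j) ^ k)) *
        (((real (n j) + \<alpha> + real d + real k) gchoose k) / real (n j) ^ k) * rGamma (real k + \<alpha> + 1) * (- y j) ^ k = f k j) sequentially"
      proof eventually_elim
        case (elim j)
        have "fact k * (real (n j) gchoose k) = fact (n j) / fact (n j - k)"
          using elim by (simp add: binomial_gbinomial[symmetric] binomial_fact)
        hence "fact k * ((real (n j) gchoose k) / real (n j) ^ k) = fact (n j) / fact (n j - k) / real (n j) ^ k"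
          by (simp add: times_divide_eq_right)
        thus ?case using elim by (simp only: f_def if_True)
      qed
    qed
  qed
  \<comment> \<open>For \<open>k \<le> n\<close> and \<open>n \<ge> 1\<close> the upper entry of the
    binomial coefficient is at most \<open>(2 + \<alpha> + d) * n\<close>; the other factor
    eventually bounds \<open>y\<close>, whose limit is \<open>c\<^sup>2\<close>.\<close>
  define M where "M = (2 + \<alpha> + real d) * (c + 1)\<^sup>2"
  have yb: "eventually (\<lambda>j. \<bar>y j\<bar> \<le> (c + 1)\<^sup>2) sequentially"
  proof -
    have "c\<^sup>2 < (c + 1)\<^sup>2" using c by (intro power_strict_mono) auto
    hence "eventually (\<lambda>j. y j < (c + 1)\<^sup>2) sequentially" by (rule order_tendstoD[OF y])
    thus ?thesis by eventually_elim (auto simp: y_def add_nonneg_pos)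
  qed
  have bound: "eventually (\<lambda>j. \<forall>k. norm (f k j) \<le> rGamma (\<alpha> + 1) * (M ^ k / fact k)) sequentially"
    using npos yb
  proof eventually_elim
    case (elim j)
    have rG: "0 \<le> rGamma (\<alpha> + 1)" using rGamma_shift_bound[OF \<alpha>, of 0] by simp
    have M0: "M \<ge> 0" using \<alpha> by (simp add: M_def)
    show ?case
    proof
      fix k
      show "norm (f k j) \<le> rGamma (\<alpha> + 1) * (M ^ k / fact k)"
      proof (cases "k \<le> n j")
        case True
        define N where "N = real (n j)"
        have N: "N \<ge> 1" "real k \<le> N" using elim True by (auto simp: N_def)
        have 1: "\<bar>fact (n j) / fact (n j - k) / N ^ k\<bar> \<le> 1"
        proof -
          have "real (fact (n j) div fact (n j - k)) \<le> real (n j ^ k)"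
            using fact_div_fact_le_pow[OF True] by (simp only: of_nat_le_iff)
          moreover have "real (fact (n j) div fact (n j - k)) = fact (n j) / fact (n j - k)"
            by (subst real_of_nat_div) (auto intro: fact_dvd)
          ultimately show ?thesis using N by (simp add: N_def field_simps)
        qed
        define x where "x = N + \<alpha> + real d + real k"
        have x: "x \<ge> real k" "0 \<le> x" "x \<le> (2 + \<alpha> + real d) * N"
        proof -
          have "\<alpha> + real d \<le> (\<alpha> + real d) * N" using N \<alpha> by (simp add: mult_le_cancel_left1)
          thus "x \<le> (2 + \<alpha> + real d) * N" using N by (simp add: x_def algebra_simps)
        qed (use N \<alpha> in \<open>auto simp: x_def\<close>)
        have "(x gchoose k) \<le> x ^ k / fact k" by (rule gbinomial_le_power[OF x(1)])
        also have "\<dots> \<le> ((2 + \<alpha> + real d) * N) ^ k / fact k"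
          using x by (intro divide_right_mono power_mono) auto
        finally have "(x gchoose k) / N ^ k \<le> ((2 + \<alpha> + real d) * N) ^ k / fact k / N ^ k"
          using N by (intro divide_right_mono) auto
        also have "\<dots> = (2 + \<alpha> + real d) ^ k / fact k"
          using N by (simp add: power_mult_distrib)
        finally have "(x gchoose k) / N ^ k \<le> (2 + \<alpha> + real d) ^ k / fact k" .
        hence 2: "\<bar>(x gchoose k) / N ^ k\<bar> \<le> (2 + \<alpha> + real d) ^ k / fact k"
          using gbinomial_le_power(1)[OF x(1)] N by simp
        have 3: "\<bar>(- y j) ^ k\<bar> \<le> ((c + 1)\<^sup>2) ^ k"
          using elim by (simp add: power_abs power_mono)
        have "norm (f k j) = \<bar>fact (n j) / fact (n j - k) / N ^ k\<bar> * \<bar>(x gchoose k) / N ^ k\<bar> *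
            \<bar>rGamma (real k + \<alpha> + 1)\<bar> * \<bar>(- y j) ^ k\<bar>"
          using True by (simp only: f_def N_def[symmetric] x_def[symmetric] if_True real_norm_def abs_mult)
        also have "\<dots> \<le> 1 * ((2 + \<alpha> + real d) ^ k / fact k) * rGamma (\<alpha> + 1) * ((c + 1)\<^sup>2) ^ k"
          using \<alpha> rG by (intro mult_mono 1 2 3 rGamma_shift_bound) auto
        also have "\<dots> = rGamma (\<alpha> + 1) * (M ^ k / fact k)" by (simp add: M_def power_mult_distrib)
        finally show ?thesis .
      qed (use rG M0 in \<open>simp add: f_def\<close>)
    qed
  qed
  have "(\<lambda>j. \<Sum>k. f k j) \<longlonglongrightarrow> (\<Sum>k. L k)"
  proof -
    have "eventually (\<lambda>(k, j). norm (f k j) \<le> rGamma (\<alpha> + 1) * (M ^ k / fact k)) (at_top \<times>\<^sub>F sequentially)"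
      using eventually_prodI[OF eventually_True bound, of at_top] by (auto elim!: eventually_mono)
    moreover have "summable (\<lambda>k. rGamma (\<alpha> + 1) * (M ^ k / fact k))"
      using summable_exp[of M] by (intro summable_mult) (simp add: divide_inverse mult.commute)
    ultimately show ?thesis using tannerys_theorem[OF f] by auto
  qed
  define S where "S = (\<lambda>n. Gamma (real n + \<alpha> + 1) / (fact n * real n powr \<alpha>))"
  have S: "S \<longlonglongrightarrow> 1" unfolding S_def using \<alpha> by (intro Gamma_ratio_tendsto) auto
  have nd: "filterlim (\<lambda>j. n j + d) at_top sequentially" using n by (rule filterlim_at_top_mono) auto
  have r: "(\<lambda>j. real (n j + d) / real (n j)) \<longlonglongrightarrow> 1"
    using shift_ratio_tendsto[OF n', of "real d"] by simp
  \<comment> \<open>The prefactor \<open>Gamma (n + \<alpha> + 1) / fact n\<close> of the polynomial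
    is of order \<open>n powr \<alpha>\<close>. Merged with the weight it becomes
    \<open>S (n j) * y j powr (\<alpha> / 2)\<close>, the source of the factor
    \<open>c powr \<alpha>\<close> in the Bessel function.\<close>
  have "(\<lambda>j. sqrt (S (n j + d) / S (n j)) * (real (n j + d) / real (n j)) powr (\<alpha> / 2) * (S (n j) * y j powr (\<alpha> / 2)) *
      ((t j)\<^sup>2 / (1 + (t j)\<^sup>2)) powr (real d / 2) * (\<Sum>k. f k j)) \<longlonglongrightarrow>
      sqrt (1 / 1) * 1 powr (\<alpha> / 2) * (1 * (c\<^sup>2) powr (\<alpha> / 2)) * 1 powr (real d / 2) * (\<Sum>k. L k)"
    using c by (intro tendsto_intros filterlim_compose[OF S] n nd r y t2 \<open>(\<lambda>j. \<Sum>k. f k j) \<longlonglongrightarrow> (\<Sum>k. L k)\<close>) auto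
  also have "sqrt (1 / 1) * 1 powr (\<alpha> / 2) * (1 * (c\<^sup>2) powr (\<alpha> / 2)) * 1 powr (real d / 2) * (\<Sum>k. L k) = bessel_J \<alpha> (2 * c)"
  proof -
    have "(c\<^sup>2) powr (\<alpha> / 2) = rpow c \<alpha>" using c by (simp add: rpow_eq_powr powr_powr flip: powr_numeral)
    moreover have "L = (\<lambda>m. (- 1) ^ m * rGamma (real m + \<alpha> + 1) / fact m * c ^ (2 * m))"
      by (simp add: L_def fun_eq_iff power_minus' power_mult)
    ultimately show ?thesis by (simp add: bessel_J_def)
  qed
  finally show ?thesis
  proof (rule Lim_transform_eventually)
    show "eventually (\<lambda>j. sqrt (S (n j + d) / S (n j)) * (real (n j + d) / real (n j)) powr (\<alpha> / 2) * (S (n j) * y j powr (\<alpha> / 2)) *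
      ((t j)\<^sup>2 / (1 + (t j)\<^sup>2)) powr (real d / 2) * (\<Sum>k. f k j) = jacobi_fun (n j) \<alpha> (real d) (x_of (t j))) sequentially"
      using npos tpos
    proof eventually_elim
      case (elim j)
      define N where "N = real (n j)"
      define T where "T = 1 + (t j)\<^sup>2"
      have N: "N > 0" using elim by (simp add: N_def)
      have T: "T > 0" "(t j)\<^sup>2 > 0" using elim by (auto simp: T_def add_pos_nonneg)
      have 1: "(1 - x_of (t j)) / 2 = 1 / T" "(1 + x_of (t j)) / 2 = (t j)\<^sup>2 / T" "(x_of (t j) - 1) / 2 = - (1 / T)"
      proof -
        have xt: "x_of (t j) = (T - 2) / T" "(t j)\<^sup>2 = T - 1"
          by (simp_all add: x_of_def T_def add.commute)
        show "(1 - x_of (t j)) / 2 = 1 / T" "(1 + x_of (t j)) / 2 = (t j)\<^sup>2 / T" "(x_of (t j) - 1) / 2 = - (1 / T)"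
          unfolding xt using T(1) by (simp_all add: field_simps)
      qed
      have G: "Gamma (N + \<alpha> + 1) > 0" "Gamma (N + real d + \<alpha> + 1) > 0"
        using \<alpha> N by (auto intro!: Gamma_real_pos)
      have 2: "sqrt (Gamma (N + 1) * Gamma (N + \<alpha> + real d + 1) / (Gamma (N + \<alpha> + 1) * Gamma (N + real d + 1))) =
          sqrt (S (n j + d) / S (n j)) * ((N + real d) / N) powr (\<alpha> / 2)"
      proof -
        have "Gamma (N + 1) = fact (n j)" using Gamma_fact[of "n j", where ?'a = real] by (simp add: N_def add.commute)
        moreover have "Gamma (N + real d + 1) = fact (n j + d)"
          using Gamma_fact[of "n j + d", where ?'a = real] by (simp add: N_def add_ac)
        ultimately have "Gamma (N + 1) * Gamma (N + \<alpha> + real d + 1) / (Gamma (N + \<alpha> + 1) * Gamma (N + real d + 1)) =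
            S (n j + d) / S (n j) * ((N + real d) / N) powr \<alpha>"
          unfolding S_def using N G by (simp add: N_def[symmetric] powr_divide field_simps add_ac)
        moreover have "sqrt (((N + real d) / N) powr \<alpha>) = ((N + real d) / N) powr (\<alpha> / 2)"
          using N by (simp add: powr_half_sqrt[symmetric] powr_powr)
        ultimately show ?thesis by (simp only: real_sqrt_mult)
      qed
      have 3: "jacobi_poly (n j) \<alpha> (real d) (x_of (t j)) = Gamma (N + \<alpha> + 1) / fact (n j) * (\<Sum>k. f k j)"
      proof -
        have "(\<Sum>k. f k j) = (\<Sum>k\<le>n j. f k j)" by (rule suminf_finite) (auto simp: f_def)
        also have "Gamma (N + \<alpha> + 1) / fact (n j) * \<dots> = jacobi_poly (n j) \<alpha> (real d) (x_of (t j))"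
          unfolding jacobi_poly_hypergeometric 1 sum_distrib_left
        proof (intro sum.cong refl)
          fix k assume "k \<in> {..n j}"
          hence k: "k \<le> n j" by simp
          have "y j = N\<^sup>2 / T" by (simp add: y_def N_def T_def)
          hence "(- y j) ^ k = N ^ k * N ^ k * (- (1 / T)) ^ k"
            by (simp add: power_minus' power_divide power2_eq_square power_mult_distrib)
          thus "Gamma (N + \<alpha> + 1) / fact (n j) * f k j = ((real (n j) + \<alpha>) gchoose (n j - k)) *
              ((real (n j) + \<alpha> + real d + real k) gchoose k) * (- (1 / T)) ^ k"
            unfolding f_def N_def[symmetric] using k N gbinomial_Gamma_shift[OF \<alpha> k, folded N_def] by simp
        qed
        finally show ?thesis by simp
      qed
      have 4: "S (n j) * y j powr (\<alpha> / 2) = Gamma (N + \<alpha> + 1) / fact (n j) * (1 / T) powr (\<alpha> / 2)"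
      proof -
        have "y j = N\<^sup>2 * (1 / T)" by (simp add: y_def N_def T_def)
        hence "y j powr (\<alpha> / 2) = N powr \<alpha> * (1 / T) powr (\<alpha> / 2)"
          using N T by (simp add: powr_mult powr_powr powr_divide flip: powr_numeral)
        thus ?thesis using N by (simp add: S_def N_def)
      qed
      show ?case unfolding jacobi_fun_def 1 N_def[symmetric] 2 3 rpow_eq_powr[OF divide_pos_pos[OF zero_less_one T(1)]]
          rpow_eq_powr[OF divide_pos_pos[OF T(2,1)]] of_nat_add T_def[symmetric] 4 by simp
    qed
  qed
qed

text \<open>If uniformity fails, bad points occur along a subsequence of indices, and compactness
  makes them converge; this contradicts convergence along moving arguments. Subsequences
  \<open>r\<close> appear in the hypothesis because of this selection. The functions
  \<open>f j\<close> may jump, as those built with \<open>floor\<close> do.\<close>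

lemma uniform_limit_compactI:
  fixes f :: "nat \<Rightarrow> 'a :: metric_space \<Rightarrow> 'b :: metric_space"
  assumes "compact I" and cont: "continuous_on I L"
    and lim: "\<And>r x l. strict_mono r \<Longrightarrow> (\<And>j. x j \<in> I) \<Longrightarrow> l \<in> I \<Longrightarrow> x \<longlonglongrightarrow> l \<Longrightarrow> (\<lambda>j. f (r j) (x j)) \<longlonglongrightarrow> L l"
  shows "uniform_limit I f L sequentially"
proof (rule ccontr)
  assume "\<not> uniform_limit I f L sequentially"
  then obtain e where e: "e > 0" "\<not> eventually (\<lambda>j. \<forall>x\<in>I. dist (f j x) (L x) < e) sequentially"
    unfolding uniform_limit_iff by blast
  hence "infinite {j. \<exists>x\<in>I. \<not> dist (f j x) (L x) < e}"
    by (auto simp: cofinite_eq_sequentially[symmetric] eventually_cofinite)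
  from infinite_enumerate[OF this] obtain r :: "nat \<Rightarrow> nat"
    where r: "strict_mono r" "\<And>j. r j \<in> {j. \<exists>x\<in>I. \<not> dist (f j x) (L x) < e}" by blast
  from r(2) have "\<forall>j. \<exists>x. x \<in> I \<and> dist (f (r j) x) (L x) \<ge> e" by (auto simp: not_less)
  from choice[OF this] obtain x where x: "\<And>j. x j \<in> I" "\<And>j. dist (f (r j) (x j)) (L (x j)) \<ge> e" by blast
  obtain l s where l: "l \<in> I" "strict_mono s" "(x \<circ> s) \<longlonglongrightarrow> l"
    using \<open>compact I\<close> x(1) unfolding compact_def by blast
  have 1: "(\<lambda>j. f ((r \<circ> s) j) ((x \<circ> s) j)) \<longlonglongrightarrow> L l"
    by (rule lim[OF strict_mono_o[OF r(1) l(2)] _ l(1,3)]) (simp add: x(1))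
  have 2: "(\<lambda>j. L ((x \<circ> s) j)) \<longlonglongrightarrow> L l"
    by (rule continuous_on_tendsto_compose[OF cont l(3,1)]) (simp add: x(1))
  have "(\<lambda>j. dist (f ((r \<circ> s) j) ((x \<circ> s) j)) (L ((x \<circ> s) j))) \<longlonglongrightarrow> dist (L l) (L l)"
    by (intro tendsto_dist 1 2)
  hence "eventually (\<lambda>j. dist (f ((r \<circ> s) j) ((x \<circ> s) j)) (L ((x \<circ> s) j)) < e) sequentially"
    using e(1) by (intro order_tendstoD) auto
  with x(2) show False by (auto simp: eventually_sequentially not_less[symmetric])
qed

lemma continuous_bessel_J:
  assumes "\<alpha> \<ge> 0" "0 \<le> a"
  shows "continuous_on {a..b} (\<lambda>c. bessel_J \<alpha> (2 * c))"
proof -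
  have sm: "summable (\<lambda>m. (- 1) ^ m * rGamma (real m + \<alpha> + 1) / fact m * y ^ m)" for y
  proof (rule summable_comparison_test')
    show "summable (\<lambda>m. rGamma (\<alpha> + 1) * (\<bar>y\<bar> ^ m / fact m))"
      using summable_exp[of "\<bar>y\<bar>"] by (intro summable_mult) (simp add: divide_inverse mult.commute)
    show "norm ((- 1) ^ m * rGamma (real m + \<alpha> + 1) / fact m * y ^ m) \<le> rGamma (\<alpha> + 1) * (\<bar>y\<bar> ^ m / fact m)" for m
      using mult_right_mono[OF rGamma_shift_bound[OF assms(1), of m], of "\<bar>y\<bar> ^ m / fact m"]
      by (simp add: abs_mult power_abs)
  qed
  define h where "h = (\<lambda>y. \<Sum>m. (- 1) ^ m * rGamma (real m + \<alpha> + 1) / fact m * y ^ m)"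
  have "isCont h y" for y
    unfolding h_def by (rule isCont_powser_converges_everywhere[OF sm])
  hence h: "continuous_on UNIV h" by (simp add: continuous_at_imp_continuous_on)
  have "continuous_on {a..b} (\<lambda>c. h (c\<^sup>2))"
    by (rule continuous_on_compose2[OF h]) (auto intro!: continuous_intros)
  moreover have "continuous_on {a..b} (\<lambda>c. rpow c \<alpha>)"
    unfolding continuous_on_def
    using assms by (intro ballI tendsto_rpow tendsto_ident_at) (auto simp: eventually_at_filter)
  ultimately have "continuous_on {a..b} (\<lambda>c. h (c\<^sup>2) * rpow c \<alpha>)" by (intro continuous_on_mult)
  thus ?thesis by (simp add: bessel_J_def h_def power_mult)
qed

lemma continuous_laguerre_fun:
  assumes "\<alpha> \<ge> 0"
  shows "continuous_on {0..R} (laguerre_fun k \<alpha>)"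
proof -
  have "continuous_on {0..R} (\<lambda>c. rpow c (\<alpha> / 2))"
    unfolding continuous_on_def
    using assms by (intro ballI tendsto_rpow tendsto_ident_at) (auto simp: eventually_at_filter)
  thus ?thesis unfolding laguerre_fun_def laguerre_poly_def by (intro continuous_intros) auto
qed

section \<open>The Laguerre propagator\<close>

text \<open>Time derivative coefficient by coefficient: the series stay formal in the space
  variable, so no radius of convergence has to be followed as \<open>t\<close> varies.\<close>

definition fps_has_tderiv ::
    "(real \<Rightarrow> complex fps) \<Rightarrow> complex fps \<Rightarrow> real \<Rightarrow> bool" where
  "fps_has_tderiv F F' t \<longleftrightarrow> (\<forall>n. ((\<lambda>s. F s $ n) has_vector_derivative F' $ n) (at t))"

lemma fps_has_tderiv_mult:
  assumes "fps_has_tderiv F F' t" "fps_has_tderiv G G' t"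
  shows "fps_has_tderiv (\<lambda>s. F s * G s) (F t * G' + F' * G t) t"
  unfolding fps_has_tderiv_def
proof
  fix n
  have "((\<lambda>s. \<Sum>i=0..n. F s $ i * G s $ (n - i)) has_vector_derivative
      (\<Sum>i=0..n. F t $ i * G' $ (n - i) + F' $ i * G t $ (n - i))) (at t)"
    using assms unfolding fps_has_tderiv_def
    by (intro has_vector_derivative_sum has_vector_derivative_mult) auto
  thus "((\<lambda>s. (F s * G s) $ n) has_vector_derivative (F t * G' + F' * G t) $ n) (at t)"
    by (simp add: fps_mult_nth sum.distrib)
qed

lemma fps_has_tderiv_power:
  assumes "fps_has_tderiv F F' t"
  shows "fps_has_tderiv (\<lambda>s. F s ^ m) (of_nat m * F t ^ (m - 1) * F') t"
proof (induction m)
  case 0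
  show ?case by (simp add: fps_has_tderiv_def)
next
  case (Suc m)
  have "F t * (of_nat m * F t ^ (m - 1) * F') + F' * F t ^ m = of_nat (Suc m) * F t ^ (Suc m - 1) * F'"
    by (cases m) (simp_all add: algebra_simps)
  with fps_has_tderiv_mult[OF assms Suc] show ?case by simp
qed

text \<open>The generating functions \<open>((1 - \<i>t) z - \<i>t)\<^sup>m (1 + \<i>t + \<i>tz)\<^sup>-\<^sup>m\<^sup>-\<^sup>\<alpha>\<^sup>-\<^sup>1\<close> of the columns come from integrating
  the flow of \<open>(1 + z)\<^sup>2 d/dz + (\<alpha> + 1)(1 + z)\<close>, to which the operator is conjugate.\<close>

definition binser :: "real \<Rightarrow> real \<Rightarrow> complex fps" where
  "binser p t = Abs_fps (\<lambda>j. complex_of_real ((- p) gchoose j) * (\<i> * t) ^ j * (1 + \<i> * t) powr (- of_real (p + real j)))"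

definition numser :: "real \<Rightarrow> complex fps" where
  "numser t = fps_const (- \<i> * t) + fps_const (1 - \<i> * t) * fps_X"

definition lag_gen :: "real \<Rightarrow> nat \<Rightarrow> real \<Rightarrow> complex fps" where
  "lag_gen \<alpha> m t = numser t ^ m * binser (real m + \<alpha> + 1) t"

lemma powr_Suc_complex: "z \<noteq> 0 \<Longrightarrow> z powr (- of_real (x + 1)) * z = z powr (- of_real x)" for z :: complex
  by (simp add: powr_diff powr_minus)

lemma tau_nonzero: "1 + \<i> * complex_of_real t \<noteq> 0"
  by (auto simp: complex_eq_iff)

lemma tau_powr_deriv:
  "((\<lambda>s. (1 + \<i> * complex_of_real s) powr a) has_vector_derivative
     \<i> * a * (1 + \<i> * complex_of_real t) powr (a - 1)) (at t)"
proof -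
  have "((\<lambda>w. (1 + \<i> * w) powr a) has_field_derivative \<i> * a * (1 + \<i> * of_real t) powr (a - 1)) (at (of_real t))"
    by (rule derivative_eq_intros refl | simp add: complex_nonpos_Reals_iff)+
  from has_vector_derivative_real_field[OF this] show ?thesis by simp
qed

lemma binser_nth_Suc: 
  "binser p t $ Suc j = complex_of_real ((- p) gchoose Suc j) * (\<i> * t) ^ Suc j * (1 + \<i> * t) powr (- of_real (p + real (Suc j)))"
  unfolding binser_def by (rule fps_nth_Abs_fps)

text \<open>\<open>binser p t\<close> stands for the power \<open>- p\<close> of
  \<open>1 + \<i>t + \<i>tz\<close>, expanded in \<open>z\<close>, and this is its chain rule. As
  the series is given by coefficients, the chain rule becomes a pair of absorption identities for
  binomial coefficients.\<close>

lemma binser_tderiv: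
  "fps_has_tderiv (binser p) (- fps_const (\<i> * of_real p) * (1 + fps_X) * binser (p + 1) t) t"
  unfolding fps_has_tderiv_def
proof
  fix j
  define \<tau> where "\<tau> = 1 + \<i> * complex_of_real t"
  have \<tau>: "\<tau> \<noteq> 0" unfolding \<tau>_def by (rule tau_nonzero)
  define g where "g = complex_of_real ((- p) gchoose j)"
  have d1: "((\<lambda>s. (\<i> * complex_of_real s) ^ j) has_vector_derivative of_nat j * (\<i> * t) ^ (j - 1) * \<i>) (at t)"
  proof -
    have "((\<lambda>w. (\<i> * w) ^ j) has_field_derivative of_nat j * (\<i> * of_real t) ^ (j - 1) * \<i>) (at (of_real t))"
      by (rule derivative_eq_intros refl | simp)+
    from has_vector_derivative_real_field[OF this] show ?thesis by simp
  qed
  have "((\<lambda>s. g * ((\<i> * s) ^ j * (1 + \<i> * s) powr (- of_real (p + real j)))) has_vector_derivative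
    g * ((\<i> * t) ^ j * (\<i> * (- of_real (p + real j)) * (1 + \<i> * t) powr (- of_real (p + real j) - 1)) +
      (of_nat j * (\<i> * t) ^ (j - 1) * \<i>) * (1 + \<i> * t) powr (- of_real (p + real j)))) (at t)"
    by (intro has_vector_derivative_mult_right has_vector_derivative_mult d1 tau_powr_deriv)
  also have "g * ((\<i> * t) ^ j * (\<i> * (- of_real (p + real j)) * (1 + \<i> * t) powr (- of_real (p + real j) - 1)) +
      (of_nat j * (\<i> * t) ^ (j - 1) * \<i>) * (1 + \<i> * t) powr (- of_real (p + real j))) =
      (- fps_const (\<i> * of_real p) * (1 + fps_X) * binser (p + 1) t) $ j"
  proof -
    \<comment> \<open>Of the two terms of the product rule, the one from the power of
      \<open>1 + \<i>t\<close> uses this identity; the one from \<open>(\<i> * t) ^ j\<close> uses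
      absorption of the lower index, in \<open>c2\<close>.\<close>
    have abs: "(- p - real j) * ((- p) gchoose j) = - p * ((- p - 1) gchoose j)"
      using gbinomial_absorb_comp[of "- p" j] by simp
    have c1: "of_real (p + real j) * g = of_real p * complex_of_real ((- (p + 1)) gchoose j)"
    proof -
      have "(p + real j) * ((- p) gchoose j) = p * ((- (p + 1)) gchoose j)" 
      proof -
        have m: "- p - 1 = - (p + 1)" by simp
        show ?thesis using abs unfolding m by (simp add: left_diff_distrib distrib_right)
      qed
      thus ?thesis unfolding g_def by (simp only: flip: of_real_mult)
    qed
    have e: "- of_real (p + real j) - 1 = (- of_real (p + 1 + real j) :: complex)" by simp
    show ?thesis
    proof (cases j)
      case 0
      thus ?thesis using c1 unfolding e by (simp add: g_def binser_def mult.assoc)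
    next
      case (Suc i)
      have c2: "of_nat j * g = - of_real p * complex_of_real ((- (p + 1)) gchoose i)"
      proof -
        have "real (Suc i) * ((- p) gchoose Suc i) = - p * ((- p - 1) gchoose i)"
          by (rule gbinomial_absorption)
        hence "real j * ((- p) gchoose j) = - p * ((- (p + 1)) gchoose i)" unfolding Suc by simp
        hence "complex_of_real (real j * ((- p) gchoose j)) = complex_of_real (- p * ((- (p + 1)) gchoose i))" by (rule arg_cong)
        thus ?thesis unfolding g_def by simp
      qed
      have e2: "- of_real (p + 1 + real i) = (- of_real (p + real j) :: complex)" by (simp add: Suc)
      have "(- fps_const (\<i> * of_real p) * (1 + fps_X) * binser (p + 1) t) $ j =
        - (\<i> * of_real p) * (binser (p + 1) t $ Suc i + binser (p + 1) t $ i)"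
        unfolding Suc by (simp add: algebra_simps)
      also have "\<dots> = - \<i> * (of_real p * complex_of_real ((- (p + 1)) gchoose j)) * (\<i> * t) ^ j * (1 + \<i> * t) powr (- of_real (p + 1 + real j))
        + \<i> * (- of_real p * complex_of_real ((- (p + 1)) gchoose i)) * (\<i> * t) ^ i * (1 + \<i> * t) powr (- of_real (p + 1 + real i))"
      proof -
        have "- (\<i> * P) * (u * x * A + v * z * B) = - \<i> * (P * u) * x * A + \<i> * (- P * v) * z * B"
          for P u v x z A B :: complex by (simp add: algebra_simps)
        thus ?thesis unfolding binser_def fps_nth_Abs_fps Suc[symmetric] .
      qed
      finally have f: "(- fps_const (\<i> * of_real p) * (1 + fps_X) * binser (p + 1) t) $ j =
          - \<i> * (of_real (p + real j) * g) * (\<i> * t) ^ j * (1 + \<i> * t) powr (- of_real (p + 1 + real j))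
        + \<i> * (of_nat j * g) * (\<i> * t) ^ i * (1 + \<i> * t) powr (- of_real (p + real j))"
        unfolding c1[symmetric] c2[symmetric] e2 .
      have alg: "g * (x * (\<i> * (- P) * A) + (N * z * \<i>) * B) = - \<i> * (P * g) * x * A + \<i> * (N * g) * z * B"
        for P N x z A B :: complex by (simp add: algebra_simps)
      have i: "j - 1 = i" by (simp add: Suc)
      show ?thesis unfolding f e i by (rule alg)
    qed
  qed
  finally show "((\<lambda>s. binser p s $ j) has_vector_derivative (- fps_const (\<i> * of_real p) * (1 + fps_X) * binser (p + 1) t) $ j) (at t)"
    by (simp add: binser_def g_def mult.assoc)
qed

lemma binser_fps_deriv: "fps_deriv (binser p t) = - fps_const (\<i> * of_real p * of_real t) * binser (p + 1) t"
proof (rule fps_ext)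
  fix j
  have "real (Suc j) * ((- p) gchoose Suc j) = - p * ((- p - 1) gchoose j)"
    by (rule gbinomial_absorption)
  hence "complex_of_real (real (Suc j) * ((- p) gchoose Suc j)) = complex_of_real (- p * ((- (p + 1)) gchoose j))" by simp
  hence c: "of_nat (Suc j) * complex_of_real ((- p) gchoose Suc j) = - of_real p * complex_of_real ((- (p + 1)) gchoose j)"
    by (simp only: of_real_mult of_real_of_nat_eq of_real_minus)
  have e: "p + real (Suc j) = p + 1 + real j" by simp
  have "fps_deriv (binser p t) $ j = (of_nat (Suc j) * complex_of_real ((- p) gchoose Suc j)) * (\<i> * t) ^ Suc j * (1 + \<i> * t) powr (- of_real (p + real (Suc j)))"
    by (simp only: fps_deriv_nth binser_nth_Suc Suc_eq_plus1[symmetric] mult.assoc)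
  also have "\<dots> = (- fps_const (\<i> * of_real p * of_real t) * binser (p + 1) t) $ j"
    unfolding c e by (simp add: binser_def)
  finally show "fps_deriv (binser p t) $ j = (- fps_const (\<i> * of_real p * of_real t) * binser (p + 1) t) $ j" .
qed

text \<open>Multiplication by the base raises the exponent by one, which is Pascal's rule on
  coefficients. It brings all terms of the evolution equation to the common factor
  \<open>binser (p + 1)\<close>.\<close>

lemma binser_shift: "binser p t = (fps_const (1 + \<i> * t) + fps_const (\<i> * t) * fps_X) * binser (p + 1) t"
proof (rule fps_ext)
  fix j
  define \<tau> where "\<tau> = 1 + \<i> * complex_of_real t"
  have \<tau>: "\<tau> \<noteq> 0" unfolding \<tau>_def by (rule tau_nonzero)
  have sh: "\<tau> * (x * \<tau> powr (- of_real (p + 1 + real j))) = x * \<tau> powr (- of_real (p + real j))" for x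
    using powr_Suc_complex[OF \<tau>, of "p + real j"] by (simp add: algebra_simps)
  show "binser p t $ j = ((fps_const (1 + \<i> * t) + fps_const (\<i> * t) * fps_X) * binser (p + 1) t) $ j"
  proof (cases j)
    case 0
    thus ?thesis using sh[of 1] by (simp add: binser_def distrib_right mult.assoc flip: \<tau>_def)
  next
    case (Suc i)
    have m: "- (p + 1) + 1 = - p" by simp
    have "(- p) gchoose j = ((- (p + 1)) gchoose j) + ((- (p + 1)) gchoose i)"
      using gbinomial_Suc_Suc[of "- (p + 1)" i] unfolding Suc m by (simp only: add.commute)
    hence c: "complex_of_real ((- p) gchoose j) = complex_of_real ((- (p + 1)) gchoose j) + complex_of_real ((- (p + 1)) gchoose i)"
      by simp
    have e: "p + 1 + real i = p + real j" by (simp add: Suc)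
    have "((fps_const (1 + \<i> * t) + fps_const (\<i> * t) * fps_X) * binser (p + 1) t) $ j =
        \<tau> * binser (p + 1) t $ j + (\<i> * t) * binser (p + 1) t $ i"
      unfolding Suc \<tau>_def by (simp add: distrib_right mult.assoc del: fps_const_add fps_const_mult)
    also have "\<dots> = \<tau> * (complex_of_real ((- (p + 1)) gchoose j) * (\<i> * t) ^ j * \<tau> powr (- of_real (p + 1 + real j))) +
        complex_of_real ((- (p + 1)) gchoose i) * (\<i> * t) ^ j * \<tau> powr (- of_real (p + 1 + real i))"
      unfolding binser_def fps_nth_Abs_fps \<tau>_def Suc by simp
    also have "\<dots> = binser p t $ j"
      unfolding sh e by (simp add: binser_def c \<tau>_def algebra_simps)
    finally show ?thesis ..
  qed
qed

lemma numser_tderiv: "fps_has_tderiv numser (- fps_const \<i> * (1 + fps_X)) t"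
  unfolding fps_has_tderiv_def
proof
  fix n
  show "((\<lambda>s. numser s $ n) has_vector_derivative (- fps_const \<i> * (1 + fps_X)) $ n) (at t)"
    unfolding numser_def
    by (cases "n = 0"; cases "n = 1") (auto intro!: derivative_eq_intros simp: fps_X_nth)
qed

text \<open>In the variable \<open>X = 1 + z\<close> the vector field is \<open>X\<^sup>2\<close>
  times the derivative, and the generating function is built from two functions affine in
  \<open>X\<close>, namely \<open>N = X * (1 - c * T) - 1\<close> and
  \<open>D = 1 + c * T * X\<close>. Once \<open>binser (p + 1)\<close> is factored out, the
  evolution equation is a polynomial identity.\<close>

lemma lag_gen_tderiv:
  "fps_has_tderiv (lag_gen \<alpha> m)
     (- fps_const \<i> * ((1 + fps_X)\<^sup>2 * fps_deriv (lag_gen \<alpha> m t) + fps_const (of_real (\<alpha> + 1)) * (1 + fps_X) * lag_gen \<alpha> m t)) t"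
proof -
  define p where "p = real m + \<alpha> + 1"
  define N where "N = numser t"
  define E where "E = binser (p + 1) t"
  define D where "D = fps_const (1 + \<i> * t) + fps_const (\<i> * t) * fps_X"
  have bE: "binser p t = D * E" unfolding D_def E_def by (rule binser_shift)
  have dN: "fps_deriv N = fps_const (1 - \<i> * t)" by (simp add: N_def numser_def)
  have dt: "fps_has_tderiv (lag_gen \<alpha> m)
     (N ^ m * (- fps_const (\<i> * of_real p) * (1 + fps_X) * E) + (of_nat m * N ^ (m - 1) * (- fps_const \<i> * (1 + fps_X))) * (D * E)) t"
    using fps_has_tderiv_mult[OF fps_has_tderiv_power[OF numser_tderiv] binser_tderiv, of m p t]
    unfolding lag_gen_def[abs_def] p_def[symmetric] N_def[symmetric] bE E_def[symmetric] .
  have dz: "fps_deriv (lag_gen \<alpha> m t) = N ^ m * (- fps_const (\<i> * of_real p * of_real t) * E) + of_nat m * N ^ (m - 1) * fps_const (1 - \<i> * t) * (D * E)"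
  proof -
    have "fps_deriv (lag_gen \<alpha> m t) = N ^ m * fps_deriv (binser p t) + fps_deriv (N ^ m) * binser p t"
      unfolding lag_gen_def p_def[symmetric] N_def[symmetric] by simp
    thus ?thesis
      unfolding binser_fps_deriv E_def[symmetric] unfolding bE fps_deriv_power dN fps_of_nat
      by (simp only: mult_ac)
  qed
  have lg: "lag_gen \<alpha> m t = N ^ m * (D * E)" unfolding lag_gen_def p_def[symmetric] bE N_def ..
  define c where "c = (fps_const \<i> :: complex fps)"
  define T where "T = (fps_const (of_real t) :: complex fps)"
  define X where "X = (1 + fps_X :: complex fps)"
  define A where "A = (fps_const (of_real \<alpha>) :: complex fps)"
  define M where "M = (of_nat m :: complex fps)"
  have cc: "fps_const \<i> = c" "fps_const (\<i> * of_real p) = c * (M + A + 1)" "fps_const (\<i> * of_real p * of_real t) = c * (M + A + 1) * T"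
    "fps_const (1 - \<i> * t) = 1 - c * T" "fps_const (of_real (\<alpha> + 1)) = A + 1"
    by (simp_all add: c_def M_def A_def T_def p_def fps_of_nat[symmetric] fps_const_mult[symmetric] fps_const_add[symmetric]
       fps_const_sub[symmetric] del: fps_const_mult fps_const_add fps_const_sub)
  have DD: "D = 1 + c * T * X" "N = X * (1 - c * T) - 1"
    by (simp_all add: D_def N_def numser_def c_def T_def X_def algebra_simps fps_const_mult[symmetric] fps_const_add[symmetric]
       fps_const_sub[symmetric] del: fps_const_mult fps_const_add fps_const_sub)
  have "N ^ m * (- fps_const (\<i> * of_real p) * (1 + fps_X) * E) + (of_nat m * N ^ (m - 1) * (- fps_const \<i> * (1 + fps_X))) * (D * E) =
     - fps_const \<i> * ((1 + fps_X)\<^sup>2 * fps_deriv (lag_gen \<alpha> m t) + fps_const (of_real (\<alpha> + 1)) * (1 + fps_X) * lag_gen \<alpha> m t)"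
  proof -
    define K where "K = N ^ (m - 1)"
    \<comment> \<open>The condition on \<open>P\<close> is weaker than \<open>P = N * K\<close> so
      as to include \<open>m = 0\<close>, where \<open>N ^ 0\<close> is not \<open>N * K\<close> but
      both sides are multiplied by 0.\<close>
    have alg: "P * (- (c * (M + A + 1)) * X * E) + (M * K * (- c * X)) * (D * E) =
      - c * (X * X * (P * (- (c * (M + A + 1) * T) * E) + M * K * (1 - c * T) * (D * E)) + (A + 1) * X * (P * (D * E)))"
      if "M * P = M * (N * K)" for P
      using that unfolding DD by algebra
    have "M * N ^ m = M * (N * K)" by (cases m) (auto simp: M_def K_def)
    from alg[OF this] show ?thesis
      unfolding dz unfolding lg unfolding cc X_def[symmetric] M_def[symmetric] K_def[symmetric] power2_eq_square .
  qed
  thus ?thesis using dt by simp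
qed


text \<open>Up to a constant factor, the reciprocal norms of the Laguerre polynomials. Conjugation
  by the diagonal matrix with these entries replaces the square roots off the diagonal by
  \<open>n + \<alpha>\<close> and \<open>n + 1\<close>, the coefficients of a differential
  operator.\<close>

definition lag_r :: "real \<Rightarrow> nat \<Rightarrow> real" where
  "lag_r \<alpha> n = sqrt (fact n / pochhammer (\<alpha> + 1) n)"

definition lag_col :: "real \<Rightarrow> nat \<Rightarrow> real \<Rightarrow> nat \<Rightarrow> complex" where
  "lag_col \<alpha> m t n = complex_of_real (lag_r \<alpha> n / lag_r \<alpha> m) * lag_gen \<alpha> m t $ n"

abbreviation lag_a :: "real \<Rightarrow> nat \<Rightarrow> real" where
  "lag_a \<alpha> n \<equiv> sqrt (real n * (real n + \<alpha>))"

abbreviation lag_b :: "real \<Rightarrow> nat \<Rightarrow> real" where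
  "lag_b \<alpha> n \<equiv> 2 * real n + 1 + \<alpha>"

lemma laguerre_op_eq_jac: "laguerre_op \<alpha> = jac (lag_a \<alpha>) (lag_b \<alpha>)"
  by (auto simp: laguerre_op_def jac_def fun_eq_iff add_ac)

lemma lag_pochhammer_pos: "\<alpha> \<ge> 0 \<Longrightarrow> pochhammer (\<alpha> + 1) n > 0" for \<alpha> :: real
  by (intro pochhammer_pos) auto

lemma lag_r_pos: "\<alpha> \<ge> 0 \<Longrightarrow> lag_r \<alpha> n > 0"
  using lag_pochhammer_pos[of \<alpha> n] by (simp add: lag_r_def)

lemma lag_r_le_1: 
  assumes "\<alpha> \<ge> 0"
  shows "lag_r \<alpha> n \<le> 1"
proof -
  have "fact n \<le> pochhammer (\<alpha> + 1) n"
    unfolding pochhammer_fact pochhammer_prod using assms by (intro prod_mono) auto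
  thus ?thesis using lag_pochhammer_pos[OF assms, of n] by (simp add: lag_r_def)
qed

lemma lag_a_r:
  assumes "\<alpha> \<ge> 0"
  shows "lag_a \<alpha> (Suc n) * lag_r \<alpha> (Suc n) = real (Suc n) * lag_r \<alpha> n"
    and "lag_a \<alpha> (Suc n) * lag_r \<alpha> n = (real (Suc n) + \<alpha>) * lag_r \<alpha> (Suc n)"
proof -
  define q where "q = fact n / pochhammer (\<alpha> + 1) n"
  define x where "x = real (Suc n)"
  have x: "x > 0" "x + \<alpha> > 0" using assms by (auto simp: x_def)
  have "\<alpha> + 1 + real n = x + \<alpha>" by (simp add: x_def)
  hence rS: "lag_r \<alpha> (Suc n) = sqrt (x / (x + \<alpha>)) * sqrt q"
    unfolding lag_r_def q_def pochhammer_Suc fact_Suc x_def[symmetric]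
    by (simp flip: real_sqrt_mult)
  have r: "lag_r \<alpha> n = sqrt q" by (simp add: lag_r_def q_def)
  have "lag_a \<alpha> (Suc n) * lag_r \<alpha> (Suc n) = sqrt (x * (x + \<alpha>) * (x / (x + \<alpha>))) * sqrt q"
    unfolding rS x_def[symmetric] by (simp only: real_sqrt_mult mult.assoc)
  also have "x * (x + \<alpha>) * (x / (x + \<alpha>)) = x\<^sup>2" using x by (simp add: power2_eq_square)
  finally show "lag_a \<alpha> (Suc n) * lag_r \<alpha> (Suc n) = real (Suc n) * lag_r \<alpha> n"
    using x unfolding r x_def[symmetric] by simp
  have s: "sqrt ((x + \<alpha>)\<^sup>2) = x + \<alpha>" using x by simp
  have "(x + \<alpha>) * lag_r \<alpha> (Suc n) = sqrt ((x + \<alpha>)\<^sup>2 * (x / (x + \<alpha>))) * sqrt q"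
    unfolding rS real_sqrt_mult[of "(x + \<alpha>)\<^sup>2"] s by (simp only: mult.assoc)
  also have "(x + \<alpha>)\<^sup>2 * (x / (x + \<alpha>)) = x * (x + \<alpha>)" using x by (simp add: power2_eq_square)
  finally have "(x + \<alpha>) * lag_r \<alpha> (Suc n) = sqrt (x * (x + \<alpha>)) * sqrt q" .
  thus "lag_a \<alpha> (Suc n) * lag_r \<alpha> n = (real (Suc n) + \<alpha>) * lag_r \<alpha> (Suc n)"
    by (simp only: r x_def)
qed

text \<open>On coefficients, the operator acting on the generating function has the entries
  \<open>n + 1\<close>, \<open>2 * n + 1 + \<alpha>\<close> and \<open>n + \<alpha>\<close> at
  positions \<open>n + 1\<close>, \<open>n\<close> and \<open>n - 1\<close>; by
  \<open>lag_a_r\<close> this matrix is conjugate to the symmetric one.\<close>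

lemma lag_col_deriv:
  assumes "\<alpha> \<ge> 0"
  shows "((\<lambda>s. lag_col \<alpha> m s n) has_vector_derivative
    - \<i> * jac (lag_a \<alpha>) (lag_b \<alpha>) (lag_col \<alpha> m t) n) (at t)"
proof -
  define F where "F = lag_gen \<alpha> m t"
  define r where "r = lag_r \<alpha>"
  have rm: "r m > 0" using lag_r_pos[OF assms] by (simp add: r_def)
  define G where "G = (1 + fps_X)\<^sup>2 * fps_deriv F + fps_const (of_real (\<alpha> + 1)) * (1 + fps_X) * F"
  have "((\<lambda>s. complex_of_real (r n / r m) * lag_gen \<alpha> m s $ n) has_vector_derivative
      complex_of_real (r n / r m) * (- fps_const \<i> * G) $ n) (at t)"
    using lag_gen_tderiv[of \<alpha> m t] unfolding fps_has_tderiv_def F_def G_def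
    by (intro has_vector_derivative_mult_right) blast
  also have "complex_of_real (r n / r m) * (- fps_const \<i> * G) $ n = - \<i> * jac (lag_a \<alpha>) (lag_b \<alpha>) (lag_col \<alpha> m t) n"
  proof -
    have c: "lag_col \<alpha> m t k = complex_of_real (r k) * F $ k / complex_of_real (r m)" for k
      by (simp add: lag_col_def r_def F_def)
    have G: "G = fps_deriv F + 2 * (fps_X * fps_deriv F) + fps_X * (fps_X * fps_deriv F) + fps_const (of_real (\<alpha> + 1)) * (F + fps_X * F)"
      by (simp add: G_def power2_eq_square algebra_simps)
    have a1: "complex_of_real (lag_a \<alpha> (Suc k)) * complex_of_real (r (Suc k)) = of_nat (Suc k) * complex_of_real (r k)" for k
      using lag_a_r(1)[OF assms, of k] unfolding r_def by (metis of_real_mult of_real_of_nat_eq)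
    have a2: "complex_of_real (lag_a \<alpha> (Suc k)) * complex_of_real (r k) = (of_nat (Suc k) + of_real \<alpha>) * complex_of_real (r (Suc k))" for k
      using lag_a_r(2)[OF assms, of k] unfolding r_def by (metis of_real_mult of_real_of_nat_eq of_real_add)
    have "complex_of_real (r n) * G $ n = complex_of_real (lag_a \<alpha> n) * (if n = 0 then 0 else complex_of_real (r (n - 1)) * F $ (n - 1)) +
      complex_of_real (lag_b \<alpha> n) * (complex_of_real (r n) * F $ n) + complex_of_real (lag_a \<alpha> (Suc n)) * (complex_of_real (r (Suc n)) * F $ Suc n)"
    proof (cases n)
      case 0
      have 1: "complex_of_real (lag_a \<alpha> (Suc 0)) * (complex_of_real (r (Suc 0)) * F $ Suc 0) = complex_of_real (r 0) * F $ Suc 0"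
        by (simp only: mult.assoc[symmetric] a1) simp
      show ?thesis unfolding 0 1 unfolding G by (simp add: numeral_fps_const algebra_simps)
    next
      case (Suc k)
      have G2: "G $ Suc k = of_nat (Suc (Suc k)) * F $ Suc (Suc k) + 2 * of_nat (Suc k) * F $ Suc k + of_nat k * F $ k +
          (of_real \<alpha> + 1) * (F $ Suc k + F $ k)"
        unfolding G by (cases k; simp add: numeral_fps_const; (simp add: algebra_simps)?)
      have 1: "complex_of_real (lag_a \<alpha> (Suc k)) * (complex_of_real (r k) * F $ k) = (of_nat (Suc k) + of_real \<alpha>) * complex_of_real (r (Suc k)) * F $ k"
        using a2[of k] by (simp only: mult.assoc[symmetric])
      have 2: "complex_of_real (lag_a \<alpha> (Suc (Suc k))) * (complex_of_real (r (Suc (Suc k))) * F $ Suc (Suc k)) =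
          of_nat (Suc (Suc k)) * complex_of_real (r (Suc k)) * F $ Suc (Suc k)"
        using a1[of "Suc k"] by (simp only: mult.assoc[symmetric])
      have s: "(if Suc k = 0 then 0 else complex_of_real (r (Suc k - 1)) * F $ (Suc k - 1)) = complex_of_real (r k) * F $ k"
        by simp
      show ?thesis unfolding Suc s G2 2 1 by (simp add: algebra_simps)
    qed
    hence "complex_of_real (r n / r m) * G $ n = jac (lag_a \<alpha>) (lag_b \<alpha>) (lag_col \<alpha> m t) n"
      unfolding jac_def c using rm by (simp add: field_simps)
    moreover have "(- fps_const \<i> * G) $ n = - \<i> * G $ n" by simp
    ultimately show ?thesis by (simp only: mult.left_commute[of "complex_of_real (r n / r m)"])
  qed
  finally show ?thesis unfolding lag_col_def r_def .
qed

section \<open>Closed form, symmetry and decay of the columns\<close>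

lemma fps_linear_power_nth:
  fixes a b :: "'a :: comm_ring_1"
  shows "(fps_const a + fps_const b * fps_X) ^ m $ k = of_nat (m choose k) * b ^ k * a ^ (m - k)"
proof (induction m arbitrary: k)
  case 0
  show ?case by (cases k) auto
next
  case (Suc m)
  show ?case
  proof (cases k)
    case 0
    thus ?thesis by (simp add: Suc.IH)
  next
    case (Suc i)
    have "(fps_const a + fps_const b * fps_X) ^ Suc m $ k = a * (of_nat (m choose Suc i) * b ^ Suc i * a ^ (m - Suc i)) + b * (of_nat (m choose i) * b ^ i * a ^ (m - i))"
      by (simp add: Suc Suc.IH distrib_right mult.assoc)
    also have "a * (of_nat (m choose Suc i) * b ^ Suc i * a ^ (m - Suc i)) = of_nat (m choose Suc i) * b ^ Suc i * a ^ (m - i)"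
    proof (cases "Suc i \<le> m")
      case True
      hence "m - i = Suc (m - Suc i)" by simp
      thus ?thesis by simp
    qed (simp add: binomial_eq_0)
    also have "\<dots> + b * (of_nat (m choose i) * b ^ i * a ^ (m - i)) = of_nat (Suc m choose k) * b ^ k * a ^ (Suc m - k)"
      by (simp add: Suc algebra_simps)
    finally show ?thesis .
  qed
qed

lemma lag_gen_nth:
  "lag_gen \<alpha> m t $ n = (\<Sum>k\<le>n. of_nat (m choose k) * (1 - \<i> * t) ^ k * (- \<i> * t) ^ (m - k) *
     (complex_of_real ((- (real m + \<alpha> + 1)) gchoose (n - k)) * (\<i> * t) ^ (n - k) *
      (1 + \<i> * t) powr (- of_real (real m + \<alpha> + 1 + real (n - k)))))"
  unfolding lag_gen_def numser_def fps_mult_nth fps_linear_power_nth binser_def fps_nth_Abs_fps atMost_atLeast0 ..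

text \<open>This form makes the symmetry of the propagator in its two indices visible.\<close>

lemma lag_col_explicit:
  assumes "\<alpha> \<ge> 0"
  shows "lag_col \<alpha> m t n = complex_of_real (lag_r \<alpha> n * lag_r \<alpha> m) *
    (\<Sum>k\<le>min m n. complex_of_real (pochhammer (\<alpha> + 1) (m + n - k) / (fact k * fact (m - k) * fact (n - k))) *
      (1 - \<i> * t) ^ k * (- \<i> * t) ^ (m + n - 2 * k) * (1 + \<i> * t) powr (- of_real (real (m + n - k) + \<alpha> + 1)))"
proof -
  define q where "q = fact m / pochhammer (\<alpha> + 1) m"
  have q: "q > 0" "lag_r \<alpha> m = sqrt q" using lag_pochhammer_pos[OF assms] by (auto simp: q_def lag_r_def)
  have rr: "lag_r \<alpha> n / lag_r \<alpha> m = lag_r \<alpha> n * lag_r \<alpha> m * (1 / q)"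
    using q by (simp add: field_simps flip: power2_eq_square)
  have "lag_gen \<alpha> m t $ n = (\<Sum>k\<le>min m n. of_nat (m choose k) * (1 - \<i> * t) ^ k * (- \<i> * t) ^ (m - k) *
     (complex_of_real ((- (real m + \<alpha> + 1)) gchoose (n - k)) * (\<i> * t) ^ (n - k) *
      (1 + \<i> * t) powr (- of_real (real m + \<alpha> + 1 + real (n - k)))))"
    unfolding lag_gen_nth by (intro sum.mono_neutral_right) (auto simp: binomial_eq_0)
  also have "\<dots> = complex_of_real q * (\<Sum>k\<le>min m n. complex_of_real (pochhammer (\<alpha> + 1) (m + n - k) / (fact k * fact (m - k) * fact (n - k))) *
      (1 - \<i> * t) ^ k * (- \<i> * t) ^ (m + n - 2 * k) * (1 + \<i> * t) powr (- of_real (real (m + n - k) + \<alpha> + 1)))"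
    unfolding sum_distrib_left
  proof (intro sum.cong refl)
    fix k assume "k \<in> {..min m n}"
    hence k: "k \<le> m" "k \<le> n" by auto
    define j where "j = n - k"
    have e: "m + n - k = m + j" "m + n - 2 * k = (m - k) + j" using k by (auto simp: j_def)
    have "(- (real m + \<alpha> + 1)) gchoose j = (- 1) ^ j * pochhammer (real m + \<alpha> + 1) j / fact j"
      using gbinomial_pochhammer[of "- (real m + \<alpha> + 1)" j] by (simp only: minus_minus)
    moreover have "pochhammer (\<alpha> + 1) (m + j) = pochhammer (\<alpha> + 1) m * pochhammer (real m + \<alpha> + 1) j"
      using pochhammer_product'[of "\<alpha> + 1" m j] by (simp only: add_ac)
    moreover have "real (m choose k) = fact m / (fact k * fact (m - k))" by (rule binomial_fact[OF k(1)])
    ultimately have "real (m choose k) * ((- (real m + \<alpha> + 1)) gchoose j) =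
        (- 1) ^ j * (q * (pochhammer (\<alpha> + 1) (m + j) / (fact k * fact (m - k) * fact j)))"
      using lag_pochhammer_pos[OF assms, of m] by (simp add: q_def)
    hence "complex_of_real (real (m choose k) * ((- (real m + \<alpha> + 1)) gchoose j)) =
        complex_of_real ((- 1) ^ j * (q * (pochhammer (\<alpha> + 1) (m + j) / (fact k * fact (m - k) * fact j))))"
      by (rule arg_cong)
    hence c: "of_nat (m choose k) * complex_of_real ((- (real m + \<alpha> + 1)) gchoose j) =
        (- 1) ^ j * (complex_of_real q * complex_of_real (pochhammer (\<alpha> + 1) (m + j) / (fact k * fact (m - k) * fact j)))"
      by (simp only: of_real_mult of_real_power of_real_minus of_real_1 of_real_of_nat_eq)
    have s: "(- 1) ^ j * (\<i> * complex_of_real t) ^ j = (- \<i> * t) ^ j" by (simp flip: power_mult_distrib)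
    have p: "real m + \<alpha> + 1 + real j = real (m + j) + \<alpha> + 1" by simp
    have "of_nat (m choose k) * (1 - \<i> * t) ^ k * (- \<i> * t) ^ (m - k) *
      (complex_of_real ((- (real m + \<alpha> + 1)) gchoose j) * (\<i> * t) ^ j * (1 + \<i> * t) powr (- of_real (real m + \<alpha> + 1 + real j))) =
      (of_nat (m choose k) * complex_of_real ((- (real m + \<alpha> + 1)) gchoose j)) * (1 - \<i> * t) ^ k * (- \<i> * t) ^ (m - k) *
      (\<i> * t) ^ j * (1 + \<i> * t) powr (- of_real (real m + \<alpha> + 1 + real j))" by (simp only: mult_ac)
    also have "\<dots> = complex_of_real q * (complex_of_real (pochhammer (\<alpha> + 1) (m + j) / (fact k * fact (m - k) * fact j)) *
      (1 - \<i> * t) ^ k * (- \<i> * t) ^ (m - k + j) * (1 + \<i> * t) powr (- of_real (real (m + j) + \<alpha> + 1)))"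
      unfolding c p power_add s[symmetric] by (simp only: mult_ac)
    finally show "of_nat (m choose k) * (1 - \<i> * t) ^ k * (- \<i> * t) ^ (m - k) *
      (complex_of_real ((- (real m + \<alpha> + 1)) gchoose (n - k)) * (\<i> * t) ^ (n - k) * (1 + \<i> * t) powr (- of_real (real m + \<alpha> + 1 + real (n - k)))) =
      complex_of_real q * (complex_of_real (pochhammer (\<alpha> + 1) (m + n - k) / (fact k * fact (m - k) * fact (n - k))) *
      (1 - \<i> * t) ^ k * (- \<i> * t) ^ (m + n - 2 * k) * (1 + \<i> * t) powr (- of_real (real (m + n - k) + \<alpha> + 1)))"
      unfolding e j_def .
  qed
  finally have "lag_gen \<alpha> m t $ n = complex_of_real q * (\<Sum>k\<le>min m n. complex_of_real (pochhammer (\<alpha> + 1) (m + n - k) / (fact k * fact (m - k) * fact (n - k))) *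
      (1 - \<i> * t) ^ k * (- \<i> * t) ^ (m + n - 2 * k) * (1 + \<i> * t) powr (- of_real (real (m + n - k) + \<alpha> + 1)))" .
  thus ?thesis unfolding lag_col_def rr using q by simp
qed

lemma lag_col_sym:
  assumes "\<alpha> \<ge> 0"
  shows "lag_col \<alpha> m t n = lag_col \<alpha> n t m"
  unfolding lag_col_explicit[OF assms] by (simp add: min.commute add.commute mult.commute mult.left_commute)

lemma lag_col_0:
  assumes "\<alpha> \<ge> 0"
  shows "lag_col \<alpha> m 0 = delta m"
proof
  fix n
  have "binser p 0 = 1" for p
    by (rule fps_ext) (auto simp: binser_def power_0_left)
  hence "lag_gen \<alpha> m 0 = fps_X ^ m" by (simp add: lag_gen_def numser_def)
  thus "lag_col \<alpha> m 0 n = delta m n"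
    using lag_r_pos[OF assms, of m] by (simp add: lag_col_def delta_def)
qed

lemma gbinomial_geometric_bounded:
  fixes a :: real
  assumes "\<bar>x\<bar> < 1"
  shows "\<exists>B\<ge>0. \<forall>j. \<bar>(a gchoose j) * x ^ j\<bar> \<le> B"
proof -
  have "(\<lambda>j. (a gchoose j) * x ^ j) \<longlonglongrightarrow> 0"
    using gen_binomial_real[OF assms, of a] by (intro summable_LIMSEQ_zero) (auto simp: sums_iff)
  hence "Bseq (\<lambda>j. (a gchoose j) * x ^ j)" by (intro convergent_imp_Bseq convergentI)
  then obtain B where "B > 0" "\<forall>j. norm ((a gchoose j) * x ^ j) \<le> B" by (auto simp: Bseq_def)
  thus ?thesis by (intro exI[of _ B]) auto
qed

text \<open>The only singularity of the generating function in \<open>z\<close> has modulus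
  \<open>sqrt (1 + t\<^sup>2) / \<bar>t\<bar>\<close>, which exceeds 1 by a margin that is uniform
  for bounded \<open>t\<close>; \<open>\<rho>\<close> is the reciprocal at the end of the time
  interval.\<close>

lemma lag_col_decay:
  assumes "\<alpha> \<ge> 0"
  shows "\<exists>C \<rho>. 0 \<le> C \<and> 0 \<le> \<rho> \<and> \<rho> < 1 \<and> (\<forall>t n. \<bar>t\<bar> \<le> T \<longrightarrow> cmod (lag_col \<alpha> m t n) \<le> C * \<rho> ^ n)"
proof -
  define R where "R = \<bar>T\<bar>"
  define \<rho> where "\<rho> = R / sqrt (1 + R\<^sup>2)"
  \<comment> \<open>A ratio strictly between \<open>\<rho>\<close> and 1 leaves room for the growth
    of the binomial coefficients, which the constant \<open>B\<close> absorbs.\<close>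
  define \<sigma> where "\<sigma> = (1 + \<rho>) / 2"
  have sq: "sqrt (1 + x\<^sup>2) > 0" "\<bar>x\<bar> < sqrt (1 + x\<^sup>2)" for x :: real
    by (auto simp: add_pos_nonneg intro!: real_less_rsqrt)
  have \<rho>: "0 \<le> \<rho>" "\<rho> < 1" using sq[of R] by (auto simp: \<rho>_def R_def)
  have \<sigma>: "0 < \<sigma>" "\<sigma> < 1" "\<rho> < \<sigma>" using \<rho> by (auto simp: \<sigma>_def)
  define p where "p = real m + \<alpha> + 1"
  obtain B where B: "B \<ge> 0" "\<And>j. \<bar>((- p) gchoose j) * (\<rho> / \<sigma>) ^ j\<bar> \<le> B"
    using gbinomial_geometric_bounded[of "\<rho> / \<sigma>" "- p"] \<rho> \<sigma> by auto
  define C where "C = 1 / lag_r \<alpha> m * (\<Sum>k\<le>m. of_nat (m choose k) * (1 + R) ^ k * R ^ (m - k) * (B / \<sigma> ^ k))"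
  have r: "lag_r \<alpha> m > 0" by (rule lag_r_pos[OF assms])
  have R: "R \<ge> 0" by (simp add: R_def)
  have C0: "C \<ge> 0" unfolding C_def using r R B \<sigma> by (intro mult_nonneg_nonneg sum_nonneg divide_nonneg_nonneg) auto
  have "cmod (lag_col \<alpha> m t n) \<le> C * \<sigma> ^ n" if t: "\<bar>t\<bar> \<le> T" for t n
  proof -
    have tR: "\<bar>t\<bar> \<le> R" using t by (simp add: R_def)
    have tau: "cmod (1 + \<i> * t) = sqrt (1 + t\<^sup>2)" by (simp add: cmod_def)
    have ratio: "\<bar>t\<bar> / sqrt (1 + t\<^sup>2) \<le> \<rho>"
    proof -
      have "t\<^sup>2 \<le> R\<^sup>2" using tR abs_le_square_iff[of t R] R by simp
      hence "t\<^sup>2 / (1 + t\<^sup>2) \<le> R\<^sup>2 / (1 + R\<^sup>2)"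
        by (simp add: frac_le_eq field_simps add_pos_nonneg divide_le_eq) 
      from real_sqrt_le_mono[OF this] show ?thesis using R by (simp add: real_sqrt_divide \<rho>_def)
    qed
    have e: "cmod (complex_of_real ((- p) gchoose j) * (\<i> * t) ^ j * (1 + \<i> * t) powr (- of_real (p + real j))) \<le> B * \<sigma> ^ j" for j
    proof -
      have "cmod ((1 + \<i> * t) powr (- of_real (p + real j))) = sqrt (1 + t\<^sup>2) powr (- (p + real j))"
        using tau by (simp add: norm_powr_real_powr' flip: of_real_minus)
      also have "\<dots> = (sqrt (1 + t\<^sup>2) powr (- p)) * (1 / sqrt (1 + t\<^sup>2)) ^ j"
        using sq[of t] by (simp add: powr_diff powr_minus powr_realpow power_one_over divide_inverse power_inverse)
      also have "\<dots> \<le> 1 * (1 / sqrt (1 + t\<^sup>2)) ^ j"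
      proof (intro mult_right_mono)
        show "sqrt (1 + t\<^sup>2) powr (- p) \<le> 1"
          using assms by (subst powr_minus) (auto simp: p_def intro!: inverse_le_1_iff[THEN iffD2] ge_one_powr_ge_zero)
      qed auto
      finally have "cmod ((\<i> * t) ^ j * (1 + \<i> * t) powr (- of_real (p + real j))) \<le> \<bar>t\<bar> ^ j * (1 / sqrt (1 + t\<^sup>2)) ^ j"
        unfolding norm_mult norm_power by (simp add: mult_left_mono)
      also have "\<dots> = (\<bar>t\<bar> / sqrt (1 + t\<^sup>2)) ^ j" by (simp flip: power_mult_distrib)
      also have "\<dots> \<le> \<rho> ^ j" using ratio by (intro power_mono) auto
      finally have "cmod (complex_of_real ((- p) gchoose j) * ((\<i> * t) ^ j * (1 + \<i> * t) powr (- of_real (p + real j)))) \<le> \<bar>(- p) gchoose j\<bar> * \<rho> ^ j"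
        unfolding norm_mult[of "complex_of_real _"] norm_of_real by (rule mult_left_mono) auto
      also have "\<dots> = \<bar>((- p) gchoose j) * (\<rho> / \<sigma>) ^ j\<bar> * \<sigma> ^ j"
        using \<rho> \<sigma> by (simp add: abs_mult power_divide)
      also have "\<dots> \<le> B * \<sigma> ^ j" using B(2)[of j] \<sigma> by (intro mult_right_mono) auto
      finally show ?thesis by (simp only: mult.assoc)
    qed
    have "cmod (lag_gen \<alpha> m t $ n) \<le> (\<Sum>k\<le>n. cmod (of_nat (m choose k) * (1 - \<i> * t) ^ k * (- \<i> * t) ^ (m - k) *
     (complex_of_real ((- p) gchoose (n - k)) * (\<i> * t) ^ (n - k) * (1 + \<i> * t) powr (- of_real (p + real (n - k))))))"
      unfolding lag_gen_nth p_def[symmetric] by (rule norm_sum)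
    also have "\<dots> \<le> (\<Sum>k\<le>n. of_nat (m choose k) * (1 + R) ^ k * R ^ (m - k) * (B * \<sigma> ^ (n - k)))"
    proof (rule sum_mono)
      fix k
      have "cmod (1 - \<i> * t) \<le> 1 + R" using norm_triangle_ineq4[of 1 "\<i> * complex_of_real t"] tR by (simp add: norm_mult)
      hence "cmod (of_nat (m choose k) * (1 - \<i> * t) ^ k * (- \<i> * t) ^ (m - k)) \<le> of_nat (m choose k) * (1 + R) ^ k * R ^ (m - k)"
        unfolding norm_mult norm_power using tR R by (intro mult_mono power_mono) auto
      thus "cmod (of_nat (m choose k) * (1 - \<i> * t) ^ k * (- \<i> * t) ^ (m - k) *
        (complex_of_real ((- p) gchoose (n - k)) * (\<i> * t) ^ (n - k) * (1 + \<i> * t) powr (- of_real (p + real (n - k))))) \<le>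
        of_nat (m choose k) * (1 + R) ^ k * R ^ (m - k) * (B * \<sigma> ^ (n - k))"
        unfolding norm_mult[of "of_nat (m choose k) * (1 - \<i> * t) ^ k * (- \<i> * t) ^ (m - k)"]
        using e[of "n - k"] R by (intro mult_mono) auto
    qed
    also have "\<dots> \<le> (\<Sum>k\<le>n. of_nat (m choose k) * (1 + R) ^ k * R ^ (m - k) * (B / \<sigma> ^ k)) * \<sigma> ^ n"
      unfolding sum_distrib_right using \<sigma> by (intro sum_mono) (auto simp: power_diff)
    also have "\<dots> \<le> (\<Sum>k\<le>m. of_nat (m choose k) * (1 + R) ^ k * R ^ (m - k) * (B / \<sigma> ^ k)) * \<sigma> ^ n"
    proof (intro mult_right_mono)
      have "(\<Sum>k\<le>n. of_nat (m choose k) * (1 + R) ^ k * R ^ (m - k) * (B / \<sigma> ^ k)) =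
        (\<Sum>k\<le>min m n. of_nat (m choose k) * (1 + R) ^ k * R ^ (m - k) * (B / \<sigma> ^ k))"
        by (intro sum.mono_neutral_right) (auto simp: binomial_eq_0)
      also have "\<dots> \<le> (\<Sum>k\<le>m. of_nat (m choose k) * (1 + R) ^ k * R ^ (m - k) * (B / \<sigma> ^ k))"
        using R B \<sigma> by (intro sum_mono2) auto
      finally show "(\<Sum>k\<le>n. of_nat (m choose k) * (1 + R) ^ k * R ^ (m - k) * (B / \<sigma> ^ k)) \<le>
        (\<Sum>k\<le>m. of_nat (m choose k) * (1 + R) ^ k * R ^ (m - k) * (B / \<sigma> ^ k))" .
    qed (use \<sigma> in auto)
    finally have le: "cmod (lag_gen \<alpha> m t $ n) \<le> lag_r \<alpha> m * C * \<sigma> ^ n" using r by (simp add: C_def)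
    have "cmod (lag_col \<alpha> m t n) = lag_r \<alpha> n * (cmod (lag_gen \<alpha> m t $ n) / lag_r \<alpha> m)"
      using r lag_r_pos[OF assms, of n] by (simp add: lag_col_def norm_mult norm_divide)
    also have "\<dots> \<le> 1 * (cmod (lag_gen \<alpha> m t $ n) / lag_r \<alpha> m)"
      using lag_r_le_1[OF assms, of n] r by (intro mult_right_mono) auto
    also have "\<dots> \<le> C * \<sigma> ^ n" using le r by (simp add: field_simps)
    finally show ?thesis .
  qed
  thus ?thesis using C0 \<sigma> by (intro exI[of _ C] exI[of _ \<sigma>]) auto
qed

section \<open>The Laguerre kernel in terms of Jacobi functions\<close>

lemma lag_carleman: 
  assumes "\<alpha> \<ge> 0"
  shows "carleman (lag_a \<alpha>)"
proof
  show "lag_a \<alpha> (Suc n) > 0" for n using assms by simp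
  show "\<not> summable (\<lambda>n. 1 / lag_a \<alpha> (Suc n))"
  proof
    assume s: "summable (\<lambda>n. 1 / lag_a \<alpha> (Suc n))"
    have "summable (\<lambda>n. 1 / (1 + \<alpha>) * inverse (real (Suc n)))"
    proof (rule summable_comparison_test'[OF s])
      fix n
      have "lag_a \<alpha> (Suc n) \<le> sqrt (((1 + \<alpha>) * real (Suc n))\<^sup>2)"
      proof (rule real_sqrt_le_mono)
        have "real (Suc n) + \<alpha> \<le> (1 + \<alpha>) * real (Suc n)" "1 \<le> 1 + \<alpha>" using assms by (auto simp: algebra_simps)
        hence "real (Suc n) * (real (Suc n) + \<alpha>) \<le> real (Suc n) * ((1 + \<alpha>) * real (Suc n))"
          by (intro mult_left_mono) auto
        also have "\<dots> \<le> (1 + \<alpha>) * (real (Suc n) * ((1 + \<alpha>) * real (Suc n)))"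
          using mult_right_mono[OF \<open>1 \<le> 1 + \<alpha>\<close>, of "real (Suc n) * ((1 + \<alpha>) * real (Suc n))"] assms by simp
        finally show "real (Suc n) * (real (Suc n) + \<alpha>) \<le> ((1 + \<alpha>) * real (Suc n))\<^sup>2"
          by (simp only: power2_eq_square mult_ac)
      qed
      also have "\<dots> = (1 + \<alpha>) * real (Suc n)" using assms by simp
      finally have "lag_a \<alpha> (Suc n) \<le> (1 + \<alpha>) * real (Suc n)" .
      moreover have "lag_a \<alpha> (Suc n) > 0" using assms by simp
      ultimately have "1 / ((1 + \<alpha>) * real (Suc n)) \<le> 1 / lag_a \<alpha> (Suc n)"
        by (intro divide_left_mono mult_pos_pos) (use assms in auto)
      thus "norm (1 / (1 + \<alpha>) * inverse (real (Suc n))) \<le> 1 / lag_a \<alpha> (Suc n)"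
        using assms by (simp add: divide_inverse)
    qed
    hence "summable (\<lambda>n. inverse (real (Suc n)))"
      using assms by (subst (asm) summable_cmult_iff) auto
    hence "summable (\<lambda>n. inverse (real n))" by (subst (asm) summable_Suc_iff)
    thus False using not_summable_harmonic by blast
  qed
qed

lemma lag_propagator:
  assumes "\<alpha> \<ge> 0"
  shows "jacobi_propagator (lag_a \<alpha>) (lag_b \<alpha>) (lag_col \<alpha>) (2 + \<alpha>)"
proof -
  interpret carleman "lag_a \<alpha>" "lag_b \<alpha>" by (rule lag_carleman[OF assms])
  show ?thesis
  proof
    show "\<bar>lag_a \<alpha> n\<bar> \<le> (2 + \<alpha>) * real (Suc n)" for n
    proof -
      have "lag_a \<alpha> n \<le> sqrt (((2 + \<alpha>) * real (Suc n))\<^sup>2)"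
      proof (rule real_sqrt_le_mono)
        have "real n \<le> (2 + \<alpha>) * real (Suc n)" "real n + \<alpha> \<le> (2 + \<alpha>) * real (Suc n)"
          using assms by (auto simp: algebra_simps)
        thus "real n * (real n + \<alpha>) \<le> ((2 + \<alpha>) * real (Suc n))\<^sup>2"
          unfolding power2_eq_square using assms by (intro mult_mono) auto
      qed
      also have "\<dots> = (2 + \<alpha>) * real (Suc n)" using assms by simp
      finally show ?thesis using assms by simp
    qed
    show "\<bar>lag_b \<alpha> n\<bar> \<le> (2 + \<alpha>) * real (Suc n)" for n using assms by (simp add: algebra_simps)
  qed (use assms lag_col_deriv lag_col_sym lag_col_0 lag_col_decay in blast)+
qed

lemma laguerre_kernel_eq:
  assumes "\<alpha> \<ge> 0"
  shows "laguerre_kernel \<alpha> t n m = cmod (lag_col \<alpha> m t n)"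
proof -
  interpret jacobi_propagator "lag_a \<alpha>" "lag_b \<alpha>" "lag_col \<alpha>" "2 + \<alpha>"
    by (rule lag_propagator[OF assms])
  have "exp_group (laguerre_dom \<alpha>) (laguerre_op \<alpha>) = prop_op"
    unfolding laguerre_dom_def laguerre_op_eq_jac by (rule exp_group_jac)
  thus ?thesis by (simp add: laguerre_kernel_def ell2_inner_delta prop_op_delta)
qed

lemma lag_r_ratio:
  assumes "\<alpha> \<ge> 0"
  shows "sqrt (Gamma (real n + 1) * Gamma (real n + \<alpha> + real d + 1) /
     (Gamma (real n + \<alpha> + 1) * Gamma (real n + real d + 1))) = lag_r \<alpha> n / lag_r \<alpha> (n + d)"
proof -
  have G: "Gamma (\<alpha> + 1) > 0" using assms by (intro Gamma_real_pos) auto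
  have p: "Gamma (real k + \<alpha> + 1) = pochhammer (\<alpha> + 1) k * Gamma (\<alpha> + 1)" for k
  proof -
    have "pochhammer (\<alpha> + 1) k = Gamma (\<alpha> + 1 + of_nat k) / Gamma (\<alpha> + 1)"
      using assms by (intro pochhammer_Gamma) (auto elim!: nonpos_Ints_cases)
    thus ?thesis using G by (simp add: add_ac)
  qed
  have f: "Gamma (real k + 1) = fact k" for k using Gamma_fact[of k, where ?'a = real] by (simp add: add.commute)
  have "Gamma (real n + \<alpha> + real d + 1) = pochhammer (\<alpha> + 1) (n + d) * Gamma (\<alpha> + 1)"
    using p[of "n + d"] by (simp add: add_ac)
  moreover have "Gamma (real n + real d + 1) = fact (n + d)" using f[of "n + d"] by simp
  ultimately show ?thesis unfolding p f lag_r_def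
    using G lag_pochhammer_pos[OF assms] by (simp add: field_simps flip: real_sqrt_divide)
qed

lemma x_of_half:
  "(1 - x_of t) / 2 = 1 / (1 + t\<^sup>2)" "(1 + x_of t) / 2 = t\<^sup>2 / (1 + t\<^sup>2)"
proof -
  define T where "T = 1 + t\<^sup>2"
  have T: "T > 0" by (simp add: T_def add_pos_nonneg)
  have xt: "x_of t = (T - 2) / T" "t\<^sup>2 = T - 1" by (simp_all add: x_of_def T_def add.commute)
  show "(1 - x_of t) / 2 = 1 / (1 + t\<^sup>2)" "(1 + x_of t) / 2 = t\<^sup>2 / (1 + t\<^sup>2)"
    unfolding T_def[symmetric] unfolding xt using T by (simp_all add: field_simps)
qed

text \<open>In the explicit sum every lost power of \<open>1 - \<i>t\<close> can be traded against
  one of \<open>1 + \<i>t\<close>, since their product is \<open>1 + t\<^sup>2\<close>, and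
  \<open>(- \<i>t)\<^sup>2\<close> is real. So apart from a common factor of known modulus, a real
  hypergeometric sum in \<open>t\<^sup>2 / (1 + t\<^sup>2)\<close> remains.\<close>

theorem laguerre_kernel_jacobi:
  assumes \<alpha>: "\<alpha> \<ge> 0" and t: "t \<noteq> 0"
  shows "laguerre_kernel \<alpha> t n (n + d) = \<bar>jacobi_fun n \<alpha> (real d) (x_of t)\<bar> / sqrt (1 + t\<^sup>2)"
proof -
  define T where "T = 1 + t\<^sup>2"
  define m where "m = n + d"
  define \<tau> where "\<tau> = 1 + \<i> * complex_of_real t"
  define y where "y = - \<i> * complex_of_real t"
  have T: "T > 0" by (simp add: T_def add_pos_nonneg)
  have \<tau>0: "\<tau> \<noteq> 0" unfolding \<tau>_def by (rule tau_nonzero)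
  have \<tau>y: "(1 + y) * \<tau> = of_real T" by (simp add: y_def \<tau>_def T_def algebra_simps power2_eq_square)
  have y2: "y\<^sup>2 = - of_real (t\<^sup>2)" by (simp add: y_def power_mult_distrib)
  have n_tau: "cmod \<tau> = sqrt T" "cmod (1 + y) = sqrt T" "cmod y = \<bar>t\<bar>"
    by (simp_all add: \<tau>_def y_def T_def cmod_def norm_mult)
  \<comment> \<open>\<open>t\<^sup>2 / (1 + t\<^sup>2)\<close> is \<open>(1 + x) / 2\<close>, so the
    expansion at the endpoint -1 is the one to compare with. Reflection provides it at the cost of a
    sign, which the modulus forgets.\<close>
  have P: "jacobi_poly n \<alpha> (real d) (x_of t) = (-1) ^ n * (\<Sum>k\<le>n. ((real n + real d) gchoose (n - k)) *
      ((real n + real d + \<alpha> + real k) gchoose k) * (- (t\<^sup>2 / T)) ^ k)"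
  proof -
    have "jacobi_poly n \<alpha> (real d) (x_of t) = (-1) ^ n * jacobi_poly n (real d) \<alpha> (- x_of t)"
      using jacobi_poly_minus[of n \<alpha> "real d" "- x_of t"] by simp
    moreover have "(- x_of t - 1) / 2 = - (t\<^sup>2 / T)" using x_of_half(2)[of t] by (simp add: T_def field_simps)
    ultimately show ?thesis unfolding jacobi_poly_hypergeometric by simp
  qed
  define S where "S = (\<Sum>k\<le>n. ((real n + real d) gchoose (n - k)) * ((real n + real d + \<alpha> + real k) gchoose k) * (- (t\<^sup>2 / T)) ^ k)"
  define q where "q = pochhammer (\<alpha> + 1) m / fact m"
  have q: "q > 0" "lag_r \<alpha> m = sqrt (1 / q)" using lag_pochhammer_pos[OF \<alpha>, of m] by (simp_all add: q_def lag_r_def)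
  \<comment> \<open>The order of summation is reversed, so that \<open>k\<close> counts the powers
    of \<open>t\<^sup>2\<close>.\<close>
  have "(\<Sum>k\<le>min m n. complex_of_real (pochhammer (\<alpha> + 1) (m + n - k) / (fact k * fact (m - k) * fact (n - k))) *
      (1 - \<i> * t) ^ k * (- \<i> * t) ^ (m + n - 2 * k) * (1 + \<i> * t) powr (- of_real (real (m + n - k) + \<alpha> + 1))) =
      (\<Sum>k\<le>n. complex_of_real (pochhammer (\<alpha> + 1) (m + k) / (fact (n - k) * fact (d + k) * fact k)) *
      (1 + y) ^ (n - k) * y ^ (d + 2 * k) * \<tau> powr (- of_real (real (m + k) + \<alpha> + 1)))"
  proof (rule sum.reindex_bij_witness[of _ "\<lambda>k. n - k" "\<lambda>k. n - k"])
    fix a assume "a \<in> {..min m n}"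
    hence a: "m + (n - a) = m + n - a" "n - (n - a) = a" "d + (n - a) = m - a" "d + 2 * (n - a) = m + n - 2 * a"
      by (auto simp: m_def)
    have y: "1 - \<i> * complex_of_real t = 1 + y" by (simp add: y_def)
    show "complex_of_real (pochhammer (\<alpha> + 1) (m + (n - a)) / (fact (n - (n - a)) * fact (d + (n - a)) * fact (n - a))) *
      (1 + y) ^ (n - (n - a)) * y ^ (d + 2 * (n - a)) * \<tau> powr (- of_real (real (m + (n - a)) + \<alpha> + 1)) =
      complex_of_real (pochhammer (\<alpha> + 1) (m + n - a) / (fact a * fact (m - a) * fact (n - a))) *
      (1 - \<i> * t) ^ a * (- \<i> * t) ^ (m + n - 2 * a) * (1 + \<i> * t) powr (- of_real (real (m + n - a) + \<alpha> + 1))"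
      unfolding a y y_def[symmetric] \<tau>_def[symmetric] ..
  qed (auto simp: m_def)
  also have "\<dots> = (\<Sum>k\<le>n. (y ^ d * (1 + y) ^ n * \<tau> powr (- of_real (real m + \<alpha> + 1)) * of_real q) *
      of_real (((real n + real d) gchoose (n - k)) * ((real n + real d + \<alpha> + real k) gchoose k) * (- (t\<^sup>2 / T)) ^ k))"
  proof (intro sum.cong refl)
    fix k assume "k \<in> {..n}"
    hence k: "k \<le> n" by simp
    have "(real n + real d) gchoose (n - k) = fact m / (fact (n - k) * fact (d + k))"
    proof -
      have "(real (n + d) gchoose (n - k)) = fact (n + d) / (fact (n - k) * fact (n + d - (n - k)))"
        unfolding binomial_gbinomial[symmetric] by (intro binomial_fact) auto
      moreover have "n + d - (n - k) = d + k" using k by simp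
      ultimately show ?thesis by (simp add: m_def)
    qed
    moreover have "(real n + real d + \<alpha> + real k) gchoose k = pochhammer (real m + \<alpha> + 1) k / fact k"
      by (simp add: gbinomial_pochhammer' m_def algebra_simps)
    moreover have "pochhammer (\<alpha> + 1) (m + k) = pochhammer (\<alpha> + 1) m * pochhammer (real m + \<alpha> + 1) k"
      using pochhammer_product'[of "\<alpha> + 1" m k] by (simp only: add_ac)
    ultimately have c: "pochhammer (\<alpha> + 1) (m + k) / (fact (n - k) * fact (d + k) * fact k) =
        q * (((real n + real d) gchoose (n - k)) * ((real n + real d + \<alpha> + real k) gchoose k))"
      by (simp add: q_def)
    have p1: "\<tau> powr (- of_real (real (m + k) + \<alpha> + 1)) * \<tau> ^ k = \<tau> powr (- of_real (real m + \<alpha> + 1))"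
    proof -
      have "- of_real (real m + \<alpha> + 1) = - of_real (real (m + k) + \<alpha> + 1) + (of_nat k :: complex)" by simp
      thus ?thesis using \<tau>0 by (simp only: powr_add powr_nat if_False)
    qed
    have p2: "(1 + y) ^ (n - k) * (1 + y) ^ k = (1 + y) ^ n" using k by (simp flip: power_add)
    have p3: "(1 + y) ^ k * \<tau> ^ k = of_real T ^ k" by (simp add: \<tau>y flip: power_mult_distrib)
    have p4: "y ^ (d + 2 * k) = y ^ d * of_real ((- (t\<^sup>2)) ^ k)" by (simp add: power_add power_mult y2)
    have p5: "(- (t\<^sup>2 / T)) ^ k = (- (t\<^sup>2)) ^ k / T ^ k" by (simp flip: power_divide)
    have nz: "complex_of_real T ^ k \<noteq> 0" using T by simp
    have "(1 + y) ^ (n - k) * \<tau> powr (- of_real (real (m + k) + \<alpha> + 1)) * of_real T ^ k =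
        ((1 + y) ^ (n - k) * (1 + y) ^ k) * (\<tau> powr (- of_real (real (m + k) + \<alpha> + 1)) * \<tau> ^ k)"
      unfolding p3[symmetric] by (simp only: mult_ac)
    hence "(1 + y) ^ (n - k) * \<tau> powr (- of_real (real (m + k) + \<alpha> + 1)) =
        (1 + y) ^ n * \<tau> powr (- of_real (real m + \<alpha> + 1)) / of_real T ^ k"
      unfolding p1 p2 using nz by (simp only: eq_divide_eq) simp
    hence "of_real (q * (((real n + real d) gchoose (n - k)) * ((real n + real d + \<alpha> + real k) gchoose k))) *
        (y ^ d * of_real ((- (t\<^sup>2)) ^ k)) * ((1 + y) ^ (n - k) * \<tau> powr (- of_real (real (m + k) + \<alpha> + 1))) =
        of_real (q * (((real n + real d) gchoose (n - k)) * ((real n + real d + \<alpha> + real k) gchoose k))) *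
        (y ^ d * of_real ((- (t\<^sup>2)) ^ k)) * ((1 + y) ^ n * \<tau> powr (- of_real (real m + \<alpha> + 1)) / of_real T ^ k)"
      by simp
    thus "complex_of_real (pochhammer (\<alpha> + 1) (m + k) / (fact (n - k) * fact (d + k) * fact k)) *
      (1 + y) ^ (n - k) * y ^ (d + 2 * k) * \<tau> powr (- of_real (real (m + k) + \<alpha> + 1)) =
      (y ^ d * (1 + y) ^ n * \<tau> powr (- of_real (real m + \<alpha> + 1)) * of_real q) *
      of_real (((real n + real d) gchoose (n - k)) * ((real n + real d + \<alpha> + real k) gchoose k) * (- (t\<^sup>2 / T)) ^ k)"
      unfolding c p4 p5 of_real_mult of_real_divide of_real_power times_divide_eq_right
      by (simp only: mult_ac)
  qed
  also have "\<dots> = (y ^ d * (1 + y) ^ n * \<tau> powr (- of_real (real m + \<alpha> + 1)) * of_real q) * of_real S"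
    by (simp add: S_def sum_distrib_left)
  finally have col: "lag_col \<alpha> m t n = complex_of_real (lag_r \<alpha> n * lag_r \<alpha> m) *
      ((y ^ d * (1 + y) ^ n * \<tau> powr (- of_real (real m + \<alpha> + 1)) * of_real q) * of_real S)"
    unfolding lag_col_explicit[OF \<alpha>] by (rule arg_cong)
  have "cmod (lag_col \<alpha> m t n) = lag_r \<alpha> n * lag_r \<alpha> m * (\<bar>t\<bar> ^ d * sqrt T ^ n * sqrt T powr (- (real m + \<alpha> + 1)) * q * \<bar>S\<bar>)"
  proof -
    have nt: "cmod (\<tau> powr (- of_real (real m + \<alpha> + 1))) = sqrt T powr (- (real m + \<alpha> + 1))"
      unfolding n_tau(1)[symmetric] by (subst norm_powr_real_powr') auto
    have pos: "\<bar>lag_r \<alpha> n * lag_r \<alpha> m\<bar> = lag_r \<alpha> n * lag_r \<alpha> m" "\<bar>q\<bar> = q"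
      using lag_r_pos[OF \<alpha>, of n] lag_r_pos[OF \<alpha>, of m] q(1) by auto
    show ?thesis by (simp only: col norm_mult norm_power norm_of_real n_tau nt pos)
  qed
  also have "lag_r \<alpha> n * lag_r \<alpha> m * (\<bar>t\<bar> ^ d * sqrt T ^ n * sqrt T powr (- (real m + \<alpha> + 1)) * q * \<bar>S\<bar>) =
      (lag_r \<alpha> n / lag_r \<alpha> m) * (\<bar>t\<bar> ^ d * (sqrt T ^ n * sqrt T powr (- (real m + \<alpha> + 1)))) * \<bar>S\<bar>"
  proof -
    have "lag_r \<alpha> m * lag_r \<alpha> m = 1 / q" unfolding q(2) using q(1) by simp
    moreover have "lag_r \<alpha> m * q * lag_r \<alpha> m = (lag_r \<alpha> m * lag_r \<alpha> m) * q" by (simp only: mult_ac)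
    ultimately have "lag_r \<alpha> m * q = 1 / lag_r \<alpha> m"
      using q(1) lag_r_pos[OF \<alpha>, of m] by (simp add: eq_divide_eq)
    hence r: "lag_r \<alpha> n * (lag_r \<alpha> m * q) = lag_r \<alpha> n / lag_r \<alpha> m" by simp
    show ?thesis unfolding r[symmetric] by (simp only: mult_ac)
  qed
  \<comment> \<open>As \<open>m = n + d\<close>, the exponents of \<open>T\<close> add up to
    \<open>- (\<alpha> + d + 1) / 2\<close>: two parts belong to the Jacobi weight and the last half
    is the factor \<open>1 / sqrt (1 + t\<^sup>2)\<close> of the kernel.\<close>
  also have "sqrt T ^ n * sqrt T powr (- (real m + \<alpha> + 1)) = T powr (- (\<alpha> / 2)) * T powr (- (real d / 2)) / sqrt T"
  proof -
    have s: "sqrt T = T powr (1 / 2)" using T by (simp add: powr_half_sqrt)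
    have "sqrt T ^ n * sqrt T powr (- (real m + \<alpha> + 1)) = T powr (real n / 2) * T powr (- (real m + \<alpha> + 1) / 2)"
      unfolding s using T by (simp add: powr_powr flip: powr_realpow)
    also have "\<dots> = T powr (- (\<alpha> / 2) + - (real d / 2) + - (1 / 2))"
      unfolding powr_add[symmetric] by (rule arg_cong[where f = "(powr) T"]) (simp add: m_def field_simps)
    also have "\<dots> = T powr (- (\<alpha> / 2)) * T powr (- (real d / 2)) / sqrt T"
    proof -
      have "T powr (- (1 / 2)) = inverse (sqrt T)" unfolding powr_minus s ..
      thus ?thesis unfolding powr_add by (simp only: divide_inverse)
    qed
    finally show ?thesis .
  qed
  also have "\<bar>t\<bar> ^ d * (T powr (- (\<alpha> / 2)) * T powr (- (real d / 2)) / sqrt T) =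
      rpow ((1 - x_of t) / 2) (\<alpha> / 2) * rpow ((1 + x_of t) / 2) (real d / 2) / sqrt T"
  proof -
    have "\<bar>t\<bar> ^ d = (t\<^sup>2) powr (real d / 2)"
    proof -
      have "t\<^sup>2 = \<bar>t\<bar> powr 2" using t by simp
      thus ?thesis using t by (simp only: powr_powr) (simp add: powr_realpow)
    qed
    moreover have "rpow (1 / T) (\<alpha> / 2) = T powr (- (\<alpha> / 2))" using T by (simp add: rpow_eq_powr powr_divide powr_minus_divide)
    moreover have "rpow (t\<^sup>2 / T) (real d / 2) = (t\<^sup>2) powr (real d / 2) * T powr (- (real d / 2))"
      using T t by (simp add: rpow_eq_powr powr_divide powr_minus_divide)
    ultimately show ?thesis unfolding x_of_half T_def[symmetric] by simp
  qed
  finally have *: "cmod (lag_col \<alpha> m t n) = (lag_r \<alpha> n / lag_r \<alpha> m) * (rpow ((1 - x_of t) / 2) (\<alpha> / 2) * rpow ((1 + x_of t) / 2) (real d / 2) / sqrt T) * \<bar>S\<bar>" .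
  have "jacobi_fun n \<alpha> (real d) (x_of t) = (lag_r \<alpha> n / lag_r \<alpha> m) * rpow ((1 - x_of t) / 2) (\<alpha> / 2) * rpow ((1 + x_of t) / 2) (real d / 2) * ((-1) ^ n * S)"
    unfolding jacobi_fun_def lag_r_ratio[OF \<alpha>] P S_def m_def ..
  moreover have "rpow x a \<ge> 0" if "x \<ge> 0" for x a using that by (auto simp: rpow_def)
  hence "rpow ((1 - x_of t) / 2) (\<alpha> / 2) \<ge> 0" "rpow ((1 + x_of t) / 2) (real d / 2) \<ge> 0"
    unfolding x_of_half by (auto simp: add_pos_nonneg)
  ultimately have "\<bar>jacobi_fun n \<alpha> (real d) (x_of t)\<bar> = (lag_r \<alpha> n / lag_r \<alpha> m) * rpow ((1 - x_of t) / 2) (\<alpha> / 2) * rpow ((1 + x_of t) / 2) (real d / 2) * \<bar>S\<bar>"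
    using lag_r_pos[OF \<alpha>, of n] lag_r_pos[OF \<alpha>, of m] by (simp add: abs_mult power_abs)
  thus ?thesis unfolding laguerre_kernel_eq[OF \<alpha>] m_def[symmetric] * T_def[symmetric] by simp
qed

section \<open>Jacobi's generating function\<close>

text \<open>With \<open>F = X \<phi>(F)\<close>, both sides, as linear functions of \<open>H\<close>, satisfy \<open>D(wH) = X D(\<phi>H)\<close>, and their
  difference also satisfies \<open>D(1) = X D(\<phi>')\<close>; hence the difference is divisible by every power of \<open>X\<close>.\<close>

lemma lagrange_buermann:
  fixes F H \<phi> :: "'a :: field_char_0 fps"
  assumes F: "F = fps_X * (\<phi> oo F)"
  shows "Abs_fps (\<lambda>n. (H * \<phi> ^ n) $ n) * (1 - fps_X * (fps_deriv \<phi> oo F)) = H oo F"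
proof -
  define E where "E = 1 - fps_X * (fps_deriv \<phi> oo F)"
  define L where "L = (\<lambda>H. Abs_fps (\<lambda>n. (H * \<phi> ^ n) $ n))"
  define D where "D = (\<lambda>H. L H * E - (H oo F))"
  have F0: "F $ 0 = 0" by (subst F) simp
  have L_add: "L (G + H) = L G + L H" for G H
    by (rule fps_ext) (simp add: L_def distrib_right)
  have L_const: "L (fps_const c * H) = fps_const c * L H" for c H
    by (rule fps_ext) (simp add: L_def mult.assoc)
  have L_X: "L (fps_X * H) = fps_X * L (\<phi> * H)" for H
  proof (rule fps_ext)
    fix n show "L (fps_X * H) $ n = (fps_X * L (\<phi> * H)) $ n"
      by (cases n) (simp_all add: L_def mult_ac)
  qed
  \<comment> \<open>Coefficient \<open>Suc m\<close> of a power of \<open>\<phi>\<close> is read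
    from its derivative; cancelling the factor \<open>Suc m\<close> is where characteristic 0
    enters.\<close>
  have L_1: "L 1 = 1 + fps_X * L (fps_deriv \<phi>)"
  proof (rule fps_ext)
    fix n show "L 1 $ n = (1 + fps_X * L (fps_deriv \<phi>)) $ n"
    proof (cases n)
      case (Suc m)
      have "fps_deriv (\<phi> ^ Suc m) $ m = of_nat (Suc m) * (\<phi> ^ Suc m) $ Suc m"
        using fps_deriv_nth[of "\<phi> ^ Suc m" m] by (simp only: Suc_eq_plus1)
      moreover have "fps_deriv (\<phi> ^ Suc m) $ m = of_nat (Suc m) * (fps_deriv \<phi> * \<phi> ^ m) $ m"
        by (simp only: fps_deriv_power diff_Suc_1 fps_mult_left_const_nth mult.assoc)
      ultimately have "of_nat (Suc m) * (\<phi> ^ Suc m) $ Suc m = of_nat (Suc m) * (fps_deriv \<phi> * \<phi> ^ m) $ m" by simp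
      hence "(\<phi> ^ Suc m) $ Suc m = (fps_deriv \<phi> * \<phi> ^ m) $ m"
        by (simp only: mult_cancel_left of_nat_eq_0_iff) simp
      thus ?thesis by (simp add: L_def Suc del: power_Suc)
    qed (simp add: L_def)
  qed
  have D_split: "D H = fps_X * (fps_const (H $ 0) * D (fps_deriv \<phi>) + D (\<phi> * fps_shift 1 H))" for H
  proof -
    define K where "K = fps_shift 1 H"
    have H: "H = fps_const (H $ 0) * 1 + fps_X * K"
    proof (rule fps_ext)
      fix n show "H $ n = (fps_const (H $ 0) * 1 + fps_X * K) $ n" by (cases n) (simp_all add: K_def)
    qed
    have "L H = fps_const (H $ 0) * (1 + fps_X * L (fps_deriv \<phi>)) + fps_X * L (\<phi> * K)"
      by (subst H) (simp only: L_add L_const L_X L_1)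
    moreover have "H oo F = fps_const (H $ 0) + F * (K oo F)"
      by (subst H) (simp add: fps_compose_add_distrib fps_compose_mult_distrib[OF F0] F0)
    hence "H oo F = fps_const (H $ 0) + fps_X * (\<phi> oo F) * (K oo F)" using F by simp
    moreover have "(\<phi> * K) oo F = (\<phi> oo F) * (K oo F)" by (rule fps_compose_mult_distrib[OF F0])
    ultimately show ?thesis unfolding D_def E_def K_def[symmetric] by (simp add: algebra_simps)
  qed
  have "D H $ n = 0" for n H
  proof (induction n arbitrary: H)
    case 0
    show ?case by (subst D_split) simp
  next
    case (Suc n)
    show ?case by (subst D_split) (simp add: Suc)
  qed
  hence "D H = 0" by (simp add: fps_eq_iff)
  thus ?thesis by (simp add: D_def L_def E_def)
qed

text \<open>The formal binomial series of \<open>(1 + c * z) powr a\<close>.\<close>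

definition fps_bin :: "real \<Rightarrow> real \<Rightarrow> complex fps" where
  "fps_bin a c = Abs_fps (\<lambda>n. complex_of_real ((a gchoose n) * c ^ n))"

lemma fps_bin_add: "fps_bin (a + b) c = fps_bin a c * fps_bin b c"
proof (rule fps_ext)
  fix n
  have "(\<Sum>i=0..n. ((a gchoose i) * c ^ i) * ((b gchoose (n - i)) * c ^ (n - i))) =
      (\<Sum>i=0..n. (a gchoose i) * (b gchoose (n - i)) * c ^ n)"
    by (intro sum.cong refl) (simp add: power_add[symmetric] mult_ac)
  also have "\<dots> = ((a + b) gchoose n) * c ^ n"
    unfolding sum_distrib_right[symmetric] gbinomial_Vandermonde ..
  finally show "fps_bin (a + b) c $ n = (fps_bin a c * fps_bin b c) $ n"
    unfolding fps_mult_nth fps_bin_def fps_nth_Abs_fps of_real_mult[symmetric] of_real_sum[symmetric] by simp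
qed

lemma fps_bin_of_nat: "fps_bin (real n) c = (1 + fps_const (of_real c) * fps_X) ^ n"
proof (induction n)
  case 0
  show ?case by (rule fps_ext) (auto simp: fps_bin_def gbinomial_0_left)
next
  case (Suc n)
  have "fps_bin 1 c = 1 + fps_const (of_real c) * fps_X"
  proof (rule fps_ext)
    fix k show "fps_bin 1 c $ k = (1 + fps_const (of_real c) * fps_X) $ k"
      using binomial_gbinomial[of 1 k, where ?'a = real]
      by (cases "k = 0"; cases "k = 1") (auto simp: fps_bin_def fps_X_nth binomial_eq_0)
  qed
  thus ?case using fps_bin_add[of 1 "real n" c] Suc by simp
qed

lemma gbinomial_of_real: "of_real a gchoose n = (of_real (a gchoose n) :: complex)"
  by (simp add: gbinomial_prod_rev)

lemma has_fps_expansion_powr: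
  "(\<lambda>w. (1 + of_real c * w) powr of_real a) has_fps_expansion fps_bin a c"
proof -
  have 1: "(\<lambda>w. (1 + w) powr of_real a) has_fps_expansion fps_binomial (complex_of_real a)"
    by (rule has_fps_expansion_binomial_complex)
  have 2: "(\<lambda>w. complex_of_real c * w) has_fps_expansion fps_const (of_real c) * fps_X"
    by (intro fps_expansion_intros)
  have "((\<lambda>w. (1 + w) powr of_real a) \<circ> (\<lambda>w. complex_of_real c * w)) has_fps_expansion
      (fps_binomial (complex_of_real a) oo (fps_const (of_real c) * fps_X))"
    by (rule has_fps_expansion_compose[OF 1 2]) simp
  also have "fps_binomial (complex_of_real a) oo (fps_const (of_real c) * fps_X) = fps_bin a c"
    unfolding fps_compose_linear by (rule fps_ext) (simp add: fps_bin_def gbinomial_of_real mult.commute)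
  finally show ?thesis by (simp add: o_def)
qed

text \<open>The defining sum is a Cauchy product, the coefficient form of Rodrigues' formula.
  Splitting off the \<open>n\<close>-th powers exhibits the shape \<open>H * \<phi> ^ n\<close>
  demanded by Lagrange inversion.\<close>

lemma jacobi_poly_fps:
  fixes \<alpha> \<beta> x :: real
  defines "A \<equiv> (x - 1) / 2" and "B \<equiv> (x + 1) / 2"
  shows "of_real (jacobi_poly n \<alpha> \<beta> x) = (fps_bin \<alpha> B * fps_bin \<beta> A *
    ((1 + fps_const (of_real B) * fps_X) * (1 + fps_const (of_real A) * fps_X)) ^ n) $ n"
proof -
  have "fps_bin \<alpha> B * fps_bin \<beta> A * ((1 + fps_const (of_real B) * fps_X) * (1 + fps_const (of_real A) * fps_X)) ^ n =
      fps_bin (real n + \<beta>) A * fps_bin (real n + \<alpha>) B"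
    unfolding fps_bin_add fps_bin_of_nat power_mult_distrib by (simp only: mult_ac)
  moreover have "(fps_bin (real n + \<beta>) A * fps_bin (real n + \<alpha>) B) $ n = of_real (jacobi_poly n \<alpha> \<beta> x)"
    unfolding fps_mult_nth fps_bin_def fps_nth_Abs_fps of_real_mult[symmetric] of_real_sum[symmetric]
      jacobi_poly_def A_def[symmetric] B_def[symmetric] atMost_atLeast0
    by (intro arg_cong[where f = of_real] sum.cong refl) (simp only: mult_ac)
  ultimately show ?thesis by simp
qed

text \<open>The root of \<open>1 - 2 * cos \<theta> * z + z\<^sup>2\<close>, taken factor by factor:
  each factor stays in the right half plane on the unit disk, where the principal root is
  holomorphic, and the factor vanishing at \<open>cis (- \<theta>)\<close> stands isolated.\<close>

definition jacobi_R :: "real \<Rightarrow> complex \<Rightarrow> complex" where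
  "jacobi_R \<theta> z = csqrt (1 - z * cis \<theta>) * csqrt (1 - z * cis (- \<theta>))"

definition jacobi_gen :: "real \<Rightarrow> real \<Rightarrow> real \<Rightarrow> complex \<Rightarrow> complex" where
  "jacobi_gen \<alpha> \<beta> \<theta> z = (2 / (1 - z + jacobi_R \<theta> z)) powr of_real \<alpha> *
     (2 / (1 + z + jacobi_R \<theta> z)) powr of_real \<beta> / jacobi_R \<theta> z"

lemma Re_one_minus_pos:
  assumes "cmod z < 1" "cmod w \<le> 1"
  shows "Re (1 - z * w) > 0"
proof -
  have "cmod (z * w) \<le> cmod z * 1" unfolding norm_mult using assms(2) by (intro mult_left_mono) auto
  hence "cmod (z * w) < 1" using assms(1) by simp
  moreover have "Re (z * w) \<le> cmod (z * w)" by (rule complex_Re_le_cmod)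
  ultimately show ?thesis by simp
qed

text \<open>Each root has an argument of modulus below a quarter of \<open>pi\<close>, so the
  product remains in the right half plane.\<close>

lemma Re_csqrt_mult_pos:
  assumes "Re a > 0" "Re b > 0"
  shows "Re (csqrt a * csqrt b) > 0"
proof -
  have *: "\<bar>Im (csqrt u)\<bar> < Re (csqrt u)" if "Re u > 0" for u
  proof -
    have "Re ((csqrt u)\<^sup>2) > 0" using that by simp
    hence "(Im (csqrt u))\<^sup>2 < (Re (csqrt u))\<^sup>2" by (simp add: power2_eq_square)
    moreover have "(Re (csqrt u))\<^sup>2 \<le> \<bar>Im (csqrt u)\<bar>\<^sup>2" if "Re (csqrt u) \<le> \<bar>Im (csqrt u)\<bar>"
      using that by (rule power_mono) (rule Re_csqrt)
    ultimately show ?thesis by fastforce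
  qed
  have "Im (csqrt a) * Im (csqrt b) \<le> \<bar>Im (csqrt a)\<bar> * \<bar>Im (csqrt b)\<bar>"
    by (metis abs_ge_self abs_mult)
  also have "\<dots> < Re (csqrt a) * Re (csqrt b)"
    using *[OF assms(1)] *[OF assms(2)] by (intro mult_strict_mono') auto
  finally show ?thesis by simp
qed

lemma jacobi_R_facts:
  assumes z: "cmod z < 1"
  shows "Re (jacobi_R \<theta> z) > 0" "(jacobi_R \<theta> z)\<^sup>2 = 1 - 2 * of_real (cos \<theta>) * z + z\<^sup>2"
    "Re (1 - z + jacobi_R \<theta> z) > 0" "Re (1 + z + jacobi_R \<theta> z) > 0"
    "Re (1 - of_real (cos \<theta>) * z + jacobi_R \<theta> z) > 0"
proof -
  show R: "Re (jacobi_R \<theta> z) > 0"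
    unfolding jacobi_R_def by (intro Re_csqrt_mult_pos Re_one_minus_pos z) auto
  have "(jacobi_R \<theta> z)\<^sup>2 = (1 - z * cis \<theta>) * (1 - z * cis (- \<theta>))"
    by (simp add: jacobi_R_def power_mult_distrib)
  also have "\<dots> = 1 - (cis \<theta> + cis (- \<theta>)) * z + (cis \<theta> * cis (- \<theta>)) * z\<^sup>2"
    by (simp add: algebra_simps power2_eq_square)
  also have "cis \<theta> + cis (- \<theta>) = 2 * of_real (cos \<theta>)" by (simp add: complex_eq_iff)
  also have "cis \<theta> * cis (- \<theta>) = 1" by (simp add: cis_mult)
  finally show "(jacobi_R \<theta> z)\<^sup>2 = 1 - 2 * of_real (cos \<theta>) * z + z\<^sup>2" by simp
  show "Re (1 - z + jacobi_R \<theta> z) > 0" using Re_one_minus_pos[OF z, of 1] R by simp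
  show "Re (1 + z + jacobi_R \<theta> z) > 0" using Re_one_minus_pos[OF z, of "-1"] R by simp
  show "Re (1 - of_real (cos \<theta>) * z + jacobi_R \<theta> z) > 0"
    using Re_one_minus_pos[OF z, of "of_real (cos \<theta>)"] R by (simp add: mult.commute)
qed

lemma Re_inverse_pos: "Re z > 0 \<Longrightarrow> Re (2 / z) > 0"
  by (simp add: Re_divide power2_eq_square zero_less_divide_iff add_pos_nonneg)

lemma not_nonpos_Reals_if_Re_pos: "Re z > 0 \<Longrightarrow> z \<notin> \<real>\<^sub>\<le>\<^sub>0"
  by (auto simp: complex_nonpos_Reals_iff)

lemma jacobi_R_holomorphic: "jacobi_R \<theta> holomorphic_on ball 0 1"
proof -
  have "1 - z * cis \<phi> \<notin> \<real>\<^sub>\<le>\<^sub>0" if "z \<in> ball 0 1" for z \<phi>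
    using that by (intro not_nonpos_Reals_if_Re_pos Re_one_minus_pos) auto
  thus ?thesis unfolding jacobi_R_def by (intro holomorphic_intros) auto
qed

lemma jacobi_gen_holomorphic: "jacobi_gen \<alpha> \<beta> \<theta> holomorphic_on ball 0 1"
proof -
  have "2 / (1 - z + jacobi_R \<theta> z) \<notin> \<real>\<^sub>\<le>\<^sub>0" "2 / (1 + z + jacobi_R \<theta> z) \<notin> \<real>\<^sub>\<le>\<^sub>0" 
    "1 - z + jacobi_R \<theta> z \<noteq> 0" "1 + z + jacobi_R \<theta> z \<noteq> 0" "jacobi_R \<theta> z \<noteq> 0" if "z \<in> ball 0 1" for z
    using that jacobi_R_facts[of z \<theta>]
    by (auto intro!: not_nonpos_Reals_if_Re_pos Re_inverse_pos simp del: minus_complex.sel plus_complex.sel)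
  thus ?thesis unfolding jacobi_gen_def
    by (intro holomorphic_intros jacobi_R_holomorphic) auto
qed

text \<open>The inverse function \<open>Y\<close> solves the quadratic equation
  \<open>Y = z * \<phi>(Y)\<close> with \<open>\<phi>(w) = (1 + B * w) * (1 + A * w)\<close>; its
  discriminant root is \<open>R\<close>, which also equals the denominator
  \<open>1 - z * \<phi>'(Y)\<close> in Lagrange's formula.\<close>

lemma jacobi_generating_function:
  assumes z: "cmod z < 1"
  shows "(\<lambda>n. of_real (jacobi_poly n \<alpha> \<beta> (cos \<theta>)) * z ^ n) sums jacobi_gen \<alpha> \<beta> \<theta> z"
proof -
  define x where "x = cos \<theta>"
  define A where "A = (x - 1) / 2"
  define B where "B = (x + 1) / 2"
  define R where "R = jacobi_R \<theta>"
  \<comment> \<open>The quadratic formula in rationalized form: regular at \<open>z = 0\<close>,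
    where it selects the branch vanishing there, and without division by
    \<open>A * B\<close>.\<close>
  define Y where "Y = (\<lambda>z. 2 * z / (1 - of_real x * z + R z))"
  define \<phi> where "\<phi> = (1 + fps_const (complex_of_real B) * fps_X) * (1 + fps_const (complex_of_real A) * fps_X)"
  define H where "H = fps_bin \<alpha> B * fps_bin \<beta> A"
  have Rf: "Re (R z) > 0" "(R z)\<^sup>2 = 1 - 2 * of_real x * z + z\<^sup>2" "1 - z + R z \<noteq> 0" "1 + z + R z \<noteq> 0"
    "1 - of_real x * z + R z \<noteq> 0" if "z \<in> ball 0 1" for z
    using jacobi_R_facts[of z \<theta>] that unfolding R_def x_def by (auto simp del: minus_complex.sel plus_complex.sel)
  have AB: "complex_of_real B * of_real A = ((of_real x)\<^sup>2 - 1) / 4" "complex_of_real A + of_real B = of_real x"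
    by (simp_all add: A_def B_def field_simps power2_eq_square)
  have Y_hol: "Y holomorphic_on ball 0 1"
    unfolding Y_def R_def by (intro holomorphic_intros jacobi_R_holomorphic) (use Rf in \<open>auto simp: R_def\<close>)
  have Y_eq: "Y z = z * ((1 + of_real B * Y z) * (1 + of_real A * Y z))"
    and R_eq: "R z = 1 - z * (of_real x + 2 * (of_real A * of_real B) * Y z)"
    and B_eq: "1 + of_real B * Y z = 2 / (1 - z + R z)"
    and A_eq: "1 + of_real A * Y z = 2 / (1 + z + R z)" if z: "z \<in> ball 0 1" for z
  proof -
    define D where "D = 1 - of_real x * z + R z"
    have D: "D \<noteq> 0" using Rf[OF z] by (simp add: D_def)
    have YD: "Y z * D = 2 * z" using D by (simp add: Y_def D_def)
    have R2: "(R z)\<^sup>2 = 1 - 2 * of_real x * z + z\<^sup>2" by (rule Rf(2)[OF z])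
    have DD: "(1 - z + R z) * (1 + z + R z) = 2 * D"
      using R2 unfolding D_def by (simp add: power2_eq_square algebra_simps)
    have "(1 + of_real B * Y z) * D = D + of_real B * (Y z * D)" by (simp add: algebra_simps)
    also have "\<dots> = 1 + z + R z" unfolding YD by (simp add: D_def B_def field_simps)
    finally have 1: "(1 + of_real B * Y z) * D = 1 + z + R z" .
    have "(1 + of_real A * Y z) * D = D + of_real A * (Y z * D)" by (simp add: algebra_simps)
    also have "\<dots> = 1 - z + R z" unfolding YD by (simp add: D_def A_def field_simps)
    finally have 2: "(1 + of_real A * Y z) * D = 1 - z + R z" .
    have "(1 + of_real B * Y z) * (1 - z + R z) * D = ((1 + of_real B * Y z) * D) * (1 - z + R z)"
      by (simp only: mult_ac)
    also have "\<dots> = 2 * D" unfolding 1 DD[symmetric] by (simp only: mult_ac)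
    finally have "(1 + of_real B * Y z) * (1 - z + R z) = 2" using D by simp
    thus Beq: "1 + of_real B * Y z = 2 / (1 - z + R z)" using Rf(3)[OF z] by (simp add: eq_divide_eq)
    have "(1 + of_real A * Y z) * (1 + z + R z) * D = ((1 + of_real A * Y z) * D) * (1 + z + R z)"
      by (simp only: mult_ac)
    also have "\<dots> = 2 * D" unfolding 2 DD[symmetric] by (simp only: mult_ac)
    finally have "(1 + of_real A * Y z) * (1 + z + R z) = 2" using D by simp
    thus Aeq: "1 + of_real A * Y z = 2 / (1 + z + R z)" using Rf(4)[OF z] by (simp add: eq_divide_eq)
    have "(1 + of_real B * Y z) * (1 + of_real A * Y z) * (D * D) = 2 * D"
      using 1 2 DD by (metis mult.assoc mult.commute mult.left_commute)
    hence "(1 + of_real B * Y z) * (1 + of_real A * Y z) * D = 2" using D by (simp add: mult.assoc)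
    hence "z * ((1 + of_real B * Y z) * (1 + of_real A * Y z)) * D = Y z * D" unfolding YD by (simp add: mult_ac)
    thus "Y z = z * ((1 + of_real B * Y z) * (1 + of_real A * Y z))" using D by simp
    have AB': "of_real A * of_real B = ((of_real x)\<^sup>2 - 1) / (4 :: complex)" using AB(1) by (simp only: mult.commute)
    have "(1 - z * (of_real x + 2 * (of_real A * of_real B) * Y z)) * D = D - z * of_real x * D - 2 * z * (of_real A * of_real B) * (Y z * D)"
      by (simp add: algebra_simps)
    also have "\<dots> = D - z * of_real x * D - z\<^sup>2 * ((of_real x)\<^sup>2 - 1)"
      unfolding YD AB' by (simp add: power2_eq_square)
    also have "\<dots> = R z * D"
      using R2 unfolding D_def by algebra
    finally show "R z = 1 - z * (of_real x + 2 * (of_real A * of_real B) * Y z)" using D by simp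
  qed
  have ball: "eventually (\<lambda>z. z \<in> ball (0::complex) 1) (nhds 0)"
    by (rule eventually_nhds_in_open) auto
  define FY where "FY = fps_expansion Y 0"
  have FY: "Y has_fps_expansion FY"
    unfolding FY_def using Y_hol by (intro analytic_at_imp_has_fps_expansion_0) (auto simp: analytic_at_ball intro: exI[of _ 1])
  have FY0: "FY $ 0 = 0" using has_fps_expansion_imp_0_eq_fps_nth_0[OF FY] by (simp add: Y_def)
  define FG where "FG = fps_expansion (jacobi_gen \<alpha> \<beta> \<theta>) 0"
  have FG: "jacobi_gen \<alpha> \<beta> \<theta> has_fps_expansion FG"
    unfolding FG_def using jacobi_gen_holomorphic
    by (intro analytic_at_imp_has_fps_expansion_0) (auto simp: analytic_at_ball intro: exI[of _ 1])
  have c\<phi>: "\<phi> oo FY = (1 + fps_const (of_real B) * FY) * (1 + fps_const (of_real A) * FY)"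
    unfolding \<phi>_def by (simp add: fps_compose_mult_distrib[OF FY0] fps_compose_add_distrib FY0)
  \<comment> \<open>Identities between holomorphic functions near 0 become identities of formal
    series by uniqueness of expansions.\<close>
  have F_eq: "FY = fps_X * (\<phi> oo FY)"
  proof -
    have "(\<lambda>z. z * ((1 + of_real B * Y z) * (1 + of_real A * Y z))) has_fps_expansion fps_X * (\<phi> oo FY)"
      unfolding c\<phi> by (intro fps_expansion_intros FY)
    also have "?this \<longleftrightarrow> Y has_fps_expansion fps_X * (\<phi> oo FY)"
      by (intro has_fps_expansion_cong refl eventually_mono[OF ball]) (use Y_eq in auto)
    finally show ?thesis using FY by (metis fps_expansion_unique_complex)
  qed
  have d\<phi>: "fps_deriv \<phi> oo FY = fps_const (of_real x) + fps_const (2 * (of_real A * of_real B)) * FY"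
  proof -
    have "fps_deriv \<phi> = fps_const (of_real x) + fps_const (2 * (of_real A * of_real B)) * fps_X"
      unfolding \<phi>_def AB(2)[symmetric] by (rule fps_ext) (simp add: algebra_simps fps_X_nth numeral_fps_const)
    thus ?thesis by (simp add: fps_compose_mult_distrib[OF FY0] fps_compose_add_distrib FY0)
  qed
  have H_exp: "(\<lambda>w. (1 + of_real B * w) powr of_real \<alpha> * (1 + of_real A * w) powr of_real \<beta>) has_fps_expansion H"
    unfolding H_def by (intro fps_expansion_intros has_fps_expansion_powr)
  have "FG * (1 - fps_X * (fps_deriv \<phi> oo FY)) = H oo FY"
  proof -
    have "(\<lambda>z. jacobi_gen \<alpha> \<beta> \<theta> z * (1 - z * (of_real x + 2 * (of_real A * of_real B) * Y z))) has_fps_expansion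
        FG * (1 - fps_X * (fps_deriv \<phi> oo FY))"
      unfolding d\<phi> by (intro fps_expansion_intros FG FY)
    also have "?this \<longleftrightarrow> ((\<lambda>w. (1 + of_real B * w) powr of_real \<alpha> * (1 + of_real A * w) powr of_real \<beta>) \<circ> Y) has_fps_expansion
        FG * (1 - fps_X * (fps_deriv \<phi> oo FY))"
    proof (intro has_fps_expansion_cong refl eventually_mono[OF ball])
      fix z :: complex assume z: "z \<in> ball 0 1"
      have "R z \<noteq> 0" using Rf(1)[OF z] by auto
      thus "jacobi_gen \<alpha> \<beta> \<theta> z * (1 - z * (of_real x + 2 * (of_real A * of_real B) * Y z)) =
        ((\<lambda>w. (1 + of_real B * w) powr of_real \<alpha> * (1 + of_real A * w) powr of_real \<beta>) \<circ> Y) z"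
        unfolding R_eq[OF z, symmetric] o_def B_eq[OF z] A_eq[OF z] jacobi_gen_def R_def[symmetric] by simp
    qed
    finally show ?thesis
      using has_fps_expansion_compose[OF H_exp FY FY0] by (metis fps_expansion_unique_complex)
  qed
  also have "H oo FY = Abs_fps (\<lambda>n. (H * \<phi> ^ n) $ n) * (1 - fps_X * (fps_deriv \<phi> oo FY))"
    by (rule lagrange_buermann[OF F_eq, symmetric])
  finally have "FG = Abs_fps (\<lambda>n. (H * \<phi> ^ n) $ n)"
  proof -
    have "(1 - fps_X * (fps_deriv \<phi> oo FY)) $ 0 = 1" by simp
    hence "1 - fps_X * (fps_deriv \<phi> oo FY) \<noteq> 0" by (metis fps_zero_nth zero_neq_one)
    thus "FG * (1 - fps_X * (fps_deriv \<phi> oo FY)) = Abs_fps (\<lambda>n. (H * \<phi> ^ n) $ n) * (1 - fps_X * (fps_deriv \<phi> oo FY)) \<Longrightarrow> ?thesis"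
      by simp
  qed
  hence coeff: "FG $ n = of_real (jacobi_poly n \<alpha> \<beta> x)" for n
    by (simp add: H_def \<phi>_def A_def B_def jacobi_poly_fps)
  \<comment> \<open>The coefficients were compared near 0 only; holomorphy on the whole disk makes
    the series converge for every \<open>z\<close> in it.\<close>
  have "(\<lambda>n. (deriv ^^ n) (jacobi_gen \<alpha> \<beta> \<theta>) 0 / fact n * (z - 0) ^ n) sums jacobi_gen \<alpha> \<beta> \<theta> z"
    using z by (intro holomorphic_power_series[OF jacobi_gen_holomorphic]) auto
  moreover have "(deriv ^^ n) (jacobi_gen \<alpha> \<beta> \<theta>) 0 / fact n = of_real (jacobi_poly n \<alpha> \<beta> x)" for n
    using coeff[of n] by (simp add: FG_def fps_expansion_def)
  ultimately show ?thesis by (simp add: x_def)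
qed

section \<open>Darboux asymptotics\<close>

text \<open>Coefficients in powers of \<open>(x - 1) / 2\<close>, in Pochhammer form so that
  neighbouring entries have rational ratios. The value 0 above the degree lets recurrences hold for
  all \<open>k\<close>.\<close>

definition jac_coeff :: "real \<Rightarrow> real \<Rightarrow> nat \<Rightarrow> nat \<Rightarrow> real" where
  "jac_coeff \<alpha> \<beta> n k = (if k \<le> n then pochhammer (\<alpha> + real k + 1) (n - k) / fact (n - k) *
     (pochhammer (real n + \<alpha> + \<beta> + 1) k / fact k) else 0)"

lemma jacobi_poly_jac_coeff: "jacobi_poly n \<alpha> \<beta> x = (\<Sum>k\<le>n. jac_coeff \<alpha> \<beta> n k * ((x - 1) / 2) ^ k)"
  unfolding jacobi_poly_hypergeometric
proof (intro sum.cong refl)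
  fix k assume "k \<in> {..n}"
  hence k: "k \<le> n" by simp
  have 1: "real n + \<alpha> - real (n - k) + 1 = \<alpha> + real k + 1"
    "real n + \<alpha> + \<beta> + real k - real k + 1 = real n + \<alpha> + \<beta> + 1"
    using k by (simp_all add: of_nat_diff)
  show "((real n + \<alpha>) gchoose (n - k)) * ((real n + \<alpha> + \<beta> + real k) gchoose k) * ((x - 1) / 2) ^ k =
      jac_coeff \<alpha> \<beta> n k * ((x - 1) / 2) ^ k"
    unfolding gbinomial_pochhammer' 1 using k by (simp add: jac_coeff_def)
qed

text \<open>Denominators are cleared so that the relation persists at \<open>k = Suc n\<close>,
  where the first factor vanishes, and beyond.\<close>

lemma jac_coeff_Suc_n:
  "jac_coeff \<alpha> \<beta> (Suc n) k * (real n + 1 - real k) * (real n + \<alpha> + \<beta> + 1) =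
   jac_coeff \<alpha> \<beta> n k * (real n + \<alpha> + 1) * (real n + \<alpha> + \<beta> + real k + 1)"
proof (cases "k \<le> n")
  case True
  define \<sigma> where "\<sigma> = real n + \<alpha> + \<beta> + 1"
  have 1: "pochhammer (\<alpha> + real k + 1) (Suc n - k) = pochhammer (\<alpha> + real k + 1) (n - k) * (real n + \<alpha> + 1)"
    using True by (simp add: Suc_diff_le pochhammer_Suc of_nat_diff add_ac)
  have 2: "fact (Suc n - k) = (real n + 1 - real k) * fact (n - k)"
    using True by (simp add: Suc_diff_le of_nat_diff)
  have 3: "pochhammer (\<sigma> + 1) k * \<sigma> = pochhammer \<sigma> k * (\<sigma> + real k)"
    using pochhammer_rec[of \<sigma> k] pochhammer_Suc[of \<sigma> k] by (simp add: mult.commute)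
  have nz: "real n + 1 - real k \<noteq> 0" using True by simp
  have 4: "real (Suc n) + \<alpha> + \<beta> + 1 = \<sigma> + 1" "real n + \<alpha> + \<beta> + real k + 1 = \<sigma> + real k" by (simp_all add: \<sigma>_def)
  have "jac_coeff \<alpha> \<beta> (Suc n) k * (real n + 1 - real k) * \<sigma> =
      (pochhammer (\<alpha> + real k + 1) (n - k) * (real n + \<alpha> + 1)) / fact (n - k) * (pochhammer (\<sigma> + 1) k * \<sigma> / fact k)"
    unfolding jac_coeff_def 1 2 4 using True nz by simp
  also have "\<dots> = jac_coeff \<alpha> \<beta> n k * (real n + \<alpha> + 1) * (\<sigma> + real k)"
    unfolding 3 using True by (simp add: jac_coeff_def \<sigma>_def)
  finally show ?thesis unfolding 4 \<sigma>_def[symmetric] .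
next
  case False
  thus ?thesis by (cases "k = Suc n") (auto simp: jac_coeff_def)
qed

lemma jac_coeff_Suc_k:
  "jac_coeff \<alpha> \<beta> n (Suc k) * real (Suc k) * (\<alpha> + real k + 1) =
   jac_coeff \<alpha> \<beta> n k * (real n - real k) * (real n + \<alpha> + \<beta> + real k + 1)"
proof (cases "k < n")
  case True
  obtain m where m: "n - k = Suc m" using True by (metis Suc_diff_Suc)
  have m': "n - Suc k = m" using m by simp
  have 1: "pochhammer (\<alpha> + real k + 1) (n - k) = (\<alpha> + real k + 1) * pochhammer (\<alpha> + real (Suc k) + 1) m"
    unfolding m pochhammer_rec by (simp add: add_ac)
  have 2: "fact (n - k) = (real n - real k) * fact m"
    using True m by (simp add: m' flip: of_nat_diff)
  have nz: "real n - real k \<noteq> 0" using True by simp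
  show ?thesis
    unfolding jac_coeff_def 1 2 m' pochhammer_Suc fact_Suc using True nz by (simp add: add_ac)
next
  case False
  thus ?thesis by (cases "k = n") (auto simp: jac_coeff_def)
qed

text \<open>The contiguity relations tie all four coefficients to one another by rational factors,
  so after clearing denominators the claim is a consequence of \<open>r1\<close>, \<open>r2\<close>
  and \<open>r3\<close> by polynomial algebra.\<close>

lemma jac_coeff_recurrence:
  fixes \<alpha> \<beta> :: real and m :: nat
  assumes "\<alpha> \<ge> 0" "\<beta> \<ge> 0"
  defines "n \<equiv> real (Suc m)" and "\<sigma> \<equiv> \<alpha> + \<beta>"
  defines "f \<equiv> (2 * n + \<sigma> + 2) * (2 * n + \<sigma>)"
  shows "2 * (n + 1) * (n + \<sigma> + 1) * (2 * n + \<sigma>) * jac_coeff \<alpha> \<beta> (Suc (Suc m)) k =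
    (2 * n + \<sigma> + 1) * ((f + (\<alpha>\<^sup>2 - \<beta>\<^sup>2)) * jac_coeff \<alpha> \<beta> (Suc m) k + 2 * f * (if k = 0 then 0 else jac_coeff \<alpha> \<beta> (Suc m) (k - 1)))
    - 2 * (n + \<alpha>) * (n + \<beta>) * (2 * n + \<sigma> + 2) * jac_coeff \<alpha> \<beta> m k"
proof -
  define c0 where "c0 = jac_coeff \<alpha> \<beta> (Suc m) k"
  define c1 where "c1 = jac_coeff \<alpha> \<beta> (Suc (Suc m)) k"
  define cm where "cm = jac_coeff \<alpha> \<beta> m k"
  define cs where "cs = (if k = 0 then 0 else jac_coeff \<alpha> \<beta> (Suc m) (k - 1))"
  define x where "x = real k"
  have n: "n > 0" by (simp add: n_def)
  have \<sigma>: "\<sigma> \<ge> 0" using assms by (simp add: \<sigma>_def)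
  have \<beta>: "\<beta> = \<sigma> - \<alpha>" by (simp add: \<sigma>_def)
  have x: "x \<ge> 0" by (simp add: x_def)
  have r1: "c1 * (n + 1 - x) * (n + \<sigma> + 1) = c0 * (n + \<alpha> + 1) * (n + \<sigma> + x + 1)"
    using jac_coeff_Suc_n[of \<alpha> \<beta> "Suc m" k] by (simp add: c0_def c1_def n_def \<sigma>_def x_def add_ac)
  have r2: "c0 * (n - x) * (n + \<sigma>) = cm * (n + \<alpha>) * (n + \<sigma> + x)"
    using jac_coeff_Suc_n[of \<alpha> \<beta> m k] by (simp add: c0_def cm_def n_def \<sigma>_def x_def add_ac)
  have r3: "c0 * x * (\<alpha> + x) = cs * (n - x + 1) * (n + \<sigma> + x)"
  proof (cases k)
    case (Suc i)
    have "jac_coeff \<alpha> \<beta> (Suc m) (Suc i) * real (Suc i) * (\<alpha> + real i + 1) =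
      jac_coeff \<alpha> \<beta> (Suc m) i * (real (Suc m) - real i) * (real (Suc m) + \<alpha> + \<beta> + real i + 1)"
      by (rule jac_coeff_Suc_k)
    moreover have "real i = x - 1" "real (Suc i) = x" by (simp_all add: x_def Suc)
    ultimately show ?thesis by (simp add: c0_def cs_def n_def \<sigma>_def Suc add_ac)
  qed (simp add: cs_def x_def)
  have "2 * (n + 1) * (n + \<sigma> + 1) * (2 * n + \<sigma>) * c1 =
    (2 * n + \<sigma> + 1) * ((f + (\<alpha>\<^sup>2 - \<beta>\<^sup>2)) * c0 + 2 * f * cs) - 2 * (n + \<alpha>) * (n + \<beta>) * (2 * n + \<sigma> + 2) * cm"
  \<comment> \<open>At the leading coefficient \<open>n + 1 - x\<close> is 0 and \<open>r1\<close>
    carries no information; there the comparison goes through the subleading entry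
    \<open>e\<close>.\<close>
  proof (cases "k = Suc (Suc m)")
    case True
    have xn: "x = n + 1" by (simp add: x_def n_def True)
    have c: "c0 = 0" "cm = 0" by (simp_all add: c0_def cm_def jac_coeff_def True)
    define e where "e = jac_coeff \<alpha> \<beta> (Suc (Suc m)) (Suc m)"
    have cs: "cs = jac_coeff \<alpha> \<beta> (Suc m) (Suc m)" by (simp add: cs_def True)
    have e1: "e * (n + \<sigma> + 1) = cs * (n + \<alpha> + 1) * (2 * n + \<sigma> + 1)"
      using jac_coeff_Suc_n[of \<alpha> \<beta> "Suc m" "Suc m"] by (simp add: e_def cs n_def \<sigma>_def algebra_simps)
    have e2: "c1 * (n + 1) * (n + \<alpha> + 1) = e * (2 * n + \<sigma> + 2)"
      using jac_coeff_Suc_k[of \<alpha> \<beta> "Suc (Suc m)" "Suc m"] by (simp add: e_def c1_def True n_def \<sigma>_def algebra_simps)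
    have nz: "n + \<alpha> + 1 \<noteq> 0" using n assms by simp
    have "(n + \<alpha> + 1) * (2 * (n + 1) * (n + \<sigma> + 1) * (2 * n + \<sigma>) * c1) = (n + \<alpha> + 1) * ((2 * n + \<sigma> + 1) * (2 * f * cs))"
      unfolding f_def using e1 e2 by algebra
    hence "2 * (n + 1) * (n + \<sigma> + 1) * (2 * n + \<sigma>) * c1 = (2 * n + \<sigma> + 1) * (2 * f * cs)" using nz by simp
    thus ?thesis by (simp add: c)
  next
    case False
    show ?thesis
    proof (cases "k > Suc (Suc m)")
      case True
      thus ?thesis by (simp add: c0_def c1_def cm_def cs_def jac_coeff_def)
    next
      case False
      with \<open>k \<noteq> Suc (Suc m)\<close> have "k \<le> Suc m" by simp
      hence nx: "n + 1 - x > 0" by (simp add: n_def x_def)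
      have p: "n + \<sigma> + x > 0" using n \<sigma> x by simp
      have "(n + 1 - x) * (n + \<sigma> + x) * (2 * (n + 1) * (n + \<sigma> + 1) * (2 * n + \<sigma>) * c1) =
        (n + 1 - x) * (n + \<sigma> + x) * ((2 * n + \<sigma> + 1) * ((f + (\<alpha>\<^sup>2 - \<beta>\<^sup>2)) * c0 + 2 * f * cs) - 2 * (n + \<alpha>) * (n + \<beta>) * (2 * n + \<sigma> + 2) * cm)"
        using r1 r2 r3 unfolding f_def \<beta> by algebra
      thus ?thesis using nx p by simp
    qed
  qed
  thus ?thesis by (simp only: c0_def c1_def cm_def cs_def)
qed

lemma jacobi_three_term:
  fixes \<alpha> \<beta> x :: real and m :: nat
  assumes "\<alpha> \<ge> 0" "\<beta> \<ge> 0"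
  defines "n \<equiv> real (Suc m)" and "\<sigma> \<equiv> \<alpha> + \<beta>"
  defines "f \<equiv> (2 * n + \<sigma> + 2) * (2 * n + \<sigma>)"
  shows "2 * (n + 1) * (n + \<sigma> + 1) * (2 * n + \<sigma>) * jacobi_poly (Suc (Suc m)) \<alpha> \<beta> x =
    (2 * n + \<sigma> + 1) * (f * x + (\<alpha>\<^sup>2 - \<beta>\<^sup>2)) * jacobi_poly (Suc m) \<alpha> \<beta> x
    - 2 * (n + \<alpha>) * (n + \<beta>) * (2 * n + \<sigma> + 2) * jacobi_poly m \<alpha> \<beta> x"
proof -
  define A where "A = (x - 1) / 2"
  define M where "M = Suc (Suc m)"
  have ext: "jacobi_poly j \<alpha> \<beta> x = (\<Sum>k\<le>M. jac_coeff \<alpha> \<beta> j k * A ^ k)" if "j \<le> M" for j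
    unfolding jacobi_poly_jac_coeff A_def[symmetric] using that
    by (intro sum.mono_neutral_left) (auto simp: jac_coeff_def)
  have shift: "A * jacobi_poly (Suc m) \<alpha> \<beta> x = (\<Sum>k\<le>M. (if k = 0 then 0 else jac_coeff \<alpha> \<beta> (Suc m) (k - 1)) * A ^ k)"
  proof -
    have "(\<Sum>k\<le>M. (if k = 0 then 0 else jac_coeff \<alpha> \<beta> (Suc m) (k - 1)) * A ^ k) =
        (\<Sum>i\<le>Suc m. jac_coeff \<alpha> \<beta> (Suc m) i * A ^ Suc i)"
      unfolding M_def sum.atMost_Suc_shift[of _ "Suc m"] by (simp del: sum.atMost_Suc)
    thus ?thesis
      unfolding jacobi_poly_jac_coeff A_def[symmetric] sum_distrib_left by (simp add: mult.left_commute)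
  qed
  have x: "x = 1 + 2 * A" by (simp add: A_def field_simps)
  have "2 * (n + 1) * (n + \<sigma> + 1) * (2 * n + \<sigma>) * jacobi_poly (Suc (Suc m)) \<alpha> \<beta> x =
    (\<Sum>k\<le>M. 2 * (n + 1) * (n + \<sigma> + 1) * (2 * n + \<sigma>) * jac_coeff \<alpha> \<beta> (Suc (Suc m)) k * A ^ k)"
  proof -
    have e: "jacobi_poly (Suc (Suc m)) \<alpha> \<beta> x = (\<Sum>k\<le>M. jac_coeff \<alpha> \<beta> (Suc (Suc m)) k * A ^ k)"
      by (rule ext) (simp add: M_def)
    show ?thesis unfolding e by (simp only: sum_distrib_left mult.assoc)
  qed
  also have "\<dots> = (\<Sum>k\<le>M. (2 * n + \<sigma> + 1) * ((f + (\<alpha>\<^sup>2 - \<beta>\<^sup>2)) * (jac_coeff \<alpha> \<beta> (Suc m) k * A ^ k) +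
      2 * f * ((if k = 0 then 0 else jac_coeff \<alpha> \<beta> (Suc m) (k - 1)) * A ^ k))
    - 2 * (n + \<alpha>) * (n + \<beta>) * (2 * n + \<sigma> + 2) * (jac_coeff \<alpha> \<beta> m k * A ^ k))"
  proof -
    have alg: "(P * (Q * a + R * b) - S * c) * w = P * (Q * (a * w) + R * (b * w)) - S * (c * w)"
      for P Q R S a b c w :: real by (simp add: algebra_simps)
    have r: "2 * (n + 1) * (n + \<sigma> + 1) * (2 * n + \<sigma>) * jac_coeff \<alpha> \<beta> (Suc (Suc m)) k =
      (2 * n + \<sigma> + 1) * ((f + (\<alpha>\<^sup>2 - \<beta>\<^sup>2)) * jac_coeff \<alpha> \<beta> (Suc m) k + 2 * f * (if k = 0 then 0 else jac_coeff \<alpha> \<beta> (Suc m) (k - 1)))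
      - 2 * (n + \<alpha>) * (n + \<beta>) * (2 * n + \<sigma> + 2) * jac_coeff \<alpha> \<beta> m k" for k
      unfolding n_def \<sigma>_def f_def by (rule jac_coeff_recurrence[OF assms(1,2)])
    show ?thesis unfolding r by (intro sum.cong refl alg)
  qed
  also have "\<dots> = (2 * n + \<sigma> + 1) * ((f + (\<alpha>\<^sup>2 - \<beta>\<^sup>2)) * (\<Sum>k\<le>M. jac_coeff \<alpha> \<beta> (Suc m) k * A ^ k) +
      2 * f * (\<Sum>k\<le>M. (if k = 0 then 0 else jac_coeff \<alpha> \<beta> (Suc m) (k - 1)) * A ^ k))
    - 2 * (n + \<alpha>) * (n + \<beta>) * (2 * n + \<sigma> + 2) * (\<Sum>k\<le>M. jac_coeff \<alpha> \<beta> m k * A ^ k)"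
    by (simp only: sum_subtractf sum.distrib sum_distrib_left[symmetric])
  also have "\<dots> = (2 * n + \<sigma> + 1) * ((f + (\<alpha>\<^sup>2 - \<beta>\<^sup>2)) * jacobi_poly (Suc m) \<alpha> \<beta> x + 2 * f * (A * jacobi_poly (Suc m) \<alpha> \<beta> x))
    - 2 * (n + \<alpha>) * (n + \<beta>) * (2 * n + \<sigma> + 2) * jacobi_poly m \<alpha> \<beta> x"
    unfolding shift[symmetric] by (subst (1 2) ext[symmetric]) (auto simp: M_def)
  finally show ?thesis unfolding x by (simp add: algebra_simps)
qed

text \<open>The coefficients of \<open>(1 - z)\<^sup>-\<^sup>1\<^sup>/\<^sup>2\<close>.\<close>

definition half_coeff :: "nat \<Rightarrow> real" where
  "half_coeff n = pochhammer (1 / 2) n / fact n"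

lemma half_coeff_pos: "half_coeff n > 0"
  by (simp add: half_coeff_def pochhammer_pos)

lemma half_coeff_0 [simp]: "half_coeff 0 = 1"
  by (simp add: half_coeff_def)

lemma half_coeff_Suc: "half_coeff (Suc n) = half_coeff n * ((2 * real n + 1) / (2 * real n + 2))"
  by (simp add: half_coeff_def pochhammer_Suc field_simps)

text \<open>At interior points Jacobi polynomials have size \<open>n powr (-1/2)\<close>, so their
  own recurrence differs from a rotation already at order 1/n. \<open>half_coeff\<close> has the
  same decay, and dividing by it removes exactly this order; the rest is summable.\<close>

lemma jacobi_normalized_recurrence:
  fixes \<alpha> \<beta> :: real
  assumes "\<alpha> \<ge> 0" "\<beta> \<ge> 0"
  defines "y \<equiv> (\<lambda>n x. jacobi_poly n \<alpha> \<beta> x / half_coeff n)"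
  shows "\<exists>C>0. \<forall>m x. \<bar>x\<bar> \<le> 1 \<longrightarrow>
    \<bar>y (Suc (Suc m)) x - 2 * x * y (Suc m) x + y m x\<bar> \<le> C / (real (Suc m))\<^sup>2 * (\<bar>y (Suc m) x\<bar> + \<bar>y m x\<bar>)"
proof -
  define \<sigma> where "\<sigma> = \<alpha> + \<beta>"
  \<comment> \<open>These constants bound the numerators of the deviations: \<open>s0\<close> and
    \<open>b0\<close> those in the coefficient of \<open>y (Suc m)\<close>, and \<open>k2\<close>,
    \<open>k1\<close>, \<open>k0\<close> those of \<open>w\<close>, where the quartic and cubic
    terms cancel. The extra 1 in \<open>C\<close> makes it positive.\<close>
  define s0 where "s0 = \<sigma> * (\<sigma> + 1)"
  define b0 where "b0 = \<bar>\<alpha>\<^sup>2 - \<beta>\<^sup>2\<bar>"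
  define k2 where "k2 = \<sigma> + 2 * \<alpha> * \<beta> + 1 / 2"
  define k1 where "k1 = \<alpha> * \<beta> * (\<sigma> + 2) + (3 * \<sigma> + 2) / 4"
  define k0 where "k0 = \<sigma> * (\<sigma> + 1) / 4"
  define C where "C = 1 + s0 + b0 + k2 + k1 + k0"
  have \<sigma>: "\<sigma> \<ge> 0" using assms by (simp add: \<sigma>_def)
  have nn: "s0 \<ge> 0" "b0 \<ge> 0" "k2 \<ge> 0" "k1 \<ge> 0" "k0 \<ge> 0"
    using assms \<sigma> by (auto simp: s0_def b0_def k2_def k1_def k0_def)
  have "\<bar>y (Suc (Suc m)) x - 2 * x * y (Suc m) x + y m x\<bar> \<le> C / (real (Suc m))\<^sup>2 * (\<bar>y (Suc m) x\<bar> + \<bar>y m x\<bar>)"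
    if x: "\<bar>x\<bar> \<le> 1" for m x
  proof -
    define n where "n = real (Suc m)"
    define p0 p1 p2 where "p0 = y m x" and "p1 = y (Suc m) x" and "p2 = y (Suc (Suc m)) x"
    have n: "n \<ge> 1" by (simp add: n_def)
    define e where "e = half_coeff m"
    have e: "e > 0" by (simp add: e_def half_coeff_pos)
    have e1: "half_coeff (Suc m) = e * ((2 * n - 1) / (2 * n))"
    proof -
      have "2 * n - 1 = 2 * real m + 1" "2 * n = 2 * real m + 2" by (simp_all add: n_def)
      thus ?thesis unfolding half_coeff_Suc e_def by (simp only:)
    qed
    have e2: "half_coeff (Suc (Suc m)) = e * ((2 * n - 1) / (2 * n)) * ((2 * n + 1) / (2 * n + 2))"
      unfolding half_coeff_Suc[of "Suc m"] e1 n_def[symmetric] ..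
    have P: "jacobi_poly m \<alpha> \<beta> x = p0 * e" "jacobi_poly (Suc m) \<alpha> \<beta> x = p1 * (e * ((2 * n - 1) / (2 * n)))"
      "jacobi_poly (Suc (Suc m)) \<alpha> \<beta> x = p2 * (e * ((2 * n - 1) / (2 * n)) * ((2 * n + 1) / (2 * n + 2)))"
    proof -
      have pm: "jacobi_poly j \<alpha> \<beta> x = y j x * half_coeff j" for j
        unfolding y_def using half_coeff_pos[of j] by simp
      show "jacobi_poly m \<alpha> \<beta> x = p0 * e" "jacobi_poly (Suc m) \<alpha> \<beta> x = p1 * (e * ((2 * n - 1) / (2 * n)))"
        "jacobi_poly (Suc (Suc m)) \<alpha> \<beta> x = p2 * (e * ((2 * n - 1) / (2 * n)) * ((2 * n + 1) / (2 * n + 2)))"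
        by (simp_all only: pm p0_def p1_def p2_def e_def[symmetric] e1 e2)
    qed
    define u where "u = s0 / ((n + \<sigma> + 1) * (2 * n + 1))"
    define v where "v = (2 * n + \<sigma> + 1) * (\<alpha>\<^sup>2 - \<beta>\<^sup>2) / ((n + \<sigma> + 1) * (2 * n + \<sigma>) * (2 * n + 1))"
    define w where "w = (k2 * n\<^sup>2 + k1 * n + k0) / ((n + \<sigma> + 1) * (2 * n + \<sigma>) * (n + 1 / 2) * (n - 1 / 2))"
    have pos: "n > 0" "2 * n - 1 > 0" "2 * n + 1 > 0" "n + \<sigma> + 1 > 0" "2 * n + \<sigma> > 0" "n - 1 / 2 > 0" "n + 1 / 2 > 0"
      using n \<sigma> by auto
    have p2_eq: "p2 = 2 * x * p1 - p0 + (u * x + v) * p1 - w * p0"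
    proof -
      have rec: "2 * (n + 1) * (n + \<sigma> + 1) * (2 * n + \<sigma>) * (p2 * (e * ((2 * n - 1) / (2 * n)) * ((2 * n + 1) / (2 * n + 2)))) =
        (2 * n + \<sigma> + 1) * ((2 * n + \<sigma> + 2) * (2 * n + \<sigma>) * x + (\<alpha>\<^sup>2 - \<beta>\<^sup>2)) * (p1 * (e * ((2 * n - 1) / (2 * n))))
        - 2 * (n + \<alpha>) * (n + \<beta>) * (2 * n + \<sigma> + 2) * (p0 * e)"
        using jacobi_three_term[OF assms(1,2), of m x] unfolding P n_def[symmetric] \<sigma>_def[symmetric] .
      have "e * ((n + \<sigma> + 1) * (2 * n + \<sigma>) * (2 * n - 1) * (2 * n + 1) * p2) =
        2 * n * (2 * (n + 1) * (n + \<sigma> + 1) * (2 * n + \<sigma>) * (p2 * (e * ((2 * n - 1) / (2 * n)) * ((2 * n + 1) / (2 * n + 2)))))"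
      proof -
        have "2 * n * (2 * (n + 1) * X * Z * (p2 * (e * (a / (2 * n)) * (b / (2 * n + 2))))) = e * (X * Z * a * b * p2)"
          for a b X Z :: real
        proof -
          have c: "(2 * n) * (a / (2 * n)) = a" "(2 * (n + 1)) * (b / (2 * n + 2)) = b" using pos by simp_all
          have "2 * n * (2 * (n + 1) * X * Z * (p2 * (e * (a / (2 * n)) * (b / (2 * n + 2))))) =
            ((2 * n) * (a / (2 * n))) * ((2 * (n + 1)) * (b / (2 * n + 2))) * (e * X * Z * p2)"
            by (simp only: mult_ac)
          thus ?thesis unfolding c by (simp only: mult_ac)
        qed
        thus ?thesis by (rule sym)
      qed
      also have "\<dots> = e * ((2 * n + \<sigma> + 1) * ((2 * n + \<sigma> + 2) * (2 * n + \<sigma>) * x + (\<alpha>\<^sup>2 - \<beta>\<^sup>2)) * (2 * n - 1) * p1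
        - 4 * n * (n + \<alpha>) * (n + \<beta>) * (2 * n + \<sigma> + 2) * p0)"
        unfolding rec using pos by (simp add: field_simps)
      finally have 1: "(n + \<sigma> + 1) * (2 * n + \<sigma>) * (2 * n - 1) * (2 * n + 1) * p2 =
        (2 * n + \<sigma> + 1) * ((2 * n + \<sigma> + 2) * (2 * n + \<sigma>) * x + (\<alpha>\<^sup>2 - \<beta>\<^sup>2)) * (2 * n - 1) * p1
        - 4 * n * (n + \<alpha>) * (n + \<beta>) * (2 * n + \<sigma> + 2) * p0"
        using e by simp
      define D where "D = (n + \<sigma> + 1) * (2 * n + \<sigma>) * (2 * n - 1) * (2 * n + 1)"
      have D: "D > 0" unfolding D_def using pos by (intro mult_pos_pos) auto
      have uD: "D * u = s0 * ((2 * n + \<sigma>) * (2 * n - 1))"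
      proof -
        have "D = ((n + \<sigma> + 1) * (2 * n + 1)) * ((2 * n + \<sigma>) * (2 * n - 1))" by (simp only: D_def mult_ac)
        thus ?thesis unfolding u_def using pos by simp
      qed
      have vD: "D * v = (2 * n + \<sigma> + 1) * (\<alpha>\<^sup>2 - \<beta>\<^sup>2) * (2 * n - 1)"
      proof -
        have "D = ((n + \<sigma> + 1) * (2 * n + \<sigma>) * (2 * n + 1)) * (2 * n - 1)" by (simp only: D_def mult_ac)
        thus ?thesis unfolding v_def using pos by simp
      qed
      have wD: "D * w = 4 * (k2 * n\<^sup>2 + k1 * n + k0)"
      proof -
        have q: "(n + 1 / 2) * (n - 1 / 2) * 4 = (2 * n - 1) * (2 * n + 1)" by (simp add: algebra_simps)
        have "((n + \<sigma> + 1) * (2 * n + \<sigma>) * (n + 1 / 2) * (n - 1 / 2)) * 4 =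
            (n + \<sigma> + 1) * (2 * n + \<sigma>) * ((n + 1 / 2) * (n - 1 / 2) * 4)" by (simp only: mult.assoc)
        hence "D = ((n + \<sigma> + 1) * (2 * n + \<sigma>) * (n + 1 / 2) * (n - 1 / 2)) * 4"
          unfolding q by (simp only: D_def mult.assoc)
        thus ?thesis unfolding w_def using pos by simp
      qed
      have "D * (2 * x * p1 - p0 + (u * x + v) * p1 - w * p0) =
        D * (2 * x * p1 - p0) + (D * u) * x * p1 + (D * v) * p1 - (D * w) * p0" by (simp add: algebra_simps)
      also have "\<dots> = D * p2"
      proof -
        have k: "4 * (k2 * n\<^sup>2 + k1 * n + k0) = (4 * \<sigma> + 8 * \<alpha> * \<beta> + 2) * n\<^sup>2 +
            (4 * \<alpha> * \<beta> * (\<sigma> + 2) + 3 * \<sigma> + 2) * n + \<sigma> * (\<sigma> + 1)"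
          by (simp add: k2_def k1_def k0_def distrib_right)
        show ?thesis
          unfolding uD vD wD k unfolding D_def unfolding 1 unfolding s0_def \<sigma>_def by (simp add: power2_eq_square algebra_simps)
      qed
      finally show ?thesis using D by simp
    qed
    have n2: "n\<^sup>2 > 0" using n by simp
    have ub: "\<bar>u\<bar> \<le> s0 / (2 * n\<^sup>2)"
    proof -
      have "2 * n\<^sup>2 \<le> (n + \<sigma> + 1) * (2 * n + 1)"
        using mult_mono[of n "n + \<sigma> + 1" "2 * n" "2 * n + 1"] n \<sigma> by (simp add: power2_eq_square)
      hence "u \<le> s0 / (2 * n\<^sup>2)" unfolding u_def using n2 nn pos by (intro divide_left_mono mult_pos_pos) auto
      moreover have "u \<ge> 0" unfolding u_def using nn pos by (intro divide_nonneg_pos mult_pos_pos) auto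
      ultimately show ?thesis by simp
    qed
    have vb: "\<bar>v\<bar> \<le> b0 / (2 * n\<^sup>2)"
    proof -
      have "\<bar>v\<bar> = (2 * n + \<sigma> + 1) * b0 / ((n + \<sigma> + 1) * (2 * n + \<sigma>) * (2 * n + 1))"
        unfolding v_def b0_def using pos by (simp add: abs_mult)
      also have "\<dots> \<le> (2 * (n + \<sigma> + 1)) * b0 / ((n + \<sigma> + 1) * (2 * n + \<sigma>) * (2 * n + 1))"
        using pos nn \<sigma> by (intro divide_right_mono mult_right_mono) auto
      also have "\<dots> = 2 * b0 / ((2 * n + \<sigma>) * (2 * n + 1))"
      proof -
        have cancel: "(2 * X) * b0 / (X * Y * Z) = 2 * b0 / (Y * Z)" if "X \<noteq> 0" for X Y Z :: real using that by simp
        show ?thesis by (rule cancel) (use pos(4) in linarith)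
      qed
      also have "\<dots> \<le> 2 * b0 / ((2 * n) * (2 * n))"
        using pos nn \<sigma> by (intro divide_left_mono mult_mono mult_pos_pos) auto
      also have "\<dots> = b0 / (2 * n\<^sup>2)" by (simp add: power2_eq_square)
      finally show ?thesis .
    qed
    have wb: "\<bar>w\<bar> \<le> (k2 + k1 + k0) / n\<^sup>2"
    proof -
      have "n * (2 * n) * n * (n / 2) \<le> (n + \<sigma> + 1) * (2 * n + \<sigma>) * (n + 1 / 2) * (n - 1 / 2)"
        using n \<sigma> by (intro mult_mono) auto
      hence "n\<^sup>2 * n\<^sup>2 \<le> (n + \<sigma> + 1) * (2 * n + \<sigma>) * (n + 1 / 2) * (n - 1 / 2)"
        by (simp add: power2_eq_square mult_ac)
      moreover have "k2 * n\<^sup>2 + k1 * n + k0 \<le> (k2 + k1 + k0) * n\<^sup>2"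
      proof -
        have "n \<le> n\<^sup>2" "1 \<le> n\<^sup>2" using n by (auto simp: power2_eq_square mult_le_cancel_left1 intro: order_trans[OF n])
        hence "k1 * n \<le> k1 * n\<^sup>2" "k0 * 1 \<le> k0 * n\<^sup>2" using nn by (intro mult_left_mono; simp)+
        thus ?thesis by (simp add: algebra_simps)
      qed
      ultimately have "w \<le> (k2 + k1 + k0) * n\<^sup>2 / (n\<^sup>2 * n\<^sup>2)"
        unfolding w_def using n2 nn pos by (intro frac_le mult_pos_pos) auto
      also have "\<dots> = (k2 + k1 + k0) / n\<^sup>2"
        by (rule nonzero_mult_divide_mult_cancel_right) (use n2 in linarith)
      finally have "w \<le> (k2 + k1 + k0) / n\<^sup>2" .
      moreover have "w \<ge> 0" unfolding w_def using nn pos by (intro divide_nonneg_pos mult_pos_pos add_nonneg_nonneg mult_nonneg_nonneg) auto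
      ultimately show ?thesis by simp
    qed
    have uv: "\<bar>u * x + v\<bar> \<le> C / n\<^sup>2"
    proof -
      have "\<bar>u * x + v\<bar> \<le> \<bar>u * x\<bar> + \<bar>v\<bar>" by (rule abs_triangle_ineq)
      also have "\<bar>u * x\<bar> \<le> \<bar>u\<bar> * 1" using x unfolding abs_mult by (intro mult_mono) auto
      also have "\<bar>u\<bar> * 1 + \<bar>v\<bar> \<le> (s0 + b0) / n\<^sup>2"
      proof -
        have "s0 / (2 * n\<^sup>2) = (s0 / n\<^sup>2) / 2" "b0 / (2 * n\<^sup>2) = (b0 / n\<^sup>2) / 2" by simp_all
        moreover have "s0 / n\<^sup>2 \<ge> 0" "b0 / n\<^sup>2 \<ge> 0" using nn by simp_all
        ultimately show ?thesis using ub vb unfolding add_divide_distrib by linarith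
      qed
      also have "\<dots> \<le> C / n\<^sup>2" using nn by (intro divide_right_mono) (auto simp: C_def)
      finally show ?thesis by simp
    qed
    have wC: "\<bar>w\<bar> \<le> C / n\<^sup>2"
      using wb nn by (rule_tac order_trans[OF wb], intro divide_right_mono) (auto simp: C_def)
    have "\<bar>p2 - 2 * x * p1 + p0\<bar> = \<bar>(u * x + v) * p1 - w * p0\<bar>" unfolding p2_eq by simp
    also have "\<dots> \<le> \<bar>u * x + v\<bar> * \<bar>p1\<bar> + \<bar>w\<bar> * \<bar>p0\<bar>"
      using abs_triangle_ineq4[of "(u * x + v) * p1" "w * p0"] by (simp only: abs_mult)
    also have "\<dots> \<le> C / n\<^sup>2 * \<bar>p1\<bar> + C / n\<^sup>2 * \<bar>p0\<bar>"
      by (intro add_mono mult_right_mono uv wC) auto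
    finally show ?thesis by (simp add: p0_def p1_def p2_def n_def distrib_left)
  qed
  moreover have "C > 0" using nn by (simp add: C_def)
  ultimately show ?thesis by blast
qed

section \<open>Summable perturbations of a rotation\<close>

lemma telescoping_weight: "1 / (real (Suc n))\<^sup>2 \<le> 2 * (1 / real (Suc n) - 1 / real (Suc (Suc n)))"
proof -
  define x where "x = real (Suc n)"
  have x: "x \<ge> 1" "real (Suc (Suc n)) = x + 1" by (simp_all add: x_def)
  have "1 / x\<^sup>2 = 2 / (x * (x + x))" using x by (simp add: power2_eq_square)
  also have "\<dots> \<le> 2 / (x * (x + 1))" using x by (intro divide_left_mono mult_left_mono mult_pos_pos) auto
  also have "\<dots> = 2 * (1 / x - 1 / (x + 1))" using x by (simp add: field_simps)
  finally show ?thesis unfolding x(2) x_def[symmetric] .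
qed

lemma telescoping_bound:
  fixes f :: "nat \<Rightarrow> 'a :: real_normed_vector"
  assumes f: "\<And>n. norm (f (Suc n) - f n) \<le> K / (real (Suc n))\<^sup>2" and K: "K \<ge> 0" and nm: "n \<le> m"
  shows "norm (f m - f n) \<le> 2 * K * (1 / real (Suc n) - 1 / real (Suc m))"
  using nm
proof (induction m rule: dec_induct)
  case (step m)
  have "norm (f (Suc m) - f n) \<le> norm (f (Suc m) - f m) + norm (f m - f n)"
    using norm_triangle_ineq[of "f (Suc m) - f m" "f m - f n"] by simp
  also have "norm (f (Suc m) - f m) \<le> K * (1 / (real (Suc m))\<^sup>2)" using f[of m] by simp
  also have "\<dots> \<le> K * (2 * (1 / real (Suc m) - 1 / real (Suc (Suc m))))"
    by (rule mult_left_mono[OF telescoping_weight K])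
  also have "\<dots> + norm (f m - f n) \<le> \<dots> + 2 * K * (1 / real (Suc n) - 1 / real (Suc m))"
    using step.IH by (rule add_left_mono)
  also have "\<dots> = 2 * K * (1 / real (Suc n) - 1 / real (Suc (Suc m)))" by (simp only: algebra_simps)
  finally show ?case by simp
qed simp

text \<open>Increments of order 1/n^2 give a limit with rate 1/n. The constant is explicit, so
  bounds uniform in a parameter pass to the limit.\<close>

lemma telescoping_limit:
  fixes f :: "nat \<Rightarrow> 'a :: banach"
  assumes f: "\<And>n. norm (f (Suc n) - f n) \<le> K / (real (Suc n))\<^sup>2" and K: "K \<ge> 0"
  shows "\<exists>L. f \<longlonglongrightarrow> L \<and> (\<forall>n. norm (f n - L) \<le> 2 * K / real (Suc n))"
proof -
  have b: "norm (f m - f n) \<le> 2 * K / real (Suc n)" if "n \<le> m" for m n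
  proof -
    have "norm (f m - f n) \<le> 2 * K * (1 / real (Suc n) - 1 / real (Suc m))" by (rule telescoping_bound[OF f K that])
    also have "\<dots> \<le> 2 * K * (1 / real (Suc n))" using K by (intro mult_left_mono) auto
    finally show ?thesis by simp
  qed
  have "(\<lambda>n. 2 * K / real (Suc n)) \<longlonglongrightarrow> 0"
    by (rule real_tendsto_divide_at_top[OF tendsto_const])
       (rule filterlim_compose[OF filterlim_real_sequentially filterlim_Suc])
  hence small: "\<exists>M. \<forall>n\<ge>M. 2 * K / real (Suc n) < e" if "e > 0" for e
    using order_tendstoD(2)[of _ 0 sequentially e] that by (auto simp: eventually_sequentially)
  have "Cauchy f"
  proof (rule CauchyI')
    fix e :: real assume "e > 0"
    then obtain M where M: "\<forall>n\<ge>M. 2 * K / real (Suc n) < e" using small by blast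
    have "norm (f m - f n) < e" if "M \<le> m" "m < n" for m n
      using b[of m n] M that by (subst norm_minus_commute) (auto intro: le_less_trans)
    thus "\<exists>M. \<forall>m\<ge>M. \<forall>n>m. dist (f m) (f n) < e" unfolding dist_norm by blast
  qed
  then obtain L where L: "f \<longlonglongrightarrow> L" using Cauchy_convergent convergent_def by blast
  have "norm (f n - L) \<le> 2 * K / real (Suc n)" for n
  proof -
    have "(\<lambda>m. norm (f m - f n)) \<longlonglongrightarrow> norm (L - f n)" by (intro tendsto_intros L)
    hence "norm (L - f n) \<le> 2 * K / real (Suc n)"
      by (rule LIMSEQ_le_const2) (use b in blast)
    thus ?thesis by (simp add: norm_minus_commute)
  qed
  thus ?thesis using L by blast
qed

text \<open>Variation of constants for a perturbation of \<open>y\<^sub>n\<^sub>+\<^sub>2 - 2 cos \<theta> y\<^sub>n\<^sub>+\<^sub>1 + y\<^sub>n = 0\<close>: the rotated amplitude has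
  summable increments, so the asymptotics comes with an error \<open>O(1/n)\<close> as soon as the limit is known.\<close>

lemma perturbed_rotation:
  fixes y :: "nat \<Rightarrow> real"
  assumes C: "C \<ge> 0" and s0: "s0 > 0" "sin \<theta> \<ge> s0"
    and rec: "\<And>m. \<bar>y (Suc (Suc m)) - 2 * cos \<theta> * y (Suc m) + y m\<bar> \<le> C / (real (Suc m))\<^sup>2 * (\<bar>y (Suc m)\<bar> + \<bar>y m\<bar>)"
  defines "\<zeta> \<equiv> (\<lambda>n. cis (- (real n * \<theta>)) * (of_real (y (Suc n)) - cis (- \<theta>) * of_real (y n)))"
  defines "D \<equiv> C * (1 + 2 / s0)"
  shows "sin \<theta> * y n = Im (cis (real n * \<theta>) * \<zeta> n)"
    and "\<exists>L. \<forall>n. cmod (\<zeta> n - L) \<le> 2 * (D * exp (2 * D) * (\<bar>y 1\<bar> + \<bar>y 0\<bar>)) / real (Suc n)"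
proof -
  \<comment> \<open>This combination removes the characteristic root
    \<open>cis (- \<theta>)\<close>; without perturbation each step multiplies it by
    \<open>cis \<theta>\<close>, which \<open>\<zeta>\<close> undoes.\<close>
  define \<eta> where "\<eta> = (\<lambda>n. of_real (y (Suc n)) - cis (- \<theta>) * of_real (y n))"
  have \<zeta>: "\<zeta> n = cis (- (real n * \<theta>)) * \<eta> n" for n by (simp add: \<zeta>_def \<eta>_def)
  have Im_\<eta>: "Im (\<eta> n) = sin \<theta> * y n" for n by (simp add: \<eta>_def)
  have cc: "cis (real n * \<theta>) * \<zeta> n = \<eta> n" for n
    unfolding \<zeta> mult.assoc[symmetric] cis_mult by simp
  show "sin \<theta> * y n = Im (cis (real n * \<theta>) * \<zeta> n)" unfolding cc Im_\<eta> ..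
  have D0: "D \<ge> 0" using C s0 by (simp add: D_def)
  have norm_\<zeta>: "cmod (\<zeta> n) = cmod (\<eta> n)" for n by (simp add: \<zeta> norm_mult)
  \<comment> \<open>The lower bound \<open>s0\<close> on the sine lets the amplitude control
    \<open>y\<close>; it is the only way in which the angle enters \<open>D\<close>.\<close>
  have y0: "\<bar>y n\<bar> \<le> cmod (\<zeta> n) / s0" for n
  proof -
    have "s0 * \<bar>y n\<bar> \<le> sin \<theta> * \<bar>y n\<bar>" using s0 by (intro mult_right_mono) auto
    also have "\<dots> = \<bar>Im (\<eta> n)\<bar>" using s0 by (simp add: Im_\<eta> abs_mult)
    also have "\<dots> \<le> cmod (\<eta> n)" by (rule abs_Im_le_cmod)
    finally show ?thesis using s0 by (simp add: norm_\<zeta> field_simps)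
  qed
  have y1: "\<bar>y (Suc n)\<bar> \<le> cmod (\<zeta> n) + \<bar>y n\<bar>" for n
  proof -
    have "of_real (y (Suc n)) = \<eta> n + cis (- \<theta>) * of_real (y n)" by (simp add: \<eta>_def)
    hence "cmod (of_real (y (Suc n))) \<le> cmod (\<eta> n) + cmod (cis (- \<theta>) * of_real (y n))"
      by (metis norm_triangle_ineq)
    thus ?thesis by (simp add: norm_\<zeta> norm_mult)
  qed
  have incr: "cmod (\<zeta> (Suc n) - \<zeta> n) \<le> D / (real (Suc n))\<^sup>2 * cmod (\<zeta> n)" for n
  proof -
    have "\<zeta> n = cis (- (real (Suc n) * \<theta>)) * (cis \<theta> * \<eta> n)"
      unfolding \<zeta> mult.assoc[symmetric] cis_mult by (simp add: algebra_simps)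
    hence "\<zeta> (Suc n) - \<zeta> n = cis (- (real (Suc n) * \<theta>)) * (\<eta> (Suc n) - cis \<theta> * \<eta> n)"
      unfolding \<zeta>[of "Suc n"] by (simp add: right_diff_distrib)
    moreover have "\<eta> (Suc n) - cis \<theta> * \<eta> n = of_real (y (Suc (Suc n)) - 2 * cos \<theta> * y (Suc n) + y n)"
    proof -
      have "\<eta> (Suc n) - cis \<theta> * \<eta> n = of_real (y (Suc (Suc n))) - (cis (- \<theta>) + cis \<theta>) * of_real (y (Suc n)) + (cis \<theta> * cis (- \<theta>)) * of_real (y n)"
        by (simp add: \<eta>_def algebra_simps)
      moreover have "cis (- \<theta>) + cis \<theta> = of_real (2 * cos \<theta>)" by (simp add: complex_eq_iff)
      moreover have "cis \<theta> * cis (- \<theta>) = 1" by (simp add: cis_mult)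
      ultimately show ?thesis by simp
    qed
    ultimately have "cmod (\<zeta> (Suc n) - \<zeta> n) = \<bar>y (Suc (Suc n)) - 2 * cos \<theta> * y (Suc n) + y n\<bar>"
      by (simp only: norm_mult norm_cis norm_of_real mult_1_left)
    also have "\<dots> \<le> C / (real (Suc n))\<^sup>2 * (\<bar>y (Suc n)\<bar> + \<bar>y n\<bar>)" by (rule rec)
    also have "\<dots> \<le> C / (real (Suc n))\<^sup>2 * ((1 + 2 / s0) * cmod (\<zeta> n))"
    proof (intro mult_left_mono)
      have "(1 + 2 / s0) * cmod (\<zeta> n) = cmod (\<zeta> n) + 2 * (cmod (\<zeta> n) / s0)" by (simp add: algebra_simps)
      thus "\<bar>y (Suc n)\<bar> + \<bar>y n\<bar> \<le> (1 + 2 / s0) * cmod (\<zeta> n)" using y0[of n] y1[of n] by linarith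
    qed (use C in auto)
    finally show ?thesis by (simp add: D_def)
  qed
  \<comment> \<open>Discrete Gronwall inequality: the product of the factors
    \<open>1 + D / k\<^sup>2\<close> is bounded by a telescoping exponential.\<close>
  have growth: "cmod (\<zeta> n) \<le> exp (2 * D * (1 - 1 / real (Suc n))) * cmod (\<zeta> 0)" for n
  proof (induction n)
    case (Suc n)
    have "cmod (\<zeta> (Suc n)) \<le> cmod (\<zeta> (Suc n) - \<zeta> n) + cmod (\<zeta> n)"
      using norm_triangle_ineq[of "\<zeta> (Suc n) - \<zeta> n" "\<zeta> n"] by simp
    also have "\<dots> \<le> (1 + D * (1 / (real (Suc n))\<^sup>2)) * cmod (\<zeta> n)"
      using incr[of n] by (simp add: algebra_simps)
    also have "\<dots> \<le> exp (D * (2 * (1 / real (Suc n) - 1 / real (Suc (Suc n))))) * cmod (\<zeta> n)"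
    proof (intro mult_right_mono)
      have "1 + D * (1 / (real (Suc n))\<^sup>2) \<le> exp (D * (1 / (real (Suc n))\<^sup>2))" by (rule exp_ge_add_one_self)
      also have "\<dots> \<le> exp (D * (2 * (1 / real (Suc n) - 1 / real (Suc (Suc n)))))"
        using mult_left_mono[OF telescoping_weight D0, of n] by (simp only: exp_le_cancel_iff)
      finally show "1 + D * (1 / (real (Suc n))\<^sup>2) \<le> exp (D * (2 * (1 / real (Suc n) - 1 / real (Suc (Suc n)))))" .
    qed auto
    also have "\<dots> \<le> exp (D * (2 * (1 / real (Suc n) - 1 / real (Suc (Suc n))))) * (exp (2 * D * (1 - 1 / real (Suc n))) * cmod (\<zeta> 0))"
      by (intro mult_left_mono Suc.IH) auto
    also have "\<dots> = exp (D * (2 * (1 / real (Suc n) - 1 / real (Suc (Suc n)))) + 2 * D * (1 - 1 / real (Suc n))) * cmod (\<zeta> 0)"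
      by (simp only: exp_add mult.assoc)
    also have "D * (2 * (1 / real (Suc n) - 1 / real (Suc (Suc n)))) + 2 * D * (1 - 1 / real (Suc n)) = 2 * D * (1 - 1 / real (Suc (Suc n)))"
      by (simp only: algebra_simps)
    finally show ?case .
  qed simp
  define K where "K = D * exp (2 * D) * (\<bar>y 1\<bar> + \<bar>y 0\<bar>)"
  have K0: "K \<ge> 0" using D0 by (simp add: K_def)
  have "cmod (\<zeta> (Suc n) - \<zeta> n) \<le> K / (real (Suc n))\<^sup>2" for n
  proof -
    have "cmod (\<zeta> n) \<le> exp (2 * D) * cmod (\<zeta> 0)"
    proof -
      have "2 * D * (1 - 1 / real (Suc n)) \<le> 2 * D * 1" using D0 by (intro mult_left_mono) auto
      hence "exp (2 * D * (1 - 1 / real (Suc n))) * cmod (\<zeta> 0) \<le> exp (2 * D) * cmod (\<zeta> 0)"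
        by (intro mult_right_mono) auto
      thus ?thesis using growth[of n] by linarith
    qed
    also have "\<dots> \<le> exp (2 * D) * (\<bar>y 1\<bar> + \<bar>y 0\<bar>)"
      using norm_triangle_ineq4[of "complex_of_real (y 1)" "cis (- \<theta>) * of_real (y 0)"]
      by (intro mult_left_mono) (auto simp: norm_\<zeta> \<eta>_def norm_mult)
    finally have "D / (real (Suc n))\<^sup>2 * cmod (\<zeta> n) \<le> D / (real (Suc n))\<^sup>2 * (exp (2 * D) * (\<bar>y 1\<bar> + \<bar>y 0\<bar>))"
      using D0 by (intro mult_left_mono) auto
    thus ?thesis using incr[of n] by (simp add: K_def)
  qed
  from telescoping_limit[OF this K0] show "\<exists>L. \<forall>n. cmod (\<zeta> n - L) \<le> 2 * (D * exp (2 * D) * (\<bar>y 1\<bar> + \<bar>y 0\<bar>)) / real (Suc n)"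
    unfolding K_def by blast
qed

section \<open>The limiting amplitude from the generating function\<close>

lemma half_coeff_sums:
  fixes w :: complex
  assumes "cmod w < 1"
  shows "(\<lambda>n. of_real (half_coeff n) * w ^ n) sums ((1 - w) powr of_real (- 1 / 2))"
proof -
  have "(\<lambda>n. (of_real (- 1 / 2) gchoose n) * (- w) ^ n) sums ((1 + - w) powr of_real (- 1 / 2))"
    using assms by (intro gen_binomial_complex) auto
  moreover have "(of_real (- 1 / 2) gchoose n) * (- w) ^ n = of_real (half_coeff n) * w ^ n" for n
  proof -
    have "((- 1 / 2) gchoose n :: real) = (- 1) ^ n * half_coeff n"
      using gbinomial_pochhammer[of "- 1 / 2 :: real" n] by (simp add: half_coeff_def)
    thus ?thesis unfolding gbinomial_of_real power_minus[of w]
      by (simp add: power_mult_distrib[symmetric] mult.left_commute[of "of_real (half_coeff n)"])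
  qed
  ultimately show ?thesis by simp
qed

text \<open>The series telescopes: each term is twice the decrement of
  \<open>half_coeff\<close>.\<close>

lemma half_coeff_div:
  "summable (\<lambda>n. half_coeff n / real (Suc n))" "(\<Sum>n. half_coeff n / real (Suc n)) \<le> 2"
proof -
  have eq: "half_coeff n / real (Suc n) = 2 * (half_coeff n - half_coeff (Suc n))" for n
    unfolding half_coeff_Suc by (simp add: field_simps)
  have b: "(\<Sum>n<N. half_coeff n / real (Suc n)) \<le> 2" for N
  proof -
    have "(\<Sum>n<N. half_coeff n / real (Suc n)) = 2 * (half_coeff 0 - half_coeff N)"
      unfolding eq sum_distrib_left[symmetric] sum_lessThan_telescope' ..
    thus ?thesis using half_coeff_pos[of N] by simp
  qed
  show s: "summable (\<lambda>n. half_coeff n / real (Suc n))"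
    using half_coeff_pos by (intro summableI_nonneg_bounded[OF _ b]) (auto intro: less_imp_le)
  show "(\<Sum>n. half_coeff n / real (Suc n)) \<le> 2"
    by (rule suminf_le_const[OF s b])
qed

lemma sqrt_one_minus_tendsto: "((\<lambda>r. complex_of_real (sqrt (1 - r))) \<longlongrightarrow> 0) (at_left 1)"
proof -
  have "((\<lambda>r. complex_of_real (sqrt (1 - r))) \<longlongrightarrow> complex_of_real (sqrt (1 - 1))) (at_left 1)"
    by (intro tendsto_intros)
  thus ?thesis by simp
qed

lemma eventually_at_left_unit: "eventually (\<lambda>r::real. 0 < r \<and> r < 1) (at_left 1)"
  unfolding eventually_at_left_field by (rule exI[of _ 0]) auto

text \<open>The limiting amplitude is read off the singularity of the generating function at \<open>cis (- \<theta>)\<close>;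
  the remaining error sums to a bounded function because \<open>half_coeff n / n\<close> is summable.\<close>

lemma abel_amplitude:
  assumes \<theta>: "0 < \<theta>" "\<theta> < pi"
    and y: "\<And>n. sin \<theta> * y n = Im (cis (real n * \<theta>) * \<zeta> n)"
    and L: "\<And>n. cmod (\<zeta> n - L) \<le> Q / real (Suc n)"
    and G: "\<And>z. cmod z < 1 \<Longrightarrow> (\<lambda>n. of_real (half_coeff n * y n) * z ^ n) sums G z"
    and Z: "((\<lambda>r. of_real (sqrt (1 - r)) * G (of_real r * cis (- \<theta>))) \<longlongrightarrow> Z) (at_left 1)"
  shows "L = 2 * \<i> * of_real (sin \<theta>) * Z"
proof -
  define s where "s = sin \<theta>"
  have s: "s > 0" using \<theta> by (simp add: s_def sin_gt_zero)
  have Q: "Q \<ge> 0" using order_trans[OF norm_ge_zero L[of 0]] by simp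
  \<comment> \<open>On the ray to \<open>cis (- \<theta>)\<close> the two conjugate oscillations of
    \<open>y\<close> sum to \<open>(1 - r) powr (-1/2)\<close>, which is resonant, and to
    \<open>W r\<close>, which stays bounded; \<open>E\<close> is what the error terms
    contribute.\<close>
  define W where "W = (\<lambda>r. (1 - of_real r * cis (- 2 * \<theta>)) powr of_real (- 1 / 2))"
  define E where "E = (\<lambda>r. 2 * \<i> * of_real s * G (of_real r * cis (- \<theta>)) - (L * (1 - of_real r) powr of_real (- 1 / 2) - cnj L * W r))"
  have E_bound: "cmod (E r) \<le> 4 * Q" if r: "0 < r" "r < 1" for r
  proof -
    define \<epsilon> where "\<epsilon> = (\<lambda>n. (\<zeta> n - L) - cis (- 2 * (real n * \<theta>)) * cnj (\<zeta> n - L))"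
    have \<epsilon>: "cmod (\<epsilon> n) \<le> 2 * Q / real (Suc n)" for n
    proof -
      have "cmod (\<epsilon> n) \<le> cmod (\<zeta> n - L) + cmod (cis (- 2 * (real n * \<theta>)) * cnj (\<zeta> n - L))"
        unfolding \<epsilon>_def by (rule norm_triangle_ineq4)
      also have "\<dots> = 2 * cmod (\<zeta> n - L)" by (simp only: norm_mult norm_cis complex_mod_cnj)
      finally show ?thesis using L[of n] by simp
    qed
    have term_eq: "2 * \<i> * of_real s * (of_real (half_coeff n * y n) * (of_real r * cis (- \<theta>)) ^ n) -
        (L * (of_real (half_coeff n) * of_real r ^ n) - cnj L * (of_real (half_coeff n) * (of_real r * cis (- 2 * \<theta>)) ^ n)) =
        of_real (half_coeff n) * of_real r ^ n * \<epsilon> n" for n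
    proof -
      define e where "e = cis (real n * \<theta>)"
      have ee: "e * cnj e = 1" by (simp add: e_def cis_cnj cis_mult)
      have p1: "(of_real r * cis (- \<theta>)) ^ n = of_real r ^ n * cnj e"
        by (simp add: power_mult_distrib e_def Complex.DeMoivre cis_cnj)
      have p2: "(of_real r * cis (- 2 * \<theta>)) ^ n = of_real r ^ n * (cnj e * cnj e)"
      proof -
        have "(of_real r * cis (- 2 * \<theta>)) ^ n = of_real r ^ n * cis (real n * (- 2 * \<theta>))"
          by (simp only: power_mult_distrib Complex.DeMoivre)
        also have "real n * (- 2 * \<theta>) = - (real n * \<theta>) + - (real n * \<theta>)" by simp
        finally show ?thesis by (simp only: e_def cis_cnj cis_mult)
      qed
      have p3: "cis (- 2 * (real n * \<theta>)) = cnj e * cnj e" by (simp add: e_def cis_cnj cis_mult mult.commute)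
      have "2 * \<i> * of_real (s * y n) = e * \<zeta> n - cnj (e * \<zeta> n)"
        unfolding s_def y e_def[symmetric] by (simp add: complex_eq_iff)
      hence "2 * \<i> * of_real s * of_real (y n) * cnj e = (e * cnj e) * \<zeta> n - cnj e * cnj e * cnj (\<zeta> n)"
        by (drule_tac arg_cong[where f = "\<lambda>x. x * cnj e"]) (simp add: algebra_simps)
      hence yy: "2 * \<i> * of_real s * of_real (y n) * cnj e = \<zeta> n - cnj e * cnj e * cnj (\<zeta> n)" unfolding ee by simp
      have "2 * \<i> * of_real s * (of_real (half_coeff n * y n) * (of_real r ^ n * cnj e)) =
          of_real (half_coeff n) * of_real r ^ n * (2 * \<i> * of_real s * of_real (y n) * cnj e)" by (simp add: mult_ac)
      thus ?thesis unfolding p1 p2 yy \<epsilon>_def p3 by (simp add: algebra_simps)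
    qed
    have "(\<lambda>n. of_real (half_coeff n) * of_real r ^ n * \<epsilon> n) sums E r"
      unfolding term_eq[symmetric] E_def W_def using r
      by (intro sums_diff sums_mult G half_coeff_sums) (auto simp: norm_mult)
    hence E: "E r = (\<Sum>n. of_real (half_coeff n) * of_real r ^ n * \<epsilon> n)" by (simp add: sums_iff)
    have "cmod (E r) \<le> (\<Sum>n. 2 * Q * (half_coeff n / real (Suc n)))"
      unfolding E
    proof (rule norm_suminf_le)
      show "summable (\<lambda>n. 2 * Q * (half_coeff n / real (Suc n)))" by (intro summable_mult half_coeff_div)
      fix n
      have "cmod (of_real (half_coeff n) * of_real r ^ n * \<epsilon> n) = half_coeff n * r ^ n * cmod (\<epsilon> n)"
        using r half_coeff_pos[of n] by (simp add: norm_mult norm_power)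
      also have "\<dots> \<le> half_coeff n * 1 * (2 * Q / real (Suc n))"
        using r half_coeff_pos[of n] by (intro mult_mono \<epsilon> power_le_one) auto
      finally show "cmod (of_real (half_coeff n) * of_real r ^ n * \<epsilon> n) \<le> 2 * Q * (half_coeff n / real (Suc n))" by (simp add: mult_ac)
    qed
    also have "\<dots> = 2 * Q * (\<Sum>n. half_coeff n / real (Suc n))" by (intro suminf_mult half_coeff_div)
    also have "\<dots> \<le> 2 * Q * 2" using Q by (intro mult_left_mono half_coeff_div) auto
    finally show ?thesis by simp
  qed
  have "((\<lambda>r. of_real (sqrt (1 - r)) * E r) \<longlongrightarrow> 0) (at_left 1)"
  proof (rule Lim_null_comparison)
    show "eventually (\<lambda>r. norm (of_real (sqrt (1 - r)) * E r) \<le> cmod (of_real (sqrt (1 - r))) * (4 * Q)) (at_left 1)"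
      using eventually_at_left_unit by eventually_elim (unfold norm_mult, intro mult_left_mono E_bound, auto)
    have "((\<lambda>r. cmod (complex_of_real (sqrt (1 - r))) * (4 * Q)) \<longlongrightarrow> cmod 0 * (4 * Q)) (at_left 1)"
      by (intro tendsto_intros sqrt_one_minus_tendsto)
    thus "((\<lambda>r. cmod (complex_of_real (sqrt (1 - r))) * (4 * Q)) \<longlongrightarrow> 0) (at_left 1)" by simp
  qed
  moreover have "((\<lambda>r. of_real (sqrt (1 - r)) * (cnj L * W r)) \<longlongrightarrow> 0 * (cnj L * (1 - of_real 1 * cis (- 2 * \<theta>)) powr of_real (- 1 / 2))) (at_left 1)"
    unfolding W_def
  proof (intro tendsto_mult tendsto_const sqrt_one_minus_tendsto tendsto_powr_complex tendsto_diff tendsto_of_real)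
    \<comment> \<open>The limit point of the base lies in the right half plane, off the branch cut
      of the principal power.\<close>
    have "Re (1 - of_real 1 * cis (- 2 * \<theta>)) = 2 * s\<^sup>2" by (simp add: s_def cos_double_sin)
    thus "1 - of_real 1 * cis (- 2 * \<theta>) \<notin> \<real>\<^sub>\<le>\<^sub>0" using s by (intro not_nonpos_Reals_if_Re_pos) simp
  qed auto
  ultimately have "((\<lambda>r. of_real (sqrt (1 - r)) * E r - of_real (sqrt (1 - r)) * (cnj L * W r) + L) \<longlongrightarrow> 0 - 0 * (cnj L * (1 - of_real 1 * cis (- 2 * \<theta>)) powr of_real (- 1 / 2)) + L) (at_left 1)"
    by (intro tendsto_add tendsto_diff tendsto_const)
  hence "((\<lambda>r. of_real (sqrt (1 - r)) * E r - of_real (sqrt (1 - r)) * (cnj L * W r) + L) \<longlongrightarrow> L) (at_left 1)" by simp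
  moreover have "eventually (\<lambda>r. of_real (sqrt (1 - r)) * E r - of_real (sqrt (1 - r)) * (cnj L * W r) + L =
      2 * \<i> * of_real s * (of_real (sqrt (1 - r)) * G (of_real r * cis (- \<theta>)))) (at_left 1)"
    using eventually_at_left_unit
  proof eventually_elim
    case (elim r)
    have "of_real (sqrt (1 - r)) * (1 - of_real r) powr of_real (- 1 / 2) = (1 :: complex)"
    proof -
      have "(1 - complex_of_real r) powr of_real (- 1 / 2) = of_real ((1 - r) powr (- 1 / 2))"
        using powr_of_real[of "1 - r" "- 1 / 2"] elim by simp
      also have "(1 - r) powr (- 1 / 2) = 1 / sqrt (1 - r)" using elim by (simp add: powr_minus_divide powr_half_sqrt)
      finally show ?thesis using elim by (simp flip: of_real_mult)
    qed
    hence cancel: "of_real (sqrt (1 - r)) * (L * (1 - of_real r) powr of_real (- 1 / 2)) = L"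
      by (simp only: mult.left_commute[of _ L] mult_1_right)
    have "of_real (sqrt (1 - r)) * E r - of_real (sqrt (1 - r)) * (cnj L * W r) + L =
        of_real (sqrt (1 - r)) * (2 * \<i> * of_real s * G (of_real r * cis (- \<theta>)))"
      unfolding E_def right_diff_distrib cancel by simp
    thus ?case by (simp only: mult.left_commute[of "2 * \<i> * of_real s"])
  qed
  ultimately have "((\<lambda>r. 2 * \<i> * of_real s * (of_real (sqrt (1 - r)) * G (of_real r * cis (- \<theta>)))) \<longlongrightarrow> L) (at_left 1)"
    by (rule Lim_transform_eventually)
  moreover have "((\<lambda>r. 2 * \<i> * of_real s * (of_real (sqrt (1 - r)) * G (of_real r * cis (- \<theta>)))) \<longlongrightarrow> 2 * \<i> * of_real s * Z) (at_left 1)"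
    by (intro tendsto_intros Z)
  ultimately show ?thesis unfolding s_def by (rule tendsto_unique[rotated]) simp
qed

lemma cis_powr:
  assumes "r > 0" "- pi < \<phi>" "\<phi> \<le> pi"
  shows "(of_real r * cis \<phi>) powr of_real a = of_real (r powr a) * cis (a * \<phi>)"
proof -
  have "of_real r * cis \<phi> = exp (of_real (ln r) + \<i> * of_real \<phi>)"
    using assms by (simp add: exp_add cis_conv_exp exp_of_real)
  moreover have "Ln (exp (of_real (ln r) + \<i> * of_real \<phi>)) = of_real (ln r) + \<i> * of_real \<phi>"
    using assms by (intro Ln_exp) auto
  ultimately have "(of_real r * cis \<phi>) powr of_real a = exp (of_real a * (of_real (ln r) + \<i> * of_real \<phi>))"
    by (simp add: powr_def)
  also have "\<dots> = exp (of_real (a * ln r)) * exp (\<i> * of_real (a * \<phi>))" by (simp add: distrib_left exp_add mult_ac)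
  also have "\<dots> = of_real (r powr a) * cis (a * \<phi>)"
    using assms by (simp only: exp_of_real cis_conv_exp) (simp add: powr_def)
  finally show ?thesis .
qed

text \<open>Modulus, and with \<open>darboux_phase\<close> the argument, of the radial limit of
  \<open>sqrt (1 - r) * jacobi_gen\<close> at \<open>cis (- \<theta>)\<close>.\<close>

definition darboux_amplitude :: "real \<Rightarrow> real \<Rightarrow> real \<Rightarrow> real" where
  "darboux_amplitude \<alpha> \<beta> \<theta> = sin (\<theta> / 2) powr (- \<alpha>) * cos (\<theta> / 2) powr (- \<beta>) * (2 * sin \<theta>) powr (- 1 / 2)"

definition darboux_phase :: "real \<Rightarrow> real \<Rightarrow> real \<Rightarrow> real" where
  "darboux_phase \<alpha> \<beta> \<theta> = (\<alpha> + \<beta> + 1) / 2 * \<theta> - (2 * \<alpha> + 1) / 4 * pi"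

text \<open>On this ray one factor of \<open>jacobi_R\<close> is exactly
  \<open>sqrt (1 - r)\<close>. It cancels against the prefactor in the denominator and disappears
  from the two powers, whose bases converge inside the right half plane.\<close>

lemma jacobi_gen_radial_limit:
  assumes \<theta>: "0 < \<theta>" "\<theta> < pi"
  shows "((\<lambda>r. of_real (sqrt (1 - r)) * jacobi_gen \<alpha> \<beta> \<theta> (of_real r * cis (- \<theta>))) \<longlongrightarrow>
    of_real (darboux_amplitude \<alpha> \<beta> \<theta>) * cis (darboux_phase \<alpha> \<beta> \<theta>)) (at_left 1)"
proof -
  define s c where "s = sin (\<theta> / 2)" and "c = cos (\<theta> / 2)"
  have sc: "s > 0" "c > 0" using \<theta> by (auto simp: s_def c_def intro!: sin_gt_zero cos_gt_zero)
  have sin\<theta>: "sin \<theta> > 0" using \<theta> by (intro sin_gt_zero)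
  have dbl: "sin \<theta> = 2 * s * c" "cos \<theta> = 1 - 2 * s\<^sup>2" "cos \<theta> = 2 * c\<^sup>2 - 1"
    using sin_double[of "\<theta> / 2"] cos_double_sin[of "\<theta> / 2"] cos_double_cos[of "\<theta> / 2"] by (simp_all add: s_def c_def)
  \<comment> \<open>Polar forms by half angles; their arguments lie in the principal range, so
    powers act on modulus and argument separately.\<close>
  have e1: "1 - cis (- \<theta>) = of_real (2 * s) * cis (pi / 2 - \<theta> / 2)"
    by (simp add: complex_eq_iff cos_diff sin_diff dbl power2_eq_square flip: s_def c_def) 
  have e2: "1 + cis (- \<theta>) = of_real (2 * c) * cis (- (\<theta> / 2))"
    by (simp add: complex_eq_iff dbl(1,3) power2_eq_square flip: s_def c_def)
  have e3: "1 - cis (- 2 * \<theta>) = of_real (2 * sin \<theta>) * cis (pi / 2 - \<theta>)"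
    by (simp add: complex_eq_iff cos_diff sin_diff cos_double_sin sin_double power2_eq_square)
  define w where "w = (\<lambda>r. 1 - complex_of_real r * cis (- 2 * \<theta>))"
  have w_lim: "(w \<longlongrightarrow> 1 - cis (- 2 * \<theta>)) (at_left 1)"
  proof -
    have "(w \<longlongrightarrow> 1 - of_real 1 * cis (- 2 * \<theta>)) (at_left 1)" unfolding w_def by (intro tendsto_intros)
    thus ?thesis by simp
  qed
  have Re3: "Re (1 - cis (- 2 * \<theta>)) > 0" using sin\<theta> by (simp add: cos_double_sin)
  have cw_lim: "((\<lambda>r. csqrt (w r)) \<longlongrightarrow> csqrt (1 - cis (- 2 * \<theta>))) (at_left 1)"
    by (rule isCont_tendsto_compose[OF _ w_lim]) (rule continuous_at_csqrt[OF not_nonpos_Reals_if_Re_pos[OF Re3]])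
  define R where "R = (\<lambda>r. of_real (sqrt (1 - r)) * csqrt (w r))"
  have R_lim: "(R \<longlongrightarrow> 0) (at_left 1)"
    using tendsto_mult[OF sqrt_one_minus_tendsto cw_lim] by (simp add: R_def)
  define V where "V = (\<lambda>r. (2 / (1 - of_real r * cis (- \<theta>) + R r)) powr of_real \<alpha> *
     (2 / (1 + of_real r * cis (- \<theta>) + R r)) powr of_real \<beta> / csqrt (w r))"
  have "(V \<longlongrightarrow> (2 / (1 - of_real 1 * cis (- \<theta>) + 0)) powr of_real \<alpha> *
     (2 / (1 + of_real 1 * cis (- \<theta>) + 0)) powr of_real \<beta> / csqrt (1 - cis (- 2 * \<theta>))) (at_left 1)"
  proof -
    have "Re (1 - cis (- \<theta>)) > 0" using sc by (simp add: dbl(2))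
    moreover have "Re (1 + cis (- \<theta>)) > 0" using sc by (simp add: dbl(3))
    ultimately have n: "2 / (1 - of_real 1 * cis (- \<theta>) + 0) \<notin> \<real>\<^sub>\<le>\<^sub>0" "2 / (1 + of_real 1 * cis (- \<theta>) + 0) \<notin> \<real>\<^sub>\<le>\<^sub>0"
      "1 - of_real 1 * cis (- \<theta>) + 0 \<noteq> 0" "1 + of_real 1 * cis (- \<theta>) + 0 \<noteq> 0"
      by (auto intro!: not_nonpos_Reals_if_Re_pos Re_inverse_pos simp del: minus_complex.sel plus_complex.sel)
    have "1 - cis (- 2 * \<theta>) \<noteq> 0" using Re3 by (metis less_irrefl zero_complex.sel(1))
    hence q: "csqrt (1 - cis (- 2 * \<theta>)) \<noteq> 0" by simp
    have d: "((\<lambda>r. 1 - of_real r * cis (- \<theta>) + R r) \<longlongrightarrow> 1 - of_real 1 * cis (- \<theta>) + 0) (at_left 1)"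
      "((\<lambda>r. 1 + of_real r * cis (- \<theta>) + R r) \<longlongrightarrow> 1 + of_real 1 * cis (- \<theta>) + 0) (at_left 1)"
      by (intro tendsto_intros R_lim)+
    show ?thesis
      unfolding V_def by (intro tendsto_mult tendsto_divide tendsto_powr_complex tendsto_const cw_lim d n q)
  qed
  also have "(2 / (1 - of_real 1 * cis (- \<theta>) + 0)) powr of_real \<alpha> * (2 / (1 + of_real 1 * cis (- \<theta>) + 0)) powr of_real \<beta> / csqrt (1 - cis (- 2 * \<theta>)) =
      of_real (darboux_amplitude \<alpha> \<beta> \<theta>) * cis (darboux_phase \<alpha> \<beta> \<theta>)"
  proof -
    have 1: "(2 / (1 - of_real 1 * cis (- \<theta>) + 0)) powr of_real \<alpha> = of_real (s powr (- \<alpha>)) * cis (\<alpha> * (\<theta> / 2 - pi / 2))"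
    proof -
      have "2 / (1 - of_real 1 * cis (- \<theta>) + 0) = of_real (1 / s) * cis (\<theta> / 2 - pi / 2)"
        using sc e1 by (simp add: divide_simps cis_mult)
      moreover have "(1 / s) powr \<alpha> = s powr (- \<alpha>)" using sc by (simp add: powr_divide powr_minus_divide)
      ultimately show ?thesis using sc \<theta> by (simp only:) (subst cis_powr, auto)
    qed
    have 2: "(2 / (1 + of_real 1 * cis (- \<theta>) + 0)) powr of_real \<beta> = of_real (c powr (- \<beta>)) * cis (\<beta> * (\<theta> / 2))"
    proof -
      have "2 / (1 + of_real 1 * cis (- \<theta>) + 0) = of_real (1 / c) * cis (\<theta> / 2)"
        using sc e2 by (simp add: divide_simps cis_mult)
      moreover have "(1 / c) powr \<beta> = c powr (- \<beta>)" using sc by (simp add: powr_divide powr_minus_divide)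
      ultimately show ?thesis using sc \<theta> by (simp only:) (subst cis_powr, auto)
    qed
    have 3: "csqrt (1 - cis (- 2 * \<theta>)) = of_real ((2 * sin \<theta>) powr (1 / 2)) * cis (1 / 2 * (pi / 2 - \<theta>))"
    proof -
      have "csqrt (1 - cis (- 2 * \<theta>)) = (of_real (2 * sin \<theta>) * cis (pi / 2 - \<theta>)) powr of_real (1 / 2)"
        unfolding e3 using sin\<theta> by (subst csqrt_conv_powr) auto
      also have "\<dots> = of_real ((2 * sin \<theta>) powr (1 / 2)) * cis (1 / 2 * (pi / 2 - \<theta>))"
        by (rule cis_powr) (use sin\<theta> \<theta> in auto)
      finally show ?thesis .
    qed
    have ph: "darboux_phase \<alpha> \<beta> \<theta> = \<alpha> * (\<theta> / 2 - pi / 2) + \<beta> * (\<theta> / 2) - 1 / 2 * (pi / 2 - \<theta>)"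
      by (simp add: darboux_phase_def field_simps)
    have am: "darboux_amplitude \<alpha> \<beta> \<theta> = s powr (- \<alpha>) * c powr (- \<beta>) / (2 * sin \<theta>) powr (1 / 2)"
      by (simp add: darboux_amplitude_def s_def c_def powr_minus_divide)
    show ?thesis unfolding 1 2 3 ph am by (simp add: cis_mult[symmetric] cis_divide[symmetric])
  qed
  finally have "(V \<longlongrightarrow> of_real (darboux_amplitude \<alpha> \<beta> \<theta>) * cis (darboux_phase \<alpha> \<beta> \<theta>)) (at_left 1)" .
  thus ?thesis
  proof (rule Lim_transform_eventually)
    show "eventually (\<lambda>r. V r = of_real (sqrt (1 - r)) * jacobi_gen \<alpha> \<beta> \<theta> (of_real r * cis (- \<theta>))) (at_left 1)"
      using eventually_at_left_unit
    proof eventually_elim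
      case (elim r)
      have "jacobi_R \<theta> (of_real r * cis (- \<theta>)) = R r"
      proof -
        have "1 - of_real r * cis (- \<theta>) * cis \<theta> = complex_of_real (1 - r)" by (simp add: mult.assoc cis_mult)
        moreover have "1 - of_real r * cis (- \<theta>) * cis (- \<theta>) = w r" by (simp add: mult.assoc cis_mult w_def)
        ultimately show ?thesis using elim by (simp add: jacobi_R_def R_def del: of_real_diff)
      qed
      moreover have "complex_of_real (sqrt (1 - r)) \<noteq> 0" using elim by simp
      ultimately show ?case unfolding jacobi_gen_def V_def by (simp add: R_def)
    qed
  qed
qed

text \<open>The recurrence bound and the initial values are controlled independently of the angle,
  and variation of constants sees \<open>\<theta>\<close> only through \<open>s0\<close>; hence one
  constant serves all these angles.\<close>

lemma jacobi_darboux: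
  fixes \<alpha> \<beta> s0 :: real
  assumes "\<alpha> \<ge> 0" "\<beta> \<ge> 0" "s0 > 0"
  shows "\<exists>C\<ge>0. \<forall>\<theta> n. 0 < \<theta> \<longrightarrow> \<theta> < pi \<longrightarrow> sin \<theta> \<ge> s0 \<longrightarrow>
    \<bar>jacobi_poly n \<alpha> \<beta> (cos \<theta>) / half_coeff n -
      2 * darboux_amplitude \<alpha> \<beta> \<theta> * cos (real n * \<theta> + darboux_phase \<alpha> \<beta> \<theta>)\<bar> \<le> C / real (Suc n)"
proof -
  obtain C where C: "C > 0" "\<And>m x. \<bar>x\<bar> \<le> 1 \<Longrightarrow>
    \<bar>jacobi_poly (Suc (Suc m)) \<alpha> \<beta> x / half_coeff (Suc (Suc m)) - 2 * x * (jacobi_poly (Suc m) \<alpha> \<beta> x / half_coeff (Suc m)) +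
      jacobi_poly m \<alpha> \<beta> x / half_coeff m\<bar> \<le>
    C / (real (Suc m))\<^sup>2 * (\<bar>jacobi_poly (Suc m) \<alpha> \<beta> x / half_coeff (Suc m)\<bar> + \<bar>jacobi_poly m \<alpha> \<beta> x / half_coeff m\<bar>)"
    using jacobi_normalized_recurrence[OF assms(1,2)] by blast
  define D where "D = C * (1 + 2 / s0)"
  \<comment> \<open>Bounds the two initial values: \<open>y 0\<close> is 1, and division by
    \<open>half_coeff 1 = 1/2\<close> doubles the linear polynomial.\<close>
  define B where "B = 2 * (\<bar>jac_coeff \<alpha> \<beta> 1 0\<bar> + \<bar>jac_coeff \<alpha> \<beta> 1 1\<bar>) + 1"
  define Q where "Q = 2 * (D * exp (2 * D) * B)"
  have D0: "D \<ge> 0" using C assms by (simp add: D_def)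
  have Q0: "Q \<ge> 0" using D0 by (simp add: Q_def B_def)
  have "\<bar>jacobi_poly n \<alpha> \<beta> (cos \<theta>) / half_coeff n -
      2 * darboux_amplitude \<alpha> \<beta> \<theta> * cos (real n * \<theta> + darboux_phase \<alpha> \<beta> \<theta>)\<bar> \<le> Q / s0 / real (Suc n)"
    if \<theta>: "0 < \<theta>" "\<theta> < pi" "sin \<theta> \<ge> s0" for \<theta> n
  proof -
    define x where "x = cos \<theta>"
    define y where "y = (\<lambda>n. jacobi_poly n \<alpha> \<beta> x / half_coeff n)"
    define \<zeta> where "\<zeta> = (\<lambda>n. cis (- (real n * \<theta>)) * (of_real (y (Suc n)) - cis (- \<theta>) * of_real (y n)))"
    define M where "M = darboux_amplitude \<alpha> \<beta> \<theta>"
    define \<phi> where "\<phi> = darboux_phase \<alpha> \<beta> \<theta>"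
    have x: "\<bar>x\<bar> \<le> 1" by (simp add: x_def)
    have rec: "\<bar>y (Suc (Suc m)) - 2 * cos \<theta> * y (Suc m) + y m\<bar> \<le> C / (real (Suc m))\<^sup>2 * (\<bar>y (Suc m)\<bar> + \<bar>y m\<bar>)" for m
      using C(2)[OF x, of m] unfolding y_def x_def[symmetric] .
    have yIm: "sin \<theta> * y n = Im (cis (real n * \<theta>) * \<zeta> n)" for n
      unfolding \<zeta>_def by (rule perturbed_rotation(1)[OF less_imp_le[OF C(1)] assms(3) \<theta>(3) rec])
    obtain L where L: "\<And>n. cmod (\<zeta> n - L) \<le> 2 * (D * exp (2 * D) * (\<bar>y 1\<bar> + \<bar>y 0\<bar>)) / real (Suc n)"
      using perturbed_rotation(2)[OF less_imp_le[OF C(1)] assms(3) \<theta>(3) rec] unfolding \<zeta>_def D_def by blast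
    have yB: "\<bar>y 1\<bar> + \<bar>y 0\<bar> \<le> B"
    proof -
      have h1: "half_coeff 1 = 1 / 2" using half_coeff_Suc[of 0] by simp
      have "\<bar>(x - 1) / 2\<bar> \<le> 1" using x by (simp add: abs_le_iff)
      hence "\<bar>jac_coeff \<alpha> \<beta> 1 1\<bar> * \<bar>(x - 1) / 2\<bar> \<le> \<bar>jac_coeff \<alpha> \<beta> 1 1\<bar> * 1" by (intro mult_left_mono) auto
      hence "\<bar>jacobi_poly 1 \<alpha> \<beta> x\<bar> \<le> \<bar>jac_coeff \<alpha> \<beta> 1 0\<bar> + \<bar>jac_coeff \<alpha> \<beta> 1 1\<bar>"
        using abs_triangle_ineq[of "jac_coeff \<alpha> \<beta> 1 0" "jac_coeff \<alpha> \<beta> 1 1 * ((x - 1) / 2)"]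
        unfolding jacobi_poly_jac_coeff by (simp add: abs_mult)
      moreover have "y 0 = 1" by (simp add: y_def jacobi_poly_def)
      moreover have "y 1 = 2 * jacobi_poly 1 \<alpha> \<beta> x" unfolding y_def h1 by simp
      ultimately show ?thesis by (simp add: B_def)
    qed
    have LQ: "cmod (\<zeta> n - L) \<le> Q / real (Suc n)" for n
    proof -
      have "2 * (D * exp (2 * D) * (\<bar>y 1\<bar> + \<bar>y 0\<bar>)) \<le> Q"
        unfolding Q_def using D0 yB by (intro mult_left_mono) auto
      thus ?thesis using L[of n] by (meson divide_right_mono of_nat_0_le_iff order_trans)
    qed
    have G: "(\<lambda>n. of_real (half_coeff n * y n) * z ^ n) sums jacobi_gen \<alpha> \<beta> \<theta> z" if "cmod z < 1" for z
      using jacobi_generating_function[OF that, of \<alpha> \<beta> \<theta>] half_coeff_pos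
      by (simp add: y_def x_def order.strict_implies_not_eq[OF half_coeff_pos, symmetric])
    have L_eq: "L = 2 * \<i> * of_real (sin \<theta>) * (of_real M * cis \<phi>)"
      unfolding M_def \<phi>_def by (rule abel_amplitude[OF \<theta>(1,2) yIm LQ G jacobi_gen_radial_limit[OF \<theta>(1,2)]])
    have ImL: "Im (cis (real n * \<theta>) * L) = sin \<theta> * (2 * M * cos (real n * \<theta> + \<phi>))"
    proof -
      have "cis (real n * \<theta>) * L = of_real (2 * sin \<theta> * M) * (\<i> * (cis (real n * \<theta>) * cis \<phi>))" by (simp add: L_eq)
      thus ?thesis unfolding cis_mult by simp
    qed
    have "sin \<theta> * (y n - 2 * M * cos (real n * \<theta> + \<phi>)) = Im (cis (real n * \<theta>) * (\<zeta> n - L))"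
      by (simp only: right_diff_distrib yIm ImL minus_complex.sel)
    hence "sin \<theta> * \<bar>y n - 2 * M * cos (real n * \<theta> + \<phi>)\<bar> = \<bar>Im (cis (real n * \<theta>) * (\<zeta> n - L))\<bar>"
      using \<theta>(3) assms(3) by (metis abs_mult abs_of_pos less_le_trans)
    also have "\<dots> \<le> cmod (\<zeta> n - L)"
      using abs_Im_le_cmod[of "cis (real n * \<theta>) * (\<zeta> n - L)"] by (simp only: norm_mult norm_cis mult_1_left)
    also have "\<dots> \<le> Q / real (Suc n)" by (rule LQ)
    finally have "s0 * \<bar>y n - 2 * M * cos (real n * \<theta> + \<phi>)\<bar> \<le> Q / real (Suc n)"
      using mult_right_mono[OF \<theta>(3), of "\<bar>y n - 2 * M * cos (real n * \<theta> + \<phi>)\<bar>"] by linarith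
    hence "\<bar>y n - 2 * M * cos (real n * \<theta> + \<phi>)\<bar> \<le> Q / real (Suc n) / s0"
      by (simp only: pos_le_divide_eq[OF assms(3)] mult.commute)
    thus ?thesis by (simp add: y_def x_def M_def \<phi>_def divide_divide_eq_left mult.commute)
  qed
  thus ?thesis using Q0 assms(3) by (intro exI[of _ "Q / s0"]) auto
qed

section \<open>Normalizing weight and kernel asymptotics\<close>

lemma half_coeff_power2_le: "(half_coeff n)\<^sup>2 \<le> 1 / real (Suc n)"
proof -
  \<comment> \<open>This sharper bound is the one that propagates, because
    \<open>(2n + 1) * (2n + 3) \<le> (2n + 2)\<^sup>2\<close>.\<close>
  have "(half_coeff n)\<^sup>2 * (2 * real n + 1) \<le> 1"
  proof (induction n)
    case (Suc n)
    have "((2 * real n + 1) / (2 * real n + 2))\<^sup>2 * (2 * real (Suc n) + 1) \<le> 2 * real n + 1"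
    proof -
      have "(2 * real n + 1) * (2 * real n + 3) \<le> (2 * real n + 2)\<^sup>2" by (simp add: power2_eq_square algebra_simps)
      hence "(2 * real n + 1) * ((2 * real n + 1) * (2 * real n + 3)) \<le> (2 * real n + 1) * (2 * real n + 2)\<^sup>2"
        by (intro mult_left_mono) auto
      hence "(2 * real n + 1) * ((2 * real n + 1) * (2 * real n + 3)) / (2 * real n + 2)\<^sup>2 \<le> 2 * real n + 1"
        by (subst pos_divide_le_eq) auto
      thus ?thesis by (simp add: power_divide power2_eq_square mult_ac add_ac)
    qed
    hence "(half_coeff n)\<^sup>2 * (((2 * real n + 1) / (2 * real n + 2))\<^sup>2 * (2 * real (Suc n) + 1)) \<le> (half_coeff n)\<^sup>2 * (2 * real n + 1)"
      by (intro mult_left_mono) auto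
    thus ?case using Suc by (simp only: half_coeff_Suc power_mult_distrib mult.assoc)
  qed simp
  hence "(half_coeff n)\<^sup>2 \<le> 1 / (2 * real n + 1)" by (simp add: pos_le_divide_eq)
  also have "\<dots> \<le> 1 / real (Suc n)" by (intro divide_left_mono) auto
  finally show ?thesis .
qed

lemma abs_sqrt_diff_le:
  assumes "a \<ge> 0" "b > 0"
  shows "\<bar>sqrt a - sqrt b\<bar> \<le> \<bar>a - b\<bar> / sqrt b"
proof -
  have "\<bar>sqrt a - sqrt b\<bar> * sqrt b \<le> \<bar>sqrt a - sqrt b\<bar> * (sqrt a + sqrt b)"
    using assms by (intro mult_left_mono) auto
  also have "\<dots> = \<bar>(sqrt a - sqrt b) * (sqrt a + sqrt b)\<bar>" using assms by (simp add: abs_mult)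
  also have "(sqrt a - sqrt b) * (sqrt a + sqrt b) = a - b" using assms by (simp add: algebra_simps)
  finally show ?thesis using assms by (simp add: pos_le_divide_eq)
qed

text \<open>The sequence \<open>m\<close>, which is \<open>n\<close> times the squared weight,
  satisfies a first order recursion with rational factors whose increments are of order 1/n^2.
  Telescoping gives a limit with rate, and Euler's limit, which has no rate, supplies its value
  1/pi.\<close>

lemma jacobi_weight_asymptotics:
  fixes \<alpha> \<beta> :: real
  assumes \<alpha>: "\<alpha> \<ge> 0" and \<beta>: "\<beta> \<ge> 0"
  defines "w \<equiv> (\<lambda>n. sqrt (Gamma (real n + 1) * Gamma (real n + \<alpha> + \<beta> + 1) /
     (Gamma (real n + \<alpha> + 1) * Gamma (real n + \<beta> + 1))) * half_coeff n)"
  shows "\<exists>C\<ge>0. \<forall>n\<ge>1. \<bar>w n - 1 / sqrt (pi * real n)\<bar> \<le> C * real n powr (- 3 / 2)"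
proof -
  define \<sigma> where "\<sigma> = \<alpha> + \<beta>"
  define q where "q = (\<lambda>n. Gamma (real n + 1) * Gamma (real n + \<sigma> + 1) / (Gamma (real n + \<alpha> + 1) * Gamma (real n + \<beta> + 1)))"
  define m where "m = (\<lambda>n. real n * (q n * (half_coeff n)\<^sup>2))"
  have G: "Gamma (real n + a + 1) > 0" if "a \<ge> 0" for n a using that by (intro Gamma_real_pos) auto
  have GS: "Gamma (real (Suc n) + a + 1) = (real (Suc n) + a) * Gamma (real n + a + 1)" if "a \<ge> 0" for n a
  proof -
    have "real n + a + 1 \<notin> \<int>\<^sub>\<le>\<^sub>0" using that by (auto elim!: nonpos_Ints_cases)
    from Gamma_plus1[OF this] show ?thesis by (simp add: algebra_simps)
  qed
  have G0: "Gamma (real n + 1) > 0" for n using G[of 0 n] by simp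
  have \<sigma>: "\<sigma> \<ge> 0" using \<alpha> \<beta> by (simp add: \<sigma>_def)
  have q_pos: "q n > 0" for n unfolding q_def using G G0 \<alpha> \<beta> \<sigma> by (intro divide_pos_pos mult_pos_pos) auto
  have q_Suc: "q (Suc n) = q n * (real (Suc n) * (real (Suc n) + \<sigma>) / ((real (Suc n) + \<alpha>) * (real (Suc n) + \<beta>)))" for n
    unfolding q_def GS[OF \<alpha>] GS[OF \<beta>] GS[OF \<sigma>] using GS[of 0 n] by (simp add: mult_ac add_ac)
  have q_le: "q n \<le> q 0" for n
  proof (induction n)
    case (Suc n)
    have "real (Suc n) * (real (Suc n) + \<sigma>) \<le> (real (Suc n) + \<alpha>) * (real (Suc n) + \<beta>)"
      using \<alpha> \<beta> by (simp add: \<sigma>_def algebra_simps)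
    hence "real (Suc n) * (real (Suc n) + \<sigma>) / ((real (Suc n) + \<alpha>) * (real (Suc n) + \<beta>)) \<le> 1"
      using \<alpha> \<beta> by (subst divide_le_eq_1_pos) (auto intro!: mult_pos_pos)
    hence "q (Suc n) \<le> q n * 1" unfolding q_Suc using q_pos[of n] by (intro mult_left_mono) auto
    thus ?case using Suc by simp
  qed simp
  \<comment> \<open>\<open>c * N\<close> bounds the numerator of the increment, in which all terms
    above first order in \<open>N\<close> cancel.\<close>
  define c where "c = 1 + \<sigma> + 8 * (\<alpha> * \<beta>)"
  define K where "K = q 0 * c"
  have c0: "c \<ge> 0" using \<alpha> \<beta> \<sigma> by (simp add: c_def)
  have K0: "K \<ge> 0" using q_pos[of 0] c0 by (simp add: K_def)
  have "norm (m (Suc n) - m n) \<le> K / (real (Suc n))\<^sup>2" for n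
  proof -
    define N where "N = real (Suc n)"
    have N: "N \<ge> 1" "real n = N - 1" by (simp_all add: N_def)
    define D where "D = 4 * ((N + \<alpha>) * (N + \<beta>))"
    have D: "D > 0" using N \<alpha> \<beta> by (simp add: D_def)
    have DN: "4 * N\<^sup>2 \<le> D"
      using mult_mono[of N "N + \<alpha>" N "N + \<beta>"] N \<alpha> \<beta> by (simp add: D_def power2_eq_square)
    define X where "X = (N + \<sigma>) * (2 * N - 1)\<^sup>2 / D"
    have mS: "m (Suc n) = q n * (half_coeff n)\<^sup>2 * X"
    proof -
      have h: "half_coeff (Suc n) = half_coeff n * ((2 * N - 1) / (2 * N))"
      proof -
        have "2 * real n + 1 = 2 * N - 1" "2 * real n + 2 = 2 * N" by (simp_all add: N_def)
        thus ?thesis by (simp only: half_coeff_Suc)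
      qed
      have cancel: "N * (N * B / (A1 * A2) * (A3 / (2 * N))\<^sup>2) = B * A3\<^sup>2 / (4 * (A1 * A2))" for B A1 A2 A3
        using N by (simp add: power_divide power2_eq_square)
      have "m (Suc n) = q n * (half_coeff n)\<^sup>2 * (N * (N * (N + \<sigma>) / ((N + \<alpha>) * (N + \<beta>)) * ((2 * N - 1) / (2 * N))\<^sup>2))"
        unfolding m_def q_Suc h N_def[symmetric] power_mult_distrib by (simp only: mult_ac)
      thus ?thesis unfolding cancel X_def D_def .
    qed
    have "m (Suc n) - m n = q n * (half_coeff n)\<^sup>2 * (X - (N - 1))"
      unfolding mS by (simp add: m_def N(2) algebra_simps)
    also have "X - (N - 1) = (N * (1 - 4 * (\<alpha> * \<beta>)) + \<sigma> + 4 * (\<alpha> * \<beta>)) / D"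
    proof -
      have "(N + \<sigma>) * (2 * N - 1)\<^sup>2 - (N - 1) * D = N * (1 - 4 * (\<alpha> * \<beta>)) + \<sigma> + 4 * (\<alpha> * \<beta>)"
        by (simp add: D_def \<sigma>_def power2_eq_square algebra_simps)
      moreover have "X - (N - 1) = ((N + \<sigma>) * (2 * N - 1)\<^sup>2 - (N - 1) * D) / D"
        using D by (simp add: X_def diff_divide_distrib)
      ultimately show ?thesis by simp
    qed
    finally have "\<bar>m (Suc n) - m n\<bar> = q n * (half_coeff n)\<^sup>2 * (\<bar>N * (1 - 4 * (\<alpha> * \<beta>)) + \<sigma> + 4 * (\<alpha> * \<beta>)\<bar> / D)"
      using q_pos[of n] D by (simp add: abs_mult)
    also have "\<dots> \<le> q 0 * (1 / N) * (c * N / (4 * N\<^sup>2))"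
    proof (intro mult_mono q_le frac_le)
      show "(half_coeff n)\<^sup>2 \<le> 1 / N" unfolding N_def by (rule half_coeff_power2_le)
      have ab: "\<alpha> * \<beta> \<ge> 0" using \<alpha> \<beta> by simp
      have "\<bar>N * (1 - 4 * (\<alpha> * \<beta>)) + \<sigma> + 4 * (\<alpha> * \<beta>)\<bar> \<le> N + 4 * (N * (\<alpha> * \<beta>)) + \<sigma> + 4 * (\<alpha> * \<beta>)"
      proof -
        have "N * (1 - 4 * (\<alpha> * \<beta>)) = N - 4 * (N * (\<alpha> * \<beta>))" by (simp add: algebra_simps)
        moreover have "N * (\<alpha> * \<beta>) \<ge> 0" using N by (intro mult_nonneg_nonneg[OF _ ab]) auto
        ultimately show ?thesis using N ab \<sigma> by (intro abs_leI) linarith+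
      qed
      also have "\<dots> \<le> c * N"
      proof -
        have "\<sigma> \<le> \<sigma> * N" "\<alpha> * \<beta> \<le> \<alpha> * \<beta> * N" using N \<sigma> ab by (simp_all add: mult_le_cancel_left1)
        moreover have "c * N = N + \<sigma> * N + 8 * (\<alpha> * \<beta> * N)" by (simp add: c_def algebra_simps)
        ultimately show ?thesis unfolding mult.commute[of N "\<alpha> * \<beta>"] by linarith
      qed
      finally show "\<bar>N * (1 - 4 * (\<alpha> * \<beta>)) + \<sigma> + 4 * (\<alpha> * \<beta>)\<bar> \<le> c * N" .
    qed (use N DN q_pos[of 0] c0 D in \<open>auto intro: less_imp_le\<close>)
    also have "\<dots> = K / (4 * N\<^sup>2)" using N by (simp add: K_def power2_eq_square)
    also have "\<dots> \<le> K / N\<^sup>2" using N K0 by (intro divide_left_mono) auto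
    finally show ?thesis unfolding N_def by simp
  qed
  from telescoping_limit[OF this K0] obtain L where L: "m \<longlonglongrightarrow> L" "\<And>n. norm (m n - L) \<le> 2 * K / real (Suc n)"
    by blast
  \<comment> \<open>Instances at \<open>\<sigma>\<close>, \<open>\<alpha>\<close> and
    \<open>\<beta>\<close> give the Gamma quotient, since their powers of \<open>n\<close> cancel;
    the instance at -1/2 gives \<open>half_coeff\<close>, with
    \<open>Gamma (1/2) = sqrt pi\<close>.\<close>
  define S where "S = (\<lambda>a n. Gamma (real n + a + 1) / (fact n * real n powr a))"
  have S: "S a \<longlonglongrightarrow> 1" if "a > -1" for a unfolding S_def by (rule Gamma_ratio_tendsto[OF that])
  have "(\<lambda>n. S \<sigma> n / (S \<alpha> n * S \<beta> n) * ((S (- 1 / 2) n)\<^sup>2 / pi)) \<longlonglongrightarrow> 1 / (1 * 1) * (1\<^sup>2 / pi)"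
    using \<alpha> \<beta> \<sigma> by (intro tendsto_intros S) auto
  hence "(\<lambda>n. S \<sigma> n / (S \<alpha> n * S \<beta> n) * ((S (- 1 / 2) n)\<^sup>2 / pi)) \<longlonglongrightarrow> 1 / pi" by simp
  moreover have "eventually (\<lambda>n. S \<sigma> n / (S \<alpha> n * S \<beta> n) * ((S (- 1 / 2) n)\<^sup>2 / pi) = m n) sequentially"
    using eventually_gt_at_top[of 0]
  proof eventually_elim
    case (elim n)
    define N where "N = real n"
    have N: "N > 0" using elim by (simp add: N_def)
    have "Gamma (N + 1) = fact n" using Gamma_fact[of n, where ?'a = real] by (simp add: N_def add.commute)
    moreover have "N powr \<sigma> = N powr \<alpha> * N powr \<beta>" by (simp add: \<sigma>_def powr_add)
    ultimately have 1: "S \<sigma> n / (S \<alpha> n * S \<beta> n) = q n"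
      using N G[OF \<alpha>, of n] G[OF \<beta>, of n] by (simp add: S_def q_def N_def[symmetric])
    have "half_coeff n = Gamma (N + 1 / 2) / (sqrt pi * fact n)"
    proof -
      have "pochhammer (1 / 2) n = Gamma (1 / 2 + of_nat n) / Gamma (1 / 2 :: real)"
        by (rule pochhammer_Gamma) (auto elim!: nonpos_Ints_cases)
      hence "half_coeff n = Gamma (1 / 2 + real n) / (sqrt pi * fact n)"
        by (simp add: half_coeff_def Gamma_one_half_real)
      also have "1 / 2 + real n = N + 1 / 2" by (simp add: N_def)
      finally show ?thesis .
    qed
    moreover have "S (- 1 / 2) n = Gamma (N + 1 / 2) / (fact n * N powr (- 1 / 2))"
    proof -
      have "real n + - 1 / 2 + 1 = N + 1 / 2" by (simp add: N_def)
      thus ?thesis by (simp only: S_def N_def)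
    qed
    moreover have "N powr (- 1 / 2) = 1 / sqrt N" using N by (simp add: powr_minus_divide powr_half_sqrt)
    ultimately have "(S (- 1 / 2) n)\<^sup>2 / pi = N * (half_coeff n)\<^sup>2"
      using N by (simp add: power_divide power_mult_distrib mult_ac)
    thus ?case unfolding 1 by (simp add: m_def N_def)
  qed
  ultimately have "m \<longlonglongrightarrow> 1 / pi" by (rule Lim_transform_eventually)
  hence L_eq: "L = 1 / pi" using L(1) LIMSEQ_unique by blast
  have "\<bar>w n - 1 / sqrt (pi * real n)\<bar> \<le> 2 * K * sqrt pi * real n powr (- 3 / 2)" if n: "n \<ge> 1" for n
  proof -
    define N where "N = real n"
    have N: "N \<ge> 1" using n by (simp add: N_def)
    have m0: "m n \<ge> 0" using q_pos[of n] by (simp add: m_def)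
    have "w n = sqrt (q n) * half_coeff n" by (simp add: w_def q_def \<sigma>_def add.assoc)
    also have "\<dots> = sqrt (q n * (half_coeff n)\<^sup>2)" using half_coeff_pos[of n] by (simp add: real_sqrt_mult)
    also have "q n * (half_coeff n)\<^sup>2 = m n / N" using N by (simp add: m_def N_def)
    finally have w: "w n = sqrt (m n) / sqrt N" by (simp add: real_sqrt_divide)
    have v: "1 / sqrt (pi * N) = sqrt (1 / pi) / sqrt N" by (simp add: real_sqrt_mult real_sqrt_divide)
    have "w n - 1 / sqrt (pi * N) = (sqrt (m n) - sqrt (1 / pi)) / sqrt N"
      unfolding w v by (simp add: diff_divide_distrib)
    hence "\<bar>w n - 1 / sqrt (pi * N)\<bar> = \<bar>sqrt (m n) - sqrt (1 / pi)\<bar> / sqrt N" using N by simp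
    also have "\<dots> \<le> (\<bar>m n - 1 / pi\<bar> / sqrt (1 / pi)) / sqrt N"
      using N by (intro divide_right_mono abs_sqrt_diff_le m0) auto
    also have "\<bar>m n - 1 / pi\<bar> / sqrt (1 / pi) = \<bar>m n - 1 / pi\<bar> * sqrt pi" by (simp add: real_sqrt_divide)
    also have "\<dots> / sqrt N \<le> (2 * K / N) * sqrt pi / sqrt N"
    proof (intro divide_right_mono mult_right_mono)
      have "\<bar>m n - 1 / pi\<bar> \<le> 2 * K / real (Suc n)" using L(2)[of n] by (simp add: L_eq)
      also have "\<dots> \<le> 2 * K / N" using N K0 by (intro divide_left_mono) (auto simp: N_def)
      finally show "\<bar>m n - 1 / pi\<bar> \<le> 2 * K / N" .
    qed (use N in auto)
    also have "\<dots> = 2 * K * sqrt pi * (1 / (N * sqrt N))" by simp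
    also have "1 / (N * sqrt N) = N powr (- 3 / 2)"
    proof -
      have "N powr (- 3 / 2) = 1 / N powr (1 + 1 / 2)" by (simp add: powr_minus_divide)
      also have "N powr (1 + 1 / 2) = N * sqrt N" using N unfolding powr_add by (simp add: powr_half_sqrt)
      finally show ?thesis by simp
    qed
    finally show ?thesis unfolding N_def .
  qed
  thus ?thesis using K0 by (intro exI[of _ "2 * K * sqrt pi"]) auto
qed

lemma theta_of_facts:
  assumes "t \<noteq> 0"
  shows "0 < theta_of t" "theta_of t < pi" "cos (theta_of t) = x_of t"
    "sin (theta_of t / 2) = 1 / sqrt (1 + t\<^sup>2)" "cos (theta_of t / 2) = \<bar>t\<bar> / sqrt (1 + t\<^sup>2)"
    "sin (theta_of t) = 2 * \<bar>t\<bar> / (1 + t\<^sup>2)"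
proof -
  define T where "T = 1 + t\<^sup>2"
  have T: "T > 0" "T > 1" "t\<^sup>2 > 0" using assms by (auto simp: T_def add_pos_pos)
  have h: "(1 - x_of t) / 2 = 1 / T" "(1 + x_of t) / 2 = t\<^sup>2 / T" unfolding T_def by (rule x_of_half)+
  have x: "-1 < x_of t" "x_of t < 1"
  proof -
    have "(1 - x_of t) / 2 > 0" "(1 + x_of t) / 2 > 0" unfolding h using T by simp_all
    thus "-1 < x_of t" "x_of t < 1" by simp_all
  qed
  show b: "0 < theta_of t" "theta_of t < pi" unfolding theta_of_def using arccos_lt_bounded[OF x] by auto
  show c: "cos (theta_of t) = x_of t" unfolding theta_of_def using x by (intro cos_arccos) auto
  define s k where "s = sin (theta_of t / 2)" and "k = cos (theta_of t / 2)"
  have sk: "s > 0" "k > 0" using b by (auto simp: s_def k_def intro!: sin_gt_zero cos_gt_zero)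
  have "s\<^sup>2 = 1 / T" using cos_double_sin[of "theta_of t / 2"] h(1) by (simp add: s_def c)
  hence "s = sqrt (1 / T)" using sk by (simp add: real_sqrt_unique)
  thus s: "sin (theta_of t / 2) = 1 / sqrt (1 + t\<^sup>2)" by (simp add: s_def T_def real_sqrt_divide)
  have "k\<^sup>2 = t\<^sup>2 / T" using cos_double_cos[of "theta_of t / 2"] h(2) by (simp add: k_def c)
  hence "k = sqrt (t\<^sup>2 / T)" using sk by (simp add: real_sqrt_unique)
  thus k: "cos (theta_of t / 2) = \<bar>t\<bar> / sqrt (1 + t\<^sup>2)" by (simp add: k_def T_def real_sqrt_divide)
  have "sin (theta_of t) = 2 * (1 / sqrt T) * (\<bar>t\<bar> / sqrt T)"
    using sin_double[of "theta_of t / 2"] unfolding s k T_def by simp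
  thus "sin (theta_of t) = 2 * \<bar>t\<bar> / (1 + t\<^sup>2)" using T by (simp flip: T_def)
qed

text \<open>On a compact set without 0, \<open>\<bar>t\<bar>\<close> is bounded above and below,
  hence \<open>sin (theta_of t) = 2 * \<bar>t\<bar> / (1 + t\<^sup>2)\<close> is bounded below and
  \<open>jacobi_darboux\<close> applies with a single constant.\<close>

lemma laguerre_kernel_darboux:
  fixes \<alpha> :: real and d :: nat
  assumes \<alpha>: "\<alpha> \<ge> 0" and S: "compact S" "S \<subseteq> UNIV - {0}"
  shows "\<exists>C. \<forall>n\<ge>1. \<forall>t\<in>S. \<bar>laguerre_kernel \<alpha> t n (n + d) -
    \<bar>cos (real n * theta_of t + darboux_phase \<alpha> (real d) (theta_of t))\<bar> / sqrt (pi * real n * \<bar>t\<bar>)\<bar> \<le> C * real n powr (- 3 / 2)"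
proof -
  have "closed S" "0 \<notin> S" using S compact_imp_closed by auto
  then obtain \<delta> where \<delta>: "\<delta> > 0" "\<And>t. t \<in> S \<Longrightarrow> \<delta> \<le> \<bar>t\<bar>"
    using separate_point_closed[of S 0] by (auto simp: dist_real_def)
  obtain T where T: "\<And>t. t \<in> S \<Longrightarrow> \<bar>t\<bar> \<le> T"
    using compact_imp_bounded[OF S(1)] by (auto simp: bounded_iff)
  define s0 where "s0 = 2 * \<delta> / (1 + T\<^sup>2)"
  have s0: "s0 > 0" using \<delta>(1) by (simp add: s0_def add_pos_nonneg)
  obtain C1 where C1: "C1 \<ge> 0" "\<And>\<theta> n. 0 < \<theta> \<Longrightarrow> \<theta> < pi \<Longrightarrow> sin \<theta> \<ge> s0 \<Longrightarrow>
    \<bar>jacobi_poly n \<alpha> (real d) (cos \<theta>) / half_coeff n -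
      2 * darboux_amplitude \<alpha> (real d) \<theta> * cos (real n * \<theta> + darboux_phase \<alpha> (real d) \<theta>)\<bar> \<le> C1 / real (Suc n)"
    using jacobi_darboux[OF \<alpha> of_nat_0_le_iff s0, of d] by blast
  define w where "w = (\<lambda>n. sqrt (Gamma (real n + 1) * Gamma (real n + \<alpha> + real d + 1) /
     (Gamma (real n + \<alpha> + 1) * Gamma (real n + real d + 1))) * half_coeff n)"
  obtain C2 where C2: "C2 \<ge> 0" "\<And>n. n \<ge> 1 \<Longrightarrow> \<bar>w n - 1 / sqrt (pi * real n)\<bar> \<le> C2 * real n powr (- 3 / 2)"
    using jacobi_weight_asymptotics[OF \<alpha> of_nat_0_le_iff, of d] unfolding w_def by blast
  \<comment> \<open>The first summand pays for replacing the weight by its limit, the second for the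
    polynomial remainder multiplied by the weight.\<close>
  define C where "C = C2 / sqrt \<delta> + (1 + C2) * C1"
  have "\<bar>laguerre_kernel \<alpha> t n (n + d) -
    \<bar>cos (real n * theta_of t + darboux_phase \<alpha> (real d) (theta_of t))\<bar> / sqrt (pi * real n * \<bar>t\<bar>)\<bar> \<le> C * real n powr (- 3 / 2)"
    if n: "n \<ge> 1" and t: "t \<in> S" for n t
  proof -
    have t0: "t \<noteq> 0" using t S(2) by auto
    note th = theta_of_facts[OF t0]
    define \<theta> where "\<theta> = theta_of t"
    define N where "N = real n"
    have N: "N \<ge> 1" using n by (simp add: N_def)
    define s k where "s = sin (\<theta> / 2)" and "k = cos (\<theta> / 2)"
    have D: "1 + t\<^sup>2 > 0" "1 + t\<^sup>2 \<ge> 1" by (auto simp: add_pos_nonneg)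
    have inv_le: "1 / q > 0 \<and> 1 / q \<le> 1" if "q \<ge> 1" for q :: real using that by (simp add: divide_le_eq)
    have s1: "s = 1 / sqrt (1 + t\<^sup>2)" using th(4) by (simp add: s_def \<theta>_def)
    have "1 \<le> sqrt (1 + t\<^sup>2)" by simp
    from inv_le[OF this] s1 have s: "s = 1 / sqrt (1 + t\<^sup>2)" "s > 0" "s \<le> 1" by simp_all
    have k: "k = s * \<bar>t\<bar>" "k > 0" "k \<le> 1"
    proof -
      show "k = s * \<bar>t\<bar>" by (simp add: k_def s_def \<theta>_def th(4,5))
      show "k > 0" unfolding k_def \<theta>_def using th(1,2) by (intro cos_gt_zero_pi) auto
      show "k \<le> 1" unfolding k_def by (rule cos_le_one)
    qed
    have s2: "(1 - x_of t) / 2 = s\<^sup>2" "(1 + x_of t) / 2 = k\<^sup>2"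
      unfolding x_of_half k s(1) using D by (simp_all add: power_divide power_mult_distrib)
    have sin\<theta>: "sin \<theta> \<ge> s0"
    proof -
      have "t\<^sup>2 \<le> T\<^sup>2" using T[OF t] by (metis abs_ge_zero power2_abs power_mono)
      hence "2 * \<delta> / (1 + T\<^sup>2) \<le> 2 * \<bar>t\<bar> / (1 + t\<^sup>2)"
        using \<delta>(2)[OF t] \<delta>(1) by (intro frac_le D) auto
      thus ?thesis unfolding s0_def \<theta>_def th(6) .
    qed
    define \<Phi> where "\<Phi> = N * \<theta> + darboux_phase \<alpha> (real d) \<theta>"
    define M where "M = darboux_amplitude \<alpha> (real d) \<theta>"
    define r where "r = jacobi_poly n \<alpha> (real d) (x_of t) / half_coeff n - 2 * M * cos \<Phi>"
    have r: "\<bar>r\<bar> \<le> C1 / N"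
    proof -
      have "\<bar>r\<bar> \<le> C1 / real (Suc n)"
        using C1(2)[of \<theta> n] th(1,2,3) sin\<theta> unfolding r_def M_def \<Phi>_def N_def \<theta>_def by simp
      also have "\<dots> \<le> C1 / N" using N C1(1) by (intro divide_left_mono) (auto simp: N_def)
      finally show ?thesis .
    qed
    define \<rho> where "\<rho> = s * (s powr \<alpha> * k powr real d) * r"
    have \<rho>: "\<bar>\<rho>\<bar> \<le> C1 / N"
    proof -
      have "s powr \<alpha> \<le> 1" "k powr real d \<le> 1" using s k \<alpha> by (auto intro!: powr_le1)
      hence "s * (s powr \<alpha> * k powr real d) \<le> 1 * (1 * 1)" using s k by (intro mult_mono) auto
      hence "\<bar>\<rho>\<bar> \<le> 1 * \<bar>r\<bar>" unfolding \<rho>_def abs_mult using s k by (intro mult_right_mono) auto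
      thus ?thesis using r by simp
    qed
    \<comment> \<open>The Jacobi weight and the kernel factor \<open>s\<close> cancel the half-angle
      powers in the amplitude; as \<open>2 * sin \<theta> = (2 * s)\<^sup>2 * \<bar>t\<bar>\<close>,
      only \<open>1 / sqrt \<bar>t\<bar>\<close> is left.\<close>
    have amp: "s * (s powr \<alpha> * k powr real d) * (2 * M) = 1 / sqrt \<bar>t\<bar>"
    proof -
      have "2 * sin \<theta> = (2 * s)\<^sup>2 * \<bar>t\<bar>"
        unfolding \<theta>_def th(6) s(1) using D by (simp add: power_divide power_mult_distrib)
      hence "sqrt (2 * sin \<theta>) = 2 * s * sqrt \<bar>t\<bar>" using s by (simp add: real_sqrt_mult)
      moreover have "(2 * sin \<theta>) powr (- 1 / 2) = 1 / sqrt (2 * sin \<theta>)"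
        using sin\<theta> s0 by (simp add: powr_minus_divide powr_half_sqrt)
      ultimately have "M = s powr (- \<alpha>) * k powr (- real d) * (1 / (2 * s * sqrt \<bar>t\<bar>))"
        by (simp add: M_def darboux_amplitude_def s_def k_def)
      thus ?thesis using s k t0 by (simp add: powr_minus_divide)
    qed
    define A where "A = cos \<Phi> / sqrt \<bar>t\<bar>"
    have "jacobi_fun n \<alpha> (real d) (x_of t) = w n * (s powr \<alpha> * k powr real d) * (2 * M * cos \<Phi> + r)"
    proof -
      have "rpow (y\<^sup>2) (a / 2) = y powr a" if "y > 0" for y a :: real
        using that by (simp add: rpow_eq_powr powr_powr flip: powr_numeral)
      from this[OF s(2)] this[OF k(2)]
      have "rpow (s\<^sup>2) (\<alpha> / 2) = s powr \<alpha>" "rpow (k\<^sup>2) (real d / 2) = k powr real d" .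
      moreover have "jacobi_poly n \<alpha> (real d) (x_of t) = half_coeff n * (2 * M * cos \<Phi> + r)"
        using half_coeff_pos[of n] by (simp add: r_def)
      ultimately show ?thesis unfolding jacobi_fun_def s2 w_def by simp
    qed
    hence "jacobi_fun n \<alpha> (real d) (x_of t) * s = w n * ((s * (s powr \<alpha> * k powr real d) * (2 * M)) * cos \<Phi> + \<rho>)"
      by (simp add: \<rho>_def algebra_simps)
    hence "jacobi_fun n \<alpha> (real d) (x_of t) * s = w n * (A + \<rho>)" unfolding amp by (simp add: A_def)
    moreover have w0: "w n \<ge> 0" using half_coeff_pos[of n] \<alpha> by (auto simp: w_def intro!: mult_nonneg_nonneg divide_nonneg_nonneg Gamma_real_nonneg less_imp_le)
    moreover have "laguerre_kernel \<alpha> t n (n + d) = \<bar>jacobi_fun n \<alpha> (real d) (x_of t) * s\<bar>"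
      unfolding laguerre_kernel_jacobi[OF \<alpha> t0] abs_mult using s by simp
    ultimately have K: "laguerre_kernel \<alpha> t n (n + d) = w n * \<bar>A + \<rho>\<bar>" by (simp add: abs_mult)
    define v where "v = 1 / sqrt (pi * N)"
    have target: "\<bar>cos \<Phi>\<bar> / sqrt (pi * N * \<bar>t\<bar>) = v * \<bar>A\<bar>"
      by (simp add: v_def A_def real_sqrt_mult)
    have A: "\<bar>A\<bar> \<le> 1 / sqrt \<delta>"
      unfolding A_def abs_divide using \<delta>(1) \<delta>(2)[OF t] by (intro frac_le) auto
    have wv: "\<bar>w n - v\<bar> \<le> C2 * N powr (- 3 / 2)" using C2(2)[OF n] by (simp add: v_def N_def)
    have Npow: "N powr (- 3 / 2) = N powr (- 1 / 2) * (1 / N)"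
    proof -
      have "N powr (- 3 / 2) = N powr (- 1 / 2 + - 1)" by simp
      also have "\<dots> = N powr (- 1 / 2) * N powr (- 1)" by (rule powr_add)
      also have "N powr (- 1) = 1 / N" using N by (simp add: powr_minus_divide)
      finally show ?thesis .
    qed
    have w_le: "w n \<le> (1 + C2) * N powr (- 1 / 2)"
    proof -
      have "v \<le> N powr (- 1 / 2)"
      proof -
        have "N \<le> pi * N" using N pi_ge_two by (simp add: mult_le_cancel_right1)
        hence "v \<le> 1 / sqrt N" unfolding v_def using N by (intro divide_left_mono) auto
        thus ?thesis using N by (simp add: powr_minus_divide powr_half_sqrt)
      qed
      moreover have "C2 * N powr (- 3 / 2) \<le> C2 * N powr (- 1 / 2)"
        using N C2(1) by (intro mult_left_mono powr_mono) auto
      moreover have "w n \<le> v + \<bar>w n - v\<bar>" by simp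
      ultimately show ?thesis using wv by (simp add: distrib_right)
    qed
    \<comment> \<open>The modulus is 1-Lipschitz, so zeros of the cosine do no harm to the error
      bound.\<close>
    have "laguerre_kernel \<alpha> t n (n + d) - \<bar>cos \<Phi>\<bar> / sqrt (pi * N * \<bar>t\<bar>) = w n * (\<bar>A + \<rho>\<bar> - \<bar>A\<bar>) + (w n - v) * \<bar>A\<bar>"
      unfolding K target by (simp add: algebra_simps)
    also have "\<bar>\<dots>\<bar> \<le> w n * \<bar>\<bar>A + \<rho>\<bar> - \<bar>A\<bar>\<bar> + \<bar>w n - v\<bar> * \<bar>A\<bar>"
      using abs_triangle_ineq[of "w n * (\<bar>A + \<rho>\<bar> - \<bar>A\<bar>)" "(w n - v) * \<bar>A\<bar>"] w0 by (simp add: abs_mult)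
    also have "\<dots> \<le> ((1 + C2) * N powr (- 1 / 2)) * (C1 / N) + (C2 * N powr (- 3 / 2)) * (1 / sqrt \<delta>)"
    proof (intro add_mono mult_mono w_le wv A)
      have "\<bar>\<bar>A + \<rho>\<bar> - \<bar>A\<bar>\<bar> \<le> \<bar>\<rho>\<bar>" using abs_triangle_ineq3[of "A + \<rho>" A] by simp
      thus "\<bar>\<bar>A + \<rho>\<bar> - \<bar>A\<bar>\<bar> \<le> C1 / N" using \<rho> by linarith
    qed (use C2(1) in auto)
    also have "\<dots> = C * N powr (- 3 / 2)" unfolding Npow C_def by (simp add: algebra_simps add_divide_distrib)
    finally show ?thesis unfolding \<Phi>_def N_def \<theta>_def .
  qed
  thus ?thesis by blast
qed

section \<open>Assembly of the three regimes\<close>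

lemma abs_over_sqrt_tendsto:
  assumes "filterlim (\<lambda>j. \<bar>t j\<bar>) at_top F"
  shows "((\<lambda>j. \<bar>t j\<bar> / sqrt (1 + (t j)\<^sup>2)) \<longlongrightarrow> 1) F"
proof -
  have "filterlim (\<lambda>j. \<bar>t j\<bar>\<^sup>2) at_top F" by (intro filterlim_pow_at_top assms) auto
  hence "filterlim (\<lambda>j. 1 + (t j)\<^sup>2) at_top F"
    by (intro filterlim_tendsto_add_at_top[OF tendsto_const]) simp
  hence "((\<lambda>j. sqrt (1 - 1 / (1 + (t j)\<^sup>2))) \<longlongrightarrow> sqrt (1 - 0)) F"
    by (intro tendsto_intros real_tendsto_divide_at_top[OF tendsto_const])
  moreover have "sqrt (1 - 1 / (1 + s\<^sup>2)) = \<bar>s\<bar> / sqrt (1 + s\<^sup>2)" for s :: real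
  proof -
    have "1 + s\<^sup>2 > 0" by (simp add: add_pos_nonneg)
    hence "1 - 1 / (1 + s\<^sup>2) = s\<^sup>2 / (1 + s\<^sup>2)" by (simp add: field_simps)
    thus ?thesis by (simp add: real_sqrt_divide)
  qed
  ultimately show ?thesis by simp
qed

lemma laguerre_kernel_tendsto:
  assumes "\<alpha> \<ge> 0" "\<And>j. t j \<noteq> 0" "filterlim (\<lambda>j. \<bar>t j\<bar>) at_top F"
    and "((\<lambda>j. jacobi_fun (n j) \<alpha> (real (d j)) (x_of (t j))) \<longlongrightarrow> l) F"
  shows "((\<lambda>j. \<bar>t j\<bar> * laguerre_kernel \<alpha> (t j) (n j) (n j + d j)) \<longlongrightarrow> \<bar>l\<bar>) F"
proof -
  have "((\<lambda>j. \<bar>t j\<bar> / sqrt (1 + (t j)\<^sup>2) * \<bar>jacobi_fun (n j) \<alpha> (real (d j)) (x_of (t j))\<bar>) \<longlongrightarrow> 1 * \<bar>l\<bar>) F"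
    by (intro tendsto_mult abs_over_sqrt_tendsto tendsto_rabs assms)
  thus ?thesis by (simp add: laguerre_kernel_jacobi assms)
qed

lemma floor_ratio_tendsto:
  fixes x s :: "nat \<Rightarrow> real"
  assumes x: "x \<longlonglongrightarrow> l" and x0: "\<And>j. x j \<ge> 0" and s: "filterlim s at_top sequentially"
  shows "(\<lambda>j. real (nat \<lfloor>x j * s j\<rfloor>) / s j) \<longlonglongrightarrow> l"
proof (rule tendsto_sandwich)
  have pos: "eventually (\<lambda>j. s j > 0) sequentially"
    by (rule eventually_compose_filterlim[OF eventually_gt_at_top s])
  have fl: "real (nat \<lfloor>x j * s j\<rfloor>) = of_int \<lfloor>x j * s j\<rfloor>" if "s j > 0" for j
    using that x0[of j] by simp
  show "eventually (\<lambda>j. x j - 1 / s j \<le> real (nat \<lfloor>x j * s j\<rfloor>) / s j) sequentially"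
    using pos
  proof eventually_elim
    case (elim j)
    have "(x j * s j - 1) / s j \<le> real (nat \<lfloor>x j * s j\<rfloor>) / s j"
      unfolding fl[OF elim] using elim by (intro divide_right_mono) linarith+
    thus ?case using elim by (simp add: diff_divide_distrib)
  qed
  show "eventually (\<lambda>j. real (nat \<lfloor>x j * s j\<rfloor>) / s j \<le> x j) sequentially"
    using pos
  proof eventually_elim
    case (elim j)
    have "real (nat \<lfloor>x j * s j\<rfloor>) / s j \<le> (x j * s j) / s j"
      unfolding fl[OF elim] using elim by (intro divide_right_mono) linarith+
    thus ?case using elim by simp
  qed
  have "(\<lambda>j. x j - 1 / s j) \<longlonglongrightarrow> l - 0"
    by (intro tendsto_diff x real_tendsto_divide_at_top[OF tendsto_const s])
  thus "(\<lambda>j. x j - 1 / s j) \<longlonglongrightarrow> l" by simp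
qed (rule x)

theorem theorem11p4:
  fixes \<alpha> :: real
  assumes "\<alpha> \<ge> 0"
  shows
    "(\<forall>d::nat.
        (\<forall>(n :: nat \<Rightarrow> nat) (t :: nat \<Rightarrow> real) c.
           (\<forall>j. t j \<noteq> 0) \<longrightarrow> filterlim (\<lambda>j. \<bar>t j\<bar>) at_top sequentially \<longrightarrow> c > 0 \<longrightarrow>
           (\<lambda>j. real (n j) / \<bar>t j\<bar>) \<longlonglongrightarrow> c \<longrightarrow>
             (\<lambda>j. jacobi_fun (n j) \<alpha> (real d) (x_of (t j))) \<longlonglongrightarrow> bessel_J \<alpha> (2 * c) \<and>
             (\<lambda>j. \<bar>t j\<bar> * laguerre_kernel \<alpha> (t j) (n j) (n j + d)) \<longlonglongrightarrow> \<bar>bessel_J \<alpha> (2 * c)\<bar>) \<and>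
        (\<forall>(t :: nat \<Rightarrow> real) a b.
           (\<forall>j. t j \<noteq> 0) \<longrightarrow> filterlim (\<lambda>j. \<bar>t j\<bar>) at_top sequentially \<longrightarrow> 0 < a \<longrightarrow> a \<le> b \<longrightarrow>
             uniform_limit {a..b}
               (\<lambda>j c. jacobi_fun (nat \<lfloor>c * \<bar>t j\<bar>\<rfloor>) \<alpha> (real d) (x_of (t j)))
               (\<lambda>c. bessel_J \<alpha> (2 * c)) sequentially \<and>
             uniform_limit {a..b}
               (\<lambda>j c. \<bar>t j\<bar> * laguerre_kernel \<alpha> (t j) (nat \<lfloor>c * \<bar>t j\<bar>\<rfloor>) (nat \<lfloor>c * \<bar>t j\<bar>\<rfloor> + d))
               (\<lambda>c. \<bar>bessel_J \<alpha> (2 * c)\<bar>) sequentially))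
     \<and>
     (\<forall>k::nat.
        (\<forall>(d :: nat \<Rightarrow> nat) (t :: nat \<Rightarrow> real) u.
           (\<forall>j. t j \<noteq> 0) \<longrightarrow> filterlim d at_top sequentially \<longrightarrow>
           filterlim (\<lambda>j. \<bar>t j\<bar>) at_top sequentially \<longrightarrow> u \<ge> 0 \<longrightarrow>
           (\<lambda>j. real (d j) / (1 + (t j)\<^sup>2)) \<longlonglongrightarrow> u \<longrightarrow>
             (\<lambda>j. jacobi_fun k \<alpha> (real (d j)) (x_of (t j))) \<longlonglongrightarrow> laguerre_fun k \<alpha> u \<and>
             (\<lambda>j. \<bar>t j\<bar> * laguerre_kernel \<alpha> (t j) k (k + d j)) \<longlonglongrightarrow> \<bar>laguerre_fun k \<alpha> u\<bar>) \<and>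
        (\<forall>R>0. uniform_limit {0..R}
           (\<lambda>d u. jacobi_fun k \<alpha> (real d) (1 - 2 * u / real d))
           (\<lambda>u. laguerre_fun k \<alpha> u) sequentially))
     \<and>
     (\<forall>d::nat.
        (let \<phi> = (\<lambda>t. (\<alpha> + real d + 1) / 2 * theta_of t - (2 * \<alpha> + 1) / 4 * pi);
             err = (\<lambda>n t. laguerre_kernel \<alpha> t n (n + d) -
                      \<bar>cos (real n * theta_of t + \<phi> t)\<bar> / sqrt (pi * real n * \<bar>t\<bar>))
         in
           (\<forall>t. t \<noteq> 0 \<longrightarrow> (\<lambda>n. err n t) \<in> O(\<lambda>n. real n powr (- 3 / 2))) \<and>
           (\<forall>S. compact S \<longrightarrow> S \<subseteq> UNIV - {0} \<longrightarrow>
              (\<exists>C. \<forall>\<^sub>F n in sequentially. \<forall>t\<in>S. \<bar>err n t\<bar> \<le> C * real n powr (- 3 / 2)))))"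
proof (intro conjI allI impI)
  fix d :: nat and n :: "nat \<Rightarrow> nat" and t :: "nat \<Rightarrow> real" and c :: real
  assume t0: "\<forall>j. t j \<noteq> 0" and t: "filterlim (\<lambda>j. \<bar>t j\<bar>) at_top sequentially" and c: "c > 0"
    and nt: "(\<lambda>j. real (n j) / \<bar>t j\<bar>) \<longlonglongrightarrow> c"
  show J: "(\<lambda>j. jacobi_fun (n j) \<alpha> (real d) (x_of (t j))) \<longlonglongrightarrow> bessel_J \<alpha> (2 * c)"
    by (rule jacobi_fun_bessel_tendsto[OF assms t c nt])
  show "(\<lambda>j. \<bar>t j\<bar> * laguerre_kernel \<alpha> (t j) (n j) (n j + d)) \<longlonglongrightarrow> \<bar>bessel_J \<alpha> (2 * c)\<bar>"
    using t0 by (intro laguerre_kernel_tendsto[OF assms _ t J]) auto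
next
  fix d :: nat and t :: "nat \<Rightarrow> real" and a b :: real
  assume t0: "\<forall>j. t j \<noteq> 0" and t: "filterlim (\<lambda>j. \<bar>t j\<bar>) at_top sequentially" and ab: "0 < a" "a \<le> b"
  \<comment> \<open>Convergence along a subsequence with moving \<open>x j\<close>, as
    \<open>uniform_limit_compactI\<close> asks; rounding does not change the ratio in the
    limit.\<close>
  have lim: "(\<lambda>j. jacobi_fun (nat \<lfloor>x j * \<bar>t (r j)\<bar>\<rfloor>) \<alpha> (real d) (x_of (t (r j)))) \<longlonglongrightarrow> bessel_J \<alpha> (2 * l)"
    and tr: "filterlim (\<lambda>j. \<bar>t (r j)\<bar>) at_top sequentially"
    if "strict_mono r" "\<And>j. x j \<in> {a..b}" "l \<in> {a..b}" "x \<longlonglongrightarrow> l" for r :: "nat \<Rightarrow> nat" and x l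
  proof -
    show tr: "filterlim (\<lambda>j. \<bar>t (r j)\<bar>) at_top sequentially"
      by (rule filterlim_compose[OF t filterlim_subseq[OF that(1)]])
    have "x j \<ge> 0" for j using that(2)[of j] ab by simp
    hence "(\<lambda>j. real (nat \<lfloor>x j * \<bar>t (r j)\<bar>\<rfloor>) / \<bar>t (r j)\<bar>) \<longlonglongrightarrow> l"
      by (intro floor_ratio_tendsto that(4) tr)
    thus "(\<lambda>j. jacobi_fun (nat \<lfloor>x j * \<bar>t (r j)\<bar>\<rfloor>) \<alpha> (real d) (x_of (t (r j)))) \<longlonglongrightarrow> bessel_J \<alpha> (2 * l)"
      using that(3) ab by (intro jacobi_fun_bessel_tendsto[OF assms tr]) auto
  qed
  have cont: "continuous_on {a..b} (\<lambda>c. bessel_J \<alpha> (2 * c))"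
    using ab by (intro continuous_bessel_J assms) auto
  show "uniform_limit {a..b} (\<lambda>j c. jacobi_fun (nat \<lfloor>c * \<bar>t j\<bar>\<rfloor>) \<alpha> (real d) (x_of (t j)))
      (\<lambda>c. bessel_J \<alpha> (2 * c)) sequentially"
    by (rule uniform_limit_compactI[OF compact_Icc cont]) (rule lim)
  show "uniform_limit {a..b} (\<lambda>j c. \<bar>t j\<bar> * laguerre_kernel \<alpha> (t j) (nat \<lfloor>c * \<bar>t j\<bar>\<rfloor>) (nat \<lfloor>c * \<bar>t j\<bar>\<rfloor> + d))
      (\<lambda>c. \<bar>bessel_J \<alpha> (2 * c)\<bar>) sequentially"
  proof (rule uniform_limit_compactI[OF compact_Icc continuous_on_rabs[OF cont]])
    fix r :: "nat \<Rightarrow> nat" and x l assume *: "strict_mono r" "\<And>j. x j \<in> {a..b}" "l \<in> {a..b}" "x \<longlonglongrightarrow> l"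
    show "(\<lambda>j. \<bar>t (r j)\<bar> * laguerre_kernel \<alpha> (t (r j)) (nat \<lfloor>x j * \<bar>t (r j)\<bar>\<rfloor>) (nat \<lfloor>x j * \<bar>t (r j)\<bar>\<rfloor> + d))
        \<longlonglongrightarrow> \<bar>bessel_J \<alpha> (2 * l)\<bar>"
      by (rule laguerre_kernel_tendsto[OF assms _ tr[OF *] lim[OF *]]) (use t0 in auto)
  qed
next
  fix k :: nat and d :: "nat \<Rightarrow> nat" and t :: "nat \<Rightarrow> real" and u :: real
  assume t0: "\<forall>j. t j \<noteq> 0" and d: "filterlim d at_top sequentially"
    and t: "filterlim (\<lambda>j. \<bar>t j\<bar>) at_top sequentially" and u: "u \<ge> 0"
    and lim: "(\<lambda>j. real (d j) / (1 + (t j)\<^sup>2)) \<longlonglongrightarrow> u"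
  \<comment> \<open>With \<open>v = d / (1 + t\<^sup>2)\<close> the point
    \<open>1 - 2 * v / d\<close> is \<open>x_of t\<close> as soon as \<open>d\<close> is
    positive.\<close>
  have "(\<lambda>j. jacobi_fun k \<alpha> (real (d j)) (1 - 2 * (real (d j) / (1 + (t j)\<^sup>2)) / real (d j))) \<longlonglongrightarrow> laguerre_fun k \<alpha> u"
    by (rule jacobi_fun_laguerre_tendsto[OF assms d lim]) (auto simp: add_pos_nonneg)
  moreover have "eventually (\<lambda>j. jacobi_fun k \<alpha> (real (d j)) (1 - 2 * (real (d j) / (1 + (t j)\<^sup>2)) / real (d j)) =
      jacobi_fun k \<alpha> (real (d j)) (x_of (t j))) sequentially"
    using eventually_compose_filterlim[OF eventually_gt_at_top[of 0] d]
  proof eventually_elim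
    case (elim j)
    have "1 - 2 * (real (d j) / (1 + (t j)\<^sup>2)) / real (d j) = 1 - 2 * (1 / (1 + (t j)\<^sup>2))" using elim by simp
    also have "\<dots> = x_of (t j)" unfolding x_of_half(1)[symmetric] by (simp add: field_simps)
    finally show ?case by simp
  qed
  ultimately show J: "(\<lambda>j. jacobi_fun k \<alpha> (real (d j)) (x_of (t j))) \<longlonglongrightarrow> laguerre_fun k \<alpha> u"
    by (rule Lim_transform_eventually)
  show "(\<lambda>j. \<bar>t j\<bar> * laguerre_kernel \<alpha> (t j) k (k + d j)) \<longlonglongrightarrow> \<bar>laguerre_fun k \<alpha> u\<bar>"
    using t0 by (intro laguerre_kernel_tendsto[OF assms _ t J]) auto
next
  fix k :: nat and R :: real
  assume "R > 0"
  show "uniform_limit {0..R} (\<lambda>d u. jacobi_fun k \<alpha> (real d) (1 - 2 * u / real d)) (\<lambda>u. laguerre_fun k \<alpha> u) sequentially"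
  proof (rule uniform_limit_compactI[OF compact_Icc continuous_laguerre_fun[OF assms]])
    fix r :: "nat \<Rightarrow> nat" and x l assume *: "strict_mono r" "\<And>j. x j \<in> {0..R}" "l \<in> {0..R}" "x \<longlonglongrightarrow> l"
    show "(\<lambda>j. jacobi_fun k \<alpha> (real (r j)) (1 - 2 * x j / real (r j))) \<longlonglongrightarrow> laguerre_fun k \<alpha> l"
      using *(2) by (intro jacobi_fun_laguerre_tendsto[OF assms filterlim_subseq[OF *(1)] *(4)]) auto
  qed
next
  fix d :: nat
  define \<phi> where "\<phi> = (\<lambda>t. (\<alpha> + real d + 1) / 2 * theta_of t - (2 * \<alpha> + 1) / 4 * pi)"
  define err where "err = (\<lambda>n t. laguerre_kernel \<alpha> t n (n + d) -
    \<bar>cos (real n * theta_of t + \<phi> t)\<bar> / sqrt (pi * real n * \<bar>t\<bar>))"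
  have unif: "\<exists>C. \<forall>\<^sub>F n in sequentially. \<forall>t\<in>S. \<bar>err n t\<bar> \<le> C * real n powr (- 3 / 2)"
    if S: "compact S" "S \<subseteq> UNIV - {0}" for S
  proof -
    have "\<phi> t = darboux_phase \<alpha> (real d) (theta_of t)" for t by (simp add: \<phi>_def darboux_phase_def)
    with laguerre_kernel_darboux[OF assms S, of d] obtain C
      where "\<forall>n\<ge>1. \<forall>t\<in>S. \<bar>err n t\<bar> \<le> C * real n powr (- 3 / 2)" unfolding err_def by auto
    thus ?thesis unfolding eventually_sequentially by blast
  qed
  have pointwise: "(\<lambda>n. err n t) \<in> O(\<lambda>n. real n powr (- 3 / 2))" if t: "t \<noteq> 0" for t
  proof -
    \<comment> \<open>A single time is a compact set, so the pointwise estimate is a case of the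
      uniform one.\<close>
    obtain C where "\<forall>\<^sub>F n in sequentially. \<forall>s\<in>{t}. \<bar>err n s\<bar> \<le> C * real n powr (- 3 / 2)"
      using unif[of "{t}"] t by auto
    thus ?thesis by (intro bigoI[of _ C]) (auto elim!: eventually_mono)
  qed
  have "\<forall>t. t \<noteq> 0 \<longrightarrow> (\<lambda>n. err n t) \<in> O(\<lambda>n. real n powr (- 3 / 2))"
    "\<forall>S. compact S \<longrightarrow> S \<subseteq> UNIV - {0} \<longrightarrow>
      (\<exists>C. \<forall>\<^sub>F n in sequentially. \<forall>t\<in>S. \<bar>err n t\<bar> \<le> C * real n powr (- 3 / 2))"
    by (intro allI impI pointwise unif; assumption)+
  thus "let \<phi> = (\<lambda>t. (\<alpha> + real d + 1) / 2 * theta_of t - (2 * \<alpha> + 1) / 4 * pi);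
      err = (\<lambda>n t. laguerre_kernel \<alpha> t n (n + d) - \<bar>cos (real n * theta_of t + \<phi> t)\<bar> / sqrt (pi * real n * \<bar>t\<bar>))
    in (\<forall>t. t \<noteq> 0 \<longrightarrow> (\<lambda>n. err n t) \<in> O(\<lambda>n. real n powr (- 3 / 2))) \<and>
      (\<forall>S. compact S \<longrightarrow> S \<subseteq> UNIV - {0} \<longrightarrow>
        (\<exists>C. \<forall>\<^sub>F n in sequentially. \<forall>t\<in>S. \<bar>err n t\<bar> \<le> C * real n powr (- 3 / 2)))"
    unfolding Let_def err_def \<phi>_def by (rule conjI)
qed

end
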